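(* Let $f=(f_1,\ldots,f_n)$ be an $n$-tuple of formal power series with the model property and let $(M_{Z_1},\ldots,M_{Z_n})$ be the universal model associated with the noncommutative domain $\mathbb B_f$. If $T=(T_1,\ldots,T_n)$ is a pure $n$-tuple of operators in $\mathbb B_f(\mathcal H)$, then the characteristic function $\Theta_{f,T}$ is an isometry and $T$ is unitarily equivalent to the $n$-tuple $$\big(P_{\mathbf H_{f,T}}(M_{Z_1}\otimes I_{\mathcal D_{f,T}})|_{\mathbf H_{f,T}},\ldots,P_{\mathbf H_{f,T}}(M_{Z_n}\otimes I_{\mathcal D_{f,T}})|_{\mathbf H_{f,T}}\big),$$ where $P_{\mathbf H_{f,T}}$ is the orthogonal projection of $\mathbb H^2(f)\otimes\mathcal D_{f,T}$ onto the Hilbert space $$\mathbf H_{f,T}:=\big(\mathbb H^2(f)\otimes\mathcal D_{f,T}\big)\ominus\Theta_{f,T}\big(\mathbb H^2(f)\otimes\mathcal D_{f,T^*}\big).$$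
   Context: Notation. $\mathbb F_n^+$ is the free semigroup on $g_1,\ldots,g_n$ with identity $g_0$ and length $|\cdot|$. For an $n$-tuple $X$ of elements of a unital algebra, $X_\alpha=X_{i_1}\cdots X_{i_k}$ if $\alpha=g_{i_1}\cdots g_{i_k}$, $X_{g_0}=I$; $[f(X)]_\alpha$ is the corresponding product of $f_1(X),\ldots,f_n(X)$. A tuple $X\in B(\mathcal H)^n$ is viewed as a row operator $\mathcal H^{(n)}\to\mathcal H$, so $\|X\|=\|\sum X_iX_i^*\|^{1/2}$; $[B(\mathcal H)^n]_\gamma=\{X:\|X\|<\gamma\}$. A free holomorphic function on $[B(\mathcal H)^n]_\gamma$ is a formal power series $\sum a_\alpha Z_\alpha$ in noncommuting indeterminates (complex coefficients) with radius of convergence $r$, $r^{-1}=\limsup_k(\sum_{|\alpha|=k}|a_\alpha|^2)^{1/2k}$, at least $\gamma$, identified with the map $X\mapsto\sum_k\sum_{|\alpha|=k}a_\alpha X_\alpha$ (norm convergence; $\mathcal H$ separable infinite-dimensional). $H^2_{\bf ball}$ is the Hilbert space of series with $\sum|a_\alpha|^2<\infty$ (the $Z_\alpha$ being orthonormal). Convergence sets. For an $n$-tuple $f$ of formal power series $f_j=\sum c^{(j)}_\alpha Z_\alpha$ and a Hilbert space $\mathcal H$: $\mathcal C_f^{SOT}(\mathcal H)$ is the set of $X\in B(\mathcal H)^n$ such that each series $f_j(X):=\sum_k\sum_{|\alpha|=k}c^{(j)}_\alpha X_\alpha$ is SOT-convergent; $\mathcal C_f^{rad}(\mathcal H)$ is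 the set of $X$ such that for some $\delta\in(0,1)$ these series converge in norm at $rX$ for all $r\in(\delta,1)$ and $f_j(X):=\text{SOT-}\lim_{r\to1}f_j(rX)$ exists for each $j$. Model property. $f=(f_1,\ldots,f_n)$ has the model property if one of the following holds. (A) $f$ is an $n$-tuple of noncommutative polynomials for which there is an $n$-tuple $g$ of noncommutative polynomials with $f\circ g=g\circ f=\mathrm{id}$. Then $\{f_\alpha\}$ is a linear basis of $\mathbb C[Z_1,\ldots,Z_n]$ and $\mathbb H^2(f)$ is the completion of $\mathbb C[Z_1,\ldots,Z_n]$ for the inner product $\langle f_\alpha,f_\beta\rangle=\delta_{\alpha\beta}$. (S) $f$ is an $n$-tuple of formal power series with $f(0)=0$, nonzero radius of convergence and $\det J_f(0)\neq0$ ($J_f(0)_{ij}$ is the coefficient of $Z_j$ in $f_i$); $\mathbb H^2(f)$ is the Hilbert space of formal power series $\sum a_\alpha f_\alpha$, $\sum|a_\alpha|^2<\infty$, with $\{f_\alpha\}$ orthonormal; $Z_1,\ldots,Z_n\in\mathbb H^2(f)$; left multiplication $M_{Z_i}$ by $Z_i$ is bounded on $\mathbb H^2(f)$; and $M_Z=(M_{Z_1},\ldots,M_{Z_n})$ belongs to $\mathcal C_f^{SOT}(\mathbb H^2(f))$ or $\mathcal C_f^{rad}(\mathbb H^2(f))$ with $f_j(M_Z)=M_{f_j}$ (left multiplication by $f_j$), $j=1,\ldots,n$. (F) $f$ is an $n$-tuple of free holomorphic functions on some $[B(\mathcal H)^n]_\gamma$, $\gamma>0$, with range in $[B(\mathcal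 H)^n]_1$, such that $G\circ f\not\equiv0$ for every nonzero free holomorphic $G$ on $[B(\mathcal H)^n]_1$; $\mathbb H^2(f)=\{G\circ f:G\in H^2_{\bf ball}\}$ with $\langle F\circ f,G\circ f\rangle=\langle F,G\rangle$; the coordinate functions $Z_1,\ldots,Z_n$ lie in $\mathbb H^2(f)$, left multiplications $M_{Z_i}$ by them are bounded on $\mathbb H^2(f)$, and $M_Z$ is in $\mathcal C_f^{SOT}(\mathbb H^2(f))$ or $\mathcal C_f^{rad}(\mathbb H^2(f))$ with $f_j(M_Z)=M_{f_j}$ for all $j$. In all cases $\{f_\alpha\}_{\alpha\in\mathbb F_n^+}$ is an orthonormal basis of $\mathbb H^2(f)$, and $M_Z$ is called the universal model. Writing $Z_i=\sum_\alpha a^{(i)}_\alpha f_\alpha$ in $\mathbb H^2(f)$, one has $M_{Z_i}f_\beta=\sum_\alpha a^{(i)}_\alpha f_{\alpha\beta}$, and $g_i:=\sum_\alpha a^{(i)}_\alpha Z_\alpha$ defines the inverse $g=(g_1,\ldots,g_n)$ of $f$ with respect to composition. Domain. $X\in B(\mathcal H)^n$ satisfies $g(f(X))=X$ if $X\in\mathcal C_f^{SOT}(\mathcal H)\cup\mathcal C_f^{rad}(\mathcal H)$ and either (for all $i$) $X_i=\sum_k\sum_{|\alpha|=k}a^{(i)}_\alpha[f(X)]_\alpha$ in the SOT, or (for all $i$) $X_i=\text{SOT-}\lim_{r\to1}\sum_k\sum_{|\alpha|=k}a^{(i)}_\alpha r^{|\alpha|}[f(X)]_\alpha$ (automatic in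 case (A)). Then $\mathbb B_f(\mathcal H):=\{X\in B(\mathcal H)^n:\ g(f(X))=X,\ \|f(X)\|\le1\}$. $T\in\mathbb B_f(\mathcal H)$ is pure if $\text{SOT-}\lim_{k\to\infty}\sum_{|\alpha|=k}[f(T)]_\alpha[f(T)]_\alpha^*=0$. Characteristic function. For $T\in\mathbb B_f(\mathcal H)$ let $f(T)=[f_1(T),\ldots,f_n(T)]:\mathcal H^{(n)}\to\mathcal H$, $\Delta_{f,T}:=(I_{\mathcal H}-\sum_if_i(T)f_i(T)^* )^{1/2}\in B(\mathcal H)$, $\Delta_{f,T^*}:=(I-f(T)^*f(T))^{1/2}\in B(\mathcal H^{(n)})$, $\mathcal D_{f,T}:=\overline{\Delta_{f,T}\mathcal H}$, $\mathcal D_{f,T^*}:=\overline{\Delta_{f,T^*}\mathcal H^{(n)}}$, and let $\Lambda_i$ be right multiplication by $f_i$ on $\mathbb H^2(f)$, $\Lambda_if_\alpha=f_{\alpha g_i}$. The characteristic function $\Theta_{f,T}:\mathbb H^2(f)\otimes\mathcal D_{f,T^*}\to\mathbb H^2(f)\otimes\mathcal D_{f,T}$ is the bounded operator (satisfying $\Theta_{f,T}(M_{Z_i}\otimes I)=(M_{Z_i}\otimes I)\Theta_{f,T}$ for all $i$) with formal Fourier representation $$-I\otimes f(T)+(I\otimes\Delta_{f,T})\Big(I-\sum_{i=1}^n\Lambda_i\otimes f_i(T)^*\Big)^{-1}[\Lambda_1\otimes I_{\mathcal H},\ldots,\Lambda_n\otimes I_{\mathcal H}](I\otimes\Delta_{f,T^*}),$$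 i.e. it is the SOT-limit as $r\to1$ of the operators obtained by replacing each $\Lambda_i$ by $r\Lambda_i$. Two $n$-tuples $(A_i)\subset B(\mathcal H)$, $(B_i)\subset B(\mathcal K)$ are unitarily equivalent if there is a unitary $U:\mathcal H\to\mathcal K$ with $A_i=U^*B_iU$ for all $i$. *)

theory Defs
  imports "HOL-Analysis.Analysis"
begin

section \<open>Complex Hilbert spaces\<close>

text \<open>
  A complex Hilbert space is a complete real inner product space that carries a complex scalar
  multiplication and a complex inner product (linear in its first argument) inducing the given
  real structure; norm, topology and completeness are those of the library classes.
\<close>

class chilbert = real_inner + complete_space +
  fixes scaleC :: "complex \<Rightarrow> 'a \<Rightarrow> 'a" (infixr "*\<^sub>C" 75)
    and cinner :: "'a \<Rightarrow> 'a \<Rightarrow> complex"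
  assumes scaleC_add_right: "c *\<^sub>C (x + y) = c *\<^sub>C x + c *\<^sub>C y"
    and scaleC_add_left: "(c + d) *\<^sub>C x = c *\<^sub>C x + d *\<^sub>C x"
    and scaleC_scaleC: "c *\<^sub>C d *\<^sub>C x = (c * d) *\<^sub>C x"
    and scaleR_scaleC: "r *\<^sub>R x = complex_of_real r *\<^sub>C x"
    and cinner_commute: "cinner x y = cnj (cinner y x)"
    and cinner_add_left: "cinner (x + y) z = cinner x z + cinner y z"
    and cinner_scaleC_left: "cinner (c *\<^sub>C x) y = c * cinner x y"
    and inner_cinner: "inner x y = Re (cinner x y)"

instantiation complex :: chilbert
begin
definition "scaleC_complex = ((*) :: complex \<Rightarrow> complex \<Rightarrow> complex)"
definition "cinner_complex x y = x * cnj (y :: complex)"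
instance
  by intro_classes
    (auto simp: scaleC_complex_def cinner_complex_def algebra_simps scaleR_conv_of_real
      inner_complex_def)
end

text \<open>The direct sum \<open>H\<^sup>(\<^sup>n\<^sup>)\<close> is the type \<open>'h ^ 'n\<close>.\<close>

instantiation vec :: (chilbert, finite) chilbert
begin
definition "scaleC_vec c (x :: 'a ^ 'b) = (\<chi> i. c *\<^sub>C (x $ i))"
definition "cinner_vec (x :: 'a ^ 'b) y = (\<Sum>i\<in>UNIV. cinner (x $ i) (y $ i))"
instance
proof intro_classes
  fix x y z :: "'a ^ 'b" and c d :: complex and r :: real
  show "c *\<^sub>C (x + y) = c *\<^sub>C x + c *\<^sub>C y"
    by (simp add: scaleC_vec_def vec_eq_iff scaleC_add_right)
  show "(c + d) *\<^sub>C x = c *\<^sub>C x + d *\<^sub>C x"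
    by (simp add: scaleC_vec_def vec_eq_iff scaleC_add_left)
  show "c *\<^sub>C d *\<^sub>C x = (c * d) *\<^sub>C x"
    by (simp add: scaleC_vec_def vec_eq_iff scaleC_scaleC)
  show "r *\<^sub>R x = complex_of_real r *\<^sub>C x"
    by (simp add: scaleC_vec_def vec_eq_iff scaleR_scaleC)
  show "cinner x y = cnj (cinner y x)"
    unfolding cinner_vec_def cnj_sum by (intro sum.cong refl cinner_commute)
  show "cinner (x + y) z = cinner x z + cinner y z"
    by (simp add: cinner_vec_def cinner_add_left sum.distrib)
  show "cinner (c *\<^sub>C x) y = c * cinner x y"
    by (simp add: cinner_vec_def scaleC_vec_def cinner_scaleC_left sum_distrib_left)
  show "inner x y = Re (cinner x y)"
    by (simp add: cinner_vec_def inner_vec_def inner_cinner)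
qed
end

lemma norm_scaleC: "norm (c *\<^sub>C x) = cmod c * norm (x :: 'a::chilbert)"
proof -
  have 1: "cinner x (c *\<^sub>C x) = cnj c * cinner x x"
    by (subst cinner_commute, simp add: cinner_scaleC_left, subst cinner_commute, simp)
  have "cinner (c *\<^sub>C x) (c *\<^sub>C x) = c * cnj c * cinner x x"
    by (simp only: cinner_scaleC_left 1 mult.assoc)
  also have "\<dots> = complex_of_real ((cmod c)\<^sup>2) * cinner x x"
    by (simp only: complex_norm_square)
  finally have "inner (c *\<^sub>C x) (c *\<^sub>C x) = (cmod c)\<^sup>2 * inner x x"
    unfolding inner_cinner by simp
  thus ?thesis by (simp add: norm_eq_sqrt_inner real_sqrt_mult)
qed

lemma cmod_cinner_le: "cmod (cinner x y) \<le> norm x * norm (y :: 'a::chilbert)"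
proof (cases "cinner x y = 0")
  case False
  define u where "u = cnj (cinner x y) / cmod (cinner x y)"
  have "cmod u = 1" using False by (simp add: u_def norm_divide)
  have "cinner (u *\<^sub>C x) y = (cinner x y * cnj (cinner x y)) / cmod (cinner x y)"
    by (simp add: cinner_scaleC_left u_def)
  also have "\<dots> = complex_of_real ((cmod (cinner x y))\<^sup>2 / cmod (cinner x y))"
    by (simp only: complex_norm_square of_real_divide)
  also have "(cmod (cinner x y))\<^sup>2 / cmod (cinner x y) = cmod (cinner x y)"
    using False by (simp add: power2_eq_square)
  finally have "cinner (u *\<^sub>C x) y = cmod (cinner x y)" .
  hence "cmod (cinner x y) = inner (u *\<^sub>C x) y" by (simp add: inner_cinner)
  also have "\<dots> \<le> norm (u *\<^sub>C x) * norm y" by (rule norm_cauchy_schwarz)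
  finally show ?thesis by (simp add: norm_scaleC \<open>cmod u = 1\<close>)
qed simp


subsection \<open>The Hilbert space \<open>\<ell>\<^sup>2(A; H)\<close>\<close>

typedef (overloaded) ('a, 'h) l2 =
  "{u :: 'a \<Rightarrow> 'h::chilbert. (\<lambda>a. (norm (u a))\<^sup>2) summable_on UNIV}"
  morphisms coef Abs_l2
  by (rule exI[of _ "\<lambda>_. 0"]) simp

setup_lifting type_definition_l2

lemma l2_summable: "(\<lambda>a. (norm (coef u a))\<^sup>2) summable_on UNIV"
  using coef[of u] by simp

lemma sq_summable_bound:
  fixes g :: "'a \<Rightarrow> real"
  assumes "g summable_on UNIV" "\<And>a. 0 \<le> h a" "\<And>a. h a \<le> g a"
  shows "h summable_on UNIV"
proof (rule nonneg_bdd_above_summable_on)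
  show "bdd_above (sum h ` {F. F \<subseteq> UNIV \<and> finite F})"
  proof (rule bdd_aboveI2)
    fix F :: "'a set" assume F: "F \<in> {F. F \<subseteq> UNIV \<and> finite F}"
    have "sum h F \<le> sum g F" by (rule sum_mono) (rule assms(3))
    also have "\<dots> \<le> infsum g UNIV"
      using F by (intro finite_sum_le_infsum assms(1) order_trans[OF assms(2,3)]) simp_all
    finally show "sum h F \<le> infsum g UNIV" .
  qed
qed (rule assms(2))

lemma sq_summable_add:
  fixes u v :: "'a \<Rightarrow> 'h::real_inner"
  assumes "(\<lambda>a. (norm (u a))\<^sup>2) summable_on UNIV" "(\<lambda>a. (norm (v a))\<^sup>2) summable_on UNIV"
  shows "(\<lambda>a. (norm (u a + v a))\<^sup>2) summable_on UNIV"
proof (rule sq_summable_bound)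
  show "(\<lambda>a. 2 * ((norm (u a))\<^sup>2 + (norm (v a))\<^sup>2)) summable_on UNIV"
    by (rule summable_on_cmult_right[OF summable_on_add[OF assms]])
next
  fix a
  show "0 \<le> (norm (u a + v a))\<^sup>2" by (rule zero_le_power2)
  have *: "(p + q)\<^sup>2 \<le> 2 * (p\<^sup>2 + q\<^sup>2)" for p q :: real
    using sum_squares_bound[of p q] unfolding power2_sum distrib_left by linarith
  have "(norm (u a + v a))\<^sup>2 \<le> (norm (u a) + norm (v a))\<^sup>2"
    by (rule power_mono[OF norm_triangle_ineq norm_ge_zero])
  also have "\<dots> \<le> 2 * ((norm (u a))\<^sup>2 + (norm (v a))\<^sup>2)" by (rule *)
  finally show "(norm (u a + v a))\<^sup>2 \<le> 2 * ((norm (u a))\<^sup>2 + (norm (v a))\<^sup>2)" .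
qed

lemma l2_cinner_summable:
  "(\<lambda>a. cinner (coef u a) (coef v a)) summable_on UNIV"
proof -
  have "(\<lambda>a. cmod (cinner (coef u a) (coef v a))) summable_on UNIV"
  proof (rule sq_summable_bound)
    show "(\<lambda>a. (norm (coef u a))\<^sup>2 + (norm (coef v a))\<^sup>2) summable_on UNIV"
      by (intro summable_on_add l2_summable)
    show "cmod (cinner (coef u a) (coef v a)) \<le> (norm (coef u a))\<^sup>2 + (norm (coef v a))\<^sup>2" for a
    proof -
      have "cmod (cinner (coef u a) (coef v a)) \<le> norm (coef u a) * norm (coef v a)"
        by (rule cmod_cinner_le)
      also have "\<dots> \<le> 2 * norm (coef u a) * norm (coef v a)" by simp
      also have "\<dots> \<le> (norm (coef u a))\<^sup>2 + (norm (coef v a))\<^sup>2" by (rule sum_squares_bound)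
      finally show ?thesis .
    qed
  qed (rule norm_ge_zero)
  thus ?thesis by (rule Infinite_Sum.abs_summable_summable)
qed

instantiation l2 :: (type, chilbert) real_inner
begin
lift_definition zero_l2 :: "('a, 'b) l2" is "\<lambda>_. 0" by simp
lift_definition plus_l2 :: "('a, 'b) l2 \<Rightarrow> ('a, 'b) l2 \<Rightarrow> ('a, 'b) l2"
  is "\<lambda>u v a. u a + v a" by (rule sq_summable_add)
lift_definition uminus_l2 :: "('a, 'b) l2 \<Rightarrow> ('a, 'b) l2" is "\<lambda>u a. - u a" by simp
lift_definition minus_l2 :: "('a, 'b) l2 \<Rightarrow> ('a, 'b) l2 \<Rightarrow> ('a, 'b) l2"
  is "\<lambda>u v a. u a - v a"
  subgoal for u v using sq_summable_add[of u "\<lambda>a. - v a"] by simp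
  done
lift_definition scaleR_l2 :: "real \<Rightarrow> ('a, 'b) l2 \<Rightarrow> ('a, 'b) l2" is "\<lambda>r u a. r *\<^sub>R u a"
  by (simp add: power_mult_distrib summable_on_cmult_right)
definition inner_l2 :: "('a, 'b) l2 \<Rightarrow> ('a, 'b) l2 \<Rightarrow> real"
  where "inner_l2 u v = Re (\<Sum>\<^sub>\<infinity>a. cinner (coef u a) (coef v a))"
definition norm_l2 :: "('a, 'b) l2 \<Rightarrow> real" where "norm_l2 u = sqrt (inner u u)"
definition dist_l2 :: "('a, 'b) l2 \<Rightarrow> ('a, 'b) l2 \<Rightarrow> real" where "dist_l2 u v = norm (u - v)"
definition sgn_l2 :: "('a, 'b) l2 \<Rightarrow> ('a, 'b) l2" where "sgn_l2 u = inverse (norm u) *\<^sub>R u"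
definition uniformity_l2 :: "(('a, 'b) l2 \<times> ('a, 'b) l2) filter"
  where "uniformity_l2 = (INF e\<in>{0<..}. principal {(x, y). dist x y < e})"
definition open_l2 :: "('a, 'b) l2 set \<Rightarrow> bool"
  where "open_l2 U = (\<forall>x\<in>U. eventually (\<lambda>(x', y). x' = x \<longrightarrow> y \<in> U) uniformity)"

instance
proof intro_classes
  fix u v w :: "('a, 'b) l2" and r s :: real
  show "u + v + w = u + (v + w)" by transfer (simp add: add.assoc)
  show "u + v = v + u" by transfer (simp add: add.commute)
  show "0 + u = u" by transfer simp
  show "- u + u = 0" by transfer simp
  show "u - v = u + - v" by transfer simp
  show "r *\<^sub>R (u + v) = r *\<^sub>R u + r *\<^sub>R v" by transfer (simp add: scaleR_add_right)
  show "(r + s) *\<^sub>R u = r *\<^sub>R u + s *\<^sub>R u" by transfer (simp add: scaleR_add_left)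
  show "r *\<^sub>R s *\<^sub>R u = (r * s) *\<^sub>R u" by transfer simp
  show "1 *\<^sub>R u = u" by transfer simp
  show "dist u v = norm (u - v)" by (rule dist_l2_def)
  show "sgn u = inverse (norm u) *\<^sub>R u" by (rule sgn_l2_def)
  show "(uniformity :: (('a, 'b) l2 \<times> ('a, 'b) l2) filter)
      = (INF e\<in>{0<..}. principal {(x, y). dist x y < e})" by (rule uniformity_l2_def)
  show "open U = (\<forall>x\<in>U. \<forall>\<^sub>F (x', y) in uniformity. x' = x \<longrightarrow> y \<in> U)"
    for U :: "('a, 'b) l2 set" by (rule open_l2_def)
  show "norm u = sqrt (inner u u)" by (rule norm_l2_def)
  have inn: "inner x y = (\<Sum>\<^sub>\<infinity>a. inner (coef x a) (coef y a))" for x y :: "('a, 'b) l2"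
    unfolding inner_l2_def inner_cinner by (rule infsum_Re[OF l2_cinner_summable, symmetric])
  have sm: "(\<lambda>a. inner (coef x a) (coef y a)) summable_on UNIV" for x y :: "('a, 'b) l2"
    unfolding inner_cinner by (rule summable_on_Re[OF l2_cinner_summable])
  show "inner u v = inner v u" by (simp add: inn inner_commute)
  show "inner (u + v) w = inner u w + inner v w"
    by (simp add: inn plus_l2.rep_eq inner_add_left infsum_add sm)
  show "inner (r *\<^sub>R u) v = r * inner u v"
    by (simp add: inn scaleR_l2.rep_eq infsum_cmult_right')
  show pos: "0 \<le> inner u u" by (simp add: inn infsum_nonneg)
  show "inner u u = 0 \<longleftrightarrow> u = 0"
  proof
    assume "inner u u = 0"
    hence "inner (coef u a) (coef u a) = 0" for a
      using nonneg_infsum_le_0D[of "\<lambda>a. inner (coef u a) (coef u a)" UNIV a] sm[of u u]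
      by (simp add: inn)
    thus "u = 0" by transfer auto
  qed (simp add: inn zero_l2.rep_eq)
qed
end

lemma norm_l2_sq: "(norm u)\<^sup>2 = (\<Sum>\<^sub>\<infinity>a. (norm (coef u a))\<^sup>2)"
proof -
  have "(norm u)\<^sup>2 = inner u u" by (rule power2_norm_eq_inner)
  also have "\<dots> = (\<Sum>\<^sub>\<infinity>a. Re (cinner (coef u a) (coef u a)))"
    unfolding inner_l2_def by (rule infsum_Re[OF l2_cinner_summable, symmetric])
  finally show ?thesis by (simp add: inner_cinner[symmetric] power2_norm_eq_inner)
qed

lemma norm_coef_le: "norm (coef u a) \<le> norm u"
proof -
  have "(\<Sum>x\<in>{a}. (norm (coef u x))\<^sup>2) \<le> (norm u)\<^sup>2"
    unfolding norm_l2_sq by (rule finite_sum_le_infsum[OF l2_summable]) auto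
  hence "(norm (coef u a))\<^sup>2 \<le> (norm u)\<^sup>2" by simp
  thus ?thesis by (rule power2_le_imp_le) simp
qed

instance l2 :: (type, chilbert) complete_space
proof
  fix X :: "nat \<Rightarrow> ('a, 'b) l2"
  assume C: "Cauchy X"
  have "Cauchy (\<lambda>n. coef (X n) a)" for a
  proof (rule CauchyI)
    fix e :: real assume "e > 0"
    then obtain N where N: "\<And>m n. m \<ge> N \<Longrightarrow> n \<ge> N \<Longrightarrow> norm (X m - X n) < e"
      using CauchyD[OF C] by blast
    have "norm (coef (X m) a - coef (X n) a) < e" if "m \<ge> N" "n \<ge> N" for m n
      using norm_coef_le[of "X m - X n" a] N[OF that] by (simp add: minus_l2.rep_eq)
    thus "\<exists>N. \<forall>m\<ge>N. \<forall>n\<ge>N. norm (coef (X m) a - coef (X n) a) < e" by blast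
  qed
  hence "\<exists>l. (\<lambda>n. coef (X n) a) \<longlonglongrightarrow> l" for a
    using Cauchy_convergent_iff convergent_def by blast
  then obtain v where v: "\<And>a. (\<lambda>n. coef (X n) a) \<longlonglongrightarrow> v a" by metis
  have key: "\<exists>N. \<forall>n\<ge>N. \<forall>F. finite F \<longrightarrow> (\<Sum>a\<in>F. (norm (coef (X n) a - v a))\<^sup>2) \<le> e\<^sup>2"
    if "e > 0" for e
  proof -
    obtain N where N: "\<And>m n. m \<ge> N \<Longrightarrow> n \<ge> N \<Longrightarrow> norm (X m - X n) < e"
      using CauchyD[OF C \<open>e > 0\<close>] by blast
    have "(\<Sum>a\<in>F. (norm (coef (X n) a - v a))\<^sup>2) \<le> e\<^sup>2" if "n \<ge> N" "finite F" for n F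
    proof (rule LIMSEQ_le_const2)
      show "(\<lambda>m. \<Sum>a\<in>F. (norm (coef (X n) a - coef (X m) a))\<^sup>2)
          \<longlonglongrightarrow> (\<Sum>a\<in>F. (norm (coef (X n) a - v a))\<^sup>2)"
        by (intro tendsto_sum tendsto_power tendsto_norm tendsto_diff tendsto_const v)
      have "(\<Sum>a\<in>F. (norm (coef (X n) a - coef (X m) a))\<^sup>2) \<le> e\<^sup>2" if "m \<ge> N" for m
      proof -
        have "(\<Sum>a\<in>F. (norm (coef (X n - X m) a))\<^sup>2) \<le> (norm (X n - X m))\<^sup>2"
          unfolding norm_l2_sq
          by (rule finite_sum_le_infsum[OF l2_summable]) (use \<open>finite F\<close> in auto)
        also have "\<dots> \<le> e\<^sup>2" using N[OF \<open>n \<ge> N\<close> that] by (intro power_mono) auto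
        finally show ?thesis by (simp add: minus_l2.rep_eq)
      qed
      thus "\<exists>N. \<forall>m\<ge>N. (\<Sum>a\<in>F. (norm (coef (X n) a - coef (X m) a))\<^sup>2) \<le> e\<^sup>2" by blast
    qed
    thus ?thesis by blast
  qed
  have diff: "(\<lambda>a. (norm (coef (X n) a - v a))\<^sup>2) summable_on UNIV"
    if "\<And>F. finite F \<Longrightarrow> (\<Sum>a\<in>F. (norm (coef (X n) a - v a))\<^sup>2) \<le> e\<^sup>2" for n and e :: real
    by (rule nonneg_bdd_above_summable_on) (auto intro!: bdd_aboveI2 that)
  obtain N1 where N1:
    "\<And>F. finite F \<Longrightarrow> (\<Sum>a\<in>F. (norm (coef (X N1) a - v a))\<^sup>2) \<le> 1\<^sup>2"
    using key[of 1] by auto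
  have "(\<lambda>a. (norm (coef (X N1) a + - (coef (X N1) a - v a)))\<^sup>2) summable_on UNIV"
    by (rule sq_summable_add[OF l2_summable])
      (use diff[OF N1] in \<open>simp add: norm_minus_commute\<close>)
  hence "(\<lambda>a. (norm (v a))\<^sup>2) summable_on UNIV" by simp
  then obtain L where L: "coef L = v" using Abs_l2_inverse by blast
  have "X \<longlonglongrightarrow> L"
  proof (rule LIMSEQ_I)
    fix r :: real assume "r > 0"
    hence "r / 2 > 0" by simp
    then obtain N where N: "\<And>n F. n \<ge> N \<Longrightarrow> finite F
        \<Longrightarrow> (\<Sum>a\<in>F. (norm (coef (X n) a - v a))\<^sup>2) \<le> (r / 2)\<^sup>2"
      using key by blast
    have "norm (X n - L) < r" if "n \<ge> N" for n
    proof -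
      have "(norm (X n - L))\<^sup>2 \<le> (r / 2)\<^sup>2"
        unfolding norm_l2_sq
        by (rule infsum_le_finite_sums[OF l2_summable]) (simp add: minus_l2.rep_eq L N that)
      hence "norm (X n - L) \<le> r / 2" by (rule power2_le_imp_le) (use \<open>r > 0\<close> in simp)
      thus ?thesis using \<open>r > 0\<close> by simp
    qed
    thus "\<exists>N. \<forall>n\<ge>N. norm (X n - L) < r" by blast
  qed
  thus "convergent X" by (rule convergentI)
qed

instantiation l2 :: (type, chilbert) chilbert
begin
lift_definition scaleC_l2 :: "complex \<Rightarrow> ('a, 'b) l2 \<Rightarrow> ('a, 'b) l2" is "\<lambda>c u a. c *\<^sub>C u a"
  by (simp add: norm_scaleC power_mult_distrib summable_on_cmult_right)
definition cinner_l2 :: "('a, 'b) l2 \<Rightarrow> ('a, 'b) l2 \<Rightarrow> complex"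
  where "cinner_l2 u v = (\<Sum>\<^sub>\<infinity>a. cinner (coef u a) (coef v a))"
instance
proof intro_classes
  fix x y z :: "('a, 'b) l2" and c d :: complex and r :: real
  show "c *\<^sub>C (x + y) = c *\<^sub>C x + c *\<^sub>C y" by transfer (simp add: scaleC_add_right)
  show "(c + d) *\<^sub>C x = c *\<^sub>C x + d *\<^sub>C x" by transfer (simp add: scaleC_add_left)
  show "c *\<^sub>C d *\<^sub>C x = (c * d) *\<^sub>C x" by transfer (simp add: scaleC_scaleC)
  show "r *\<^sub>R x = complex_of_real r *\<^sub>C x" by transfer (simp add: scaleR_scaleC)
  show "cinner x y = cnj (cinner y x)"
    unfolding cinner_l2_def infsum_cnj[symmetric] by (intro infsum_cong cinner_commute)
  show "cinner (x + y) z = cinner x z + cinner y z"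
    by (simp add: cinner_l2_def plus_l2.rep_eq cinner_add_left infsum_add l2_cinner_summable)
  show "cinner (c *\<^sub>C x) y = c * cinner x y"
    by (simp add: cinner_l2_def scaleC_l2.rep_eq cinner_scaleC_left infsum_cmult_right')
  show "inner x y = Re (cinner x y)" by (simp add: cinner_l2_def inner_l2_def)
qed
end

lift_definition ket :: "'a \<Rightarrow> ('a, complex) l2" is "\<lambda>a b. if b = a then 1 else 0"
proof -
  fix a :: 'a
  have "(\<lambda>b. (norm (if b = a then 1 else 0 :: complex))\<^sup>2) summable_on {a}" by simp
  thus "(\<lambda>b. (norm (if b = a then 1 else 0 :: complex))\<^sup>2) summable_on UNIV"
    by (rule summable_on_cong_neutral[THEN iffD1, rotated -1]) auto
qed

text \<open>
  The Hilbert tensor product \<open>\<ell>\<^sup>2(A) \<otimes> K\<close> is realized as \<open>\<ell>\<^sup>2(A; K)\<close>, with elementary tensors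
  \<open>u \<otimes> x = (u\<^sub>a x)\<^sub>a\<close>; for a closed subspace \<open>D\<close> of \<open>K\<close>, \<open>\<ell>\<^sup>2(A) \<otimes> D\<close> is the
  closed subspace \<open>\<ell>\<^sup>2(A; D)\<close>.
\<close>

lift_definition tens :: "('a, complex) l2 \<Rightarrow> 'h::chilbert \<Rightarrow> ('a, 'h) l2" is "\<lambda>u x a. u a *\<^sub>C x"
  by (simp add: norm_scaleC power_mult_distrib summable_on_cmult_left)

definition tens_space :: "'h::chilbert set \<Rightarrow> ('a, 'h) l2 set" where
  "tens_space D = {u. \<forall>a. coef u a \<in> D}"


section \<open>Bounded operators\<close>

definition bounded_clinear :: "('a::chilbert \<Rightarrow> 'b::chilbert) \<Rightarrow> bool" where
  "bounded_clinear A \<longleftrightarrow> bounded_linear A \<and> (\<forall>c x. A (c *\<^sub>C x) = c *\<^sub>C A x)"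

definition cadj :: "('a::chilbert \<Rightarrow> 'b::chilbert) \<Rightarrow> 'b \<Rightarrow> 'a" where
  "cadj A = (THE B. \<forall>x y. cinner (A x) y = cinner x (B y))"

definition positive_op :: "('a::chilbert \<Rightarrow> 'a) \<Rightarrow> bool" where
  "positive_op A \<longleftrightarrow> bounded_clinear A \<and> (\<forall>x. cinner (A x) x \<in> \<real> \<and> 0 \<le> Re (cinner (A x) x))"

definition op_sqrt :: "('a::chilbert \<Rightarrow> 'a) \<Rightarrow> 'a \<Rightarrow> 'a" where
  "op_sqrt A = (THE R. positive_op R \<and> R \<circ> R = A)"

definition orth_proj :: "'a::chilbert set \<Rightarrow> 'a \<Rightarrow> 'a" where
  "orth_proj S x = (THE y. y \<in> S \<and> (\<forall>z\<in>S. cinner (x - y) z = 0))"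

definition op_tensor ::
  "(('a, complex) l2 \<Rightarrow> ('b, complex) l2) \<Rightarrow> ('h::chilbert \<Rightarrow> 'k::chilbert)
    \<Rightarrow> ('a, 'h) l2 \<Rightarrow> ('b, 'k) l2" where
  "op_tensor A B = (THE C. bounded_clinear C \<and> (\<forall>u x. C (tens u x) = tens (A u) (B x)))"

definition isometry_between ::
  "'a::chilbert set \<Rightarrow> 'b::chilbert set \<Rightarrow> ('a \<Rightarrow> 'b) \<Rightarrow> bool" where
  "isometry_between S S' A \<longleftrightarrow> A ` S \<subseteq> S'
    \<and> (\<forall>x\<in>S. \<forall>y\<in>S. A (x + y) = A x + A y) \<and> (\<forall>c. \<forall>x\<in>S. A (c *\<^sub>C x) = c *\<^sub>C A x)
    \<and> (\<forall>x\<in>S. norm (A x) = norm x)"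

text \<open>Unitary equivalence of a tuple on the whole space \<open>'h\<close> with a tuple on a closed subspace
  \<open>S\<close>; for \<open>x \<in> S\<close>, \<open>cadj U x\<close> is the value at \<open>x\<close> of the adjoint of the unitary
  \<open>U : 'h \<rightarrow> S\<close>.\<close>

definition unitarily_equiv_on ::
  "('n \<Rightarrow> 'h::chilbert \<Rightarrow> 'h) \<Rightarrow> 'k::chilbert set \<Rightarrow> ('n \<Rightarrow> 'k \<Rightarrow> 'k) \<Rightarrow> bool" where
  "unitarily_equiv_on A S B \<longleftrightarrow> (\<exists>U. bounded_clinear U \<and> range U = S
    \<and> (\<forall>x y. cinner (U x) (U y) = cinner x y)
    \<and> (\<forall>i x. B i (U x) \<in> S \<and> A i x = cadj U (B i (U x))))"


section \<open>Noncommutative power series\<close>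

text \<open>Words in the free semigroup on \<open>n\<close> generators are lists over the finite type \<open>'n\<close>, and a
  formal power series is its family of coefficients.\<close>

type_synonym 'n ncps = "'n list \<Rightarrow> complex"

definition nc_var :: "'n \<Rightarrow> 'n ncps" where
  "nc_var i = (\<lambda>\<omega>. if \<omega> = [i] then 1 else 0)"

definition nc_one :: "'n ncps" where
  "nc_one = (\<lambda>\<omega>. if \<omega> = [] then 1 else 0)"

definition nc_mult :: "'n ncps \<Rightarrow> 'n ncps \<Rightarrow> 'n ncps" where
  "nc_mult p q = (\<lambda>\<omega>. \<Sum>(\<alpha>, \<beta>) | \<alpha> @ \<beta> = \<omega>. p \<alpha> * q \<beta>)"

primrec nc_word :: "('n \<Rightarrow> 'n ncps) \<Rightarrow> 'n list \<Rightarrow> 'n ncps" where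
  "nc_word f [] = nc_one"
| "nc_word f (i # \<alpha>) = nc_mult (f i) (nc_word f \<alpha>)"

definition nc_polynomial :: "'n ncps \<Rightarrow> bool" where
  "nc_polynomial p \<longleftrightarrow> finite {\<alpha>. p \<alpha> \<noteq> 0}"

text \<open>The series \<open>\<Sum>\<^sub>\<alpha> c\<^sub>\<alpha> f\<^sub>\<alpha>\<close>, that is, the composition of \<open>c\<close> with \<open>f\<close>. It is used only when
  \<open>c\<close> is a polynomial or \<open>f(0) = 0\<close>, where every coefficient is a finite sum.\<close>

definition nc_comp :: "'n ncps \<Rightarrow> ('n \<Rightarrow> 'n ncps) \<Rightarrow> 'n ncps" where
  "nc_comp c f = (\<lambda>\<omega>. \<Sum>\<^sub>\<infinity>\<alpha>. c \<alpha> * nc_word f \<alpha> \<omega>)"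

definition nc_radius :: "'n::finite ncps \<Rightarrow> ereal" where
  "nc_radius c = conv_radius (\<lambda>k. sqrt (\<Sum>\<alpha> | length \<alpha> = k. (cmod (c \<alpha>))\<^sup>2))"

definition nc_jacobian0 :: "('n::finite \<Rightarrow> 'n ncps) \<Rightarrow> complex ^ 'n ^ 'n" where
  "nc_jacobian0 f = (\<chi> i j. f i [j])"


section \<open>Evaluation at tuples of operators\<close>

primrec op_word :: "('n \<Rightarrow> 'h \<Rightarrow> 'h) \<Rightarrow> 'n list \<Rightarrow> 'h \<Rightarrow> 'h" where
  "op_word X [] = id"
| "op_word X (i # \<alpha>) = X i \<circ> op_word X \<alpha>"

definition row_op :: "('n::finite \<Rightarrow> 'h::chilbert \<Rightarrow> 'h) \<Rightarrow> 'h ^ 'n \<Rightarrow> 'h" where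
  "row_op X = (\<lambda>v. \<Sum>i\<in>UNIV. X i (v $ i))"

definition row_ball :: "real \<Rightarrow> ('n::finite \<Rightarrow> 'h::chilbert \<Rightarrow> 'h) set" where
  "row_ball \<gamma> = {X. (\<forall>i. bounded_clinear (X i)) \<and> onorm (row_op X) < \<gamma>}"

definition hom_part :: "'n::finite ncps \<Rightarrow> ('n \<Rightarrow> 'h::chilbert \<Rightarrow> 'h) \<Rightarrow> nat \<Rightarrow> 'h \<Rightarrow> 'h" where
  "hom_part c X k = (\<lambda>x. \<Sum>\<alpha> | length \<alpha> = k. c \<alpha> *\<^sub>C op_word X \<alpha> x)"

definition nc_eval :: "'n::finite ncps \<Rightarrow> ('n \<Rightarrow> 'h::chilbert \<Rightarrow> 'h) \<Rightarrow> 'h \<Rightarrow> 'h" where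
  "nc_eval c X = (\<lambda>x. \<Sum>k. hom_part c X k x)"

definition norm_convergent_at :: "'n::finite ncps \<Rightarrow> ('n \<Rightarrow> 'h::chilbert \<Rightarrow> 'h) \<Rightarrow> bool" where
  "norm_convergent_at c X \<longleftrightarrow> (\<exists>A. bounded_clinear A \<and>
    (\<lambda>N. onorm (\<lambda>x. (\<Sum>k<N. hom_part c X k x) - A x)) \<longlonglongrightarrow> 0)"

text \<open>\<open>Y = f(X)\<close> in the sense of SOT-convergent series, resp. of radial SOT-limits.\<close>

definition sot_value ::
  "('n::finite \<Rightarrow> 'n ncps) \<Rightarrow> ('n \<Rightarrow> 'h::chilbert \<Rightarrow> 'h) \<Rightarrow> ('n \<Rightarrow> 'h \<Rightarrow> 'h) \<Rightarrow> bool" where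
  "sot_value f X Y \<longleftrightarrow> (\<forall>i. bounded_clinear (X i)) \<and> (\<forall>j. bounded_clinear (Y j))
    \<and> (\<forall>j x. (\<lambda>k. hom_part (f j) X k x) sums Y j x)"

definition rad_value ::
  "('n::finite \<Rightarrow> 'n ncps) \<Rightarrow> ('n \<Rightarrow> 'h::chilbert \<Rightarrow> 'h) \<Rightarrow> ('n \<Rightarrow> 'h \<Rightarrow> 'h) \<Rightarrow> bool" where
  "rad_value f X Y \<longleftrightarrow> (\<forall>i. bounded_clinear (X i)) \<and> (\<forall>j. bounded_clinear (Y j))
    \<and> (\<exists>\<delta>\<in>{0<..<1}. \<forall>r\<in>{\<delta><..<1}. \<forall>j. norm_convergent_at (f j) (\<lambda>i x. r *\<^sub>R X i x))
    \<and> (\<forall>j x. ((\<lambda>r. nc_eval (f j) (\<lambda>i x. r *\<^sub>R X i x) x) \<longlongrightarrow> Y j x) (at_left 1))"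

definition conv_set_SOT :: "('n::finite \<Rightarrow> 'n ncps) \<Rightarrow> ('n \<Rightarrow> 'h::chilbert \<Rightarrow> 'h) set" where
  "conv_set_SOT f = {X. \<exists>Y. sot_value f X Y}"

definition conv_set_rad :: "('n::finite \<Rightarrow> 'n ncps) \<Rightarrow> ('n \<Rightarrow> 'h::chilbert \<Rightarrow> 'h) set" where
  "conv_set_rad f = {X. \<exists>Y. rad_value f X Y}"

text \<open>On the intersection of the two convergence sets the values agree by Abel's theorem.\<close>

definition fun_calc ::
  "('n::finite \<Rightarrow> 'n ncps) \<Rightarrow> ('n \<Rightarrow> 'h::chilbert \<Rightarrow> 'h) \<Rightarrow> 'n \<Rightarrow> 'h \<Rightarrow> 'h" where
  "fun_calc f X =
    (if X \<in> conv_set_SOT f then THE Y. sot_value f X Y else THE Y. rad_value f X Y)"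


section \<open>The model property\<close>

text \<open>
  In all three cases \<open>(f\<^sub>\<alpha>)\<^sub>\<alpha>\<close> is by definition an orthonormal basis of \<open>\<bbbH>\<^sup>2(f)\<close>. So
  \<open>\<bbbH>\<^sup>2(f)\<close> is written in this basis: the vector \<open>c\<close> of \<open>\<ell>\<^sup>2\<close> over the words stands for
  \<open>\<Sum>\<^sub>\<alpha> c\<^sub>\<alpha> f\<^sub>\<alpha>\<close>, and \<open>ket \<alpha>\<close> for \<open>f\<^sub>\<alpha>\<close>. What this sum denotes depends on the case:
  for an invertible polynomial tuple it is a polynomial if \<open>c\<close> is finitely supported (such \<open>c\<close> are dense, and the remaining
  vectors are the ones added by the completion), for power series with \<open>f(0) = 0\<close> it is the formal power series
  \<open>nc_comp (coef c) f\<close>, for free holomorphic functions it is the function \<open>X \<mapsto> nc_eval (coef c) (f(X))\<close>, that is,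
  \<open>G \<circ> f\<close> where \<open>G = \<Sum>\<^sub>\<alpha> c\<^sub>\<alpha> Z\<^sub>\<alpha>\<close>.

  The following three predicates say that the bounded operator \<open>L\<close> is left multiplication by
  \<open>p\<close> on \<open>\<bbbH>\<^sup>2(f)\<close>.
\<close>

type_synonym 'n h2 = "('n list, complex) l2"

definition lmult_poly :: "('n::finite \<Rightarrow> 'n ncps) \<Rightarrow> 'n ncps \<Rightarrow> ('n h2 \<Rightarrow> 'n h2) \<Rightarrow> bool" where
  "lmult_poly f p L \<longleftrightarrow> bounded_clinear L \<and> (\<forall>c. nc_polynomial (coef c) \<longrightarrow>
    nc_polynomial (coef (L c)) \<and> nc_comp (coef (L c)) f = nc_mult p (nc_comp (coef c) f))"

definition lmult_series :: "('n::finite \<Rightarrow> 'n ncps) \<Rightarrow> 'n ncps \<Rightarrow> ('n h2 \<Rightarrow> 'n h2) \<Rightarrow> bool" where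
  "lmult_series f p L \<longleftrightarrow> bounded_clinear L \<and>
    (\<forall>c. nc_comp (coef (L c)) f = nc_mult p (nc_comp (coef c) f))"

text \<open>\<open>(nat, complex) l2\<close> is the separable infinite-dimensional Hilbert space on which free
  holomorphic functions are represented.\<close>

definition ball_map ::
  "('n::finite \<Rightarrow> 'n ncps) \<Rightarrow> ('n \<Rightarrow> (nat, complex) l2 \<Rightarrow> (nat, complex) l2)
    \<Rightarrow> 'n \<Rightarrow> (nat, complex) l2 \<Rightarrow> (nat, complex) l2" where
  "ball_map f X = (\<lambda>j. nc_eval (f j) X)"

definition lmult_holo ::
  "real \<Rightarrow> ('n::finite \<Rightarrow> 'n ncps) \<Rightarrow> 'n ncps \<Rightarrow> ('n h2 \<Rightarrow> 'n h2) \<Rightarrow> bool" where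
  "lmult_holo \<gamma> f p L \<longleftrightarrow> bounded_clinear L \<and> (\<forall>c. \<forall>X\<in>row_ball \<gamma>.
    nc_eval (coef (L c)) (ball_map f X) = nc_eval p X \<circ> nc_eval (coef c) (ball_map f X))"

text \<open>Besides stating the model property of \<open>f\<close>, each of the following predicates determines the
  coefficients \<open>a\<close> of \<open>Z\<^sub>i = \<Sum>\<^sub>\<alpha> a\<^sup>(\<^sup>i\<^sup>)\<^sub>\<alpha> f\<^sub>\<alpha>\<close> in \<open>\<bbbH>\<^sup>2(f)\<close> and the
  universal model \<open>M = (M\<^bsub>Z\<^sub>1\<^esub>, \<dots>, M\<^bsub>Z\<^sub>n\<^esub>)\<close>; both are uniquely determined
  by \<open>f\<close>, also if several cases apply.\<close>

definition model_poly ::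
  "('n::finite \<Rightarrow> 'n ncps) \<Rightarrow> ('n \<Rightarrow> 'n h2) \<Rightarrow> ('n \<Rightarrow> 'n h2 \<Rightarrow> 'n h2) \<Rightarrow> bool" where
  "model_poly f a M \<longleftrightarrow>
    (\<forall>i. nc_polynomial (f i))
    \<and> (\<exists>g. (\<forall>i. nc_polynomial (g i)) \<and> (\<forall>i. nc_comp (f i) g = nc_var i)
        \<and> (\<forall>i. nc_comp (g i) f = nc_var i))
    \<and> (\<forall>i. nc_polynomial (coef (a i)) \<and> nc_comp (coef (a i)) f = nc_var i)
    \<and> (\<forall>i. lmult_poly f (nc_var i) (M i))"

definition model_series ::
  "('n::finite \<Rightarrow> 'n ncps) \<Rightarrow> ('n \<Rightarrow> 'n h2) \<Rightarrow> ('n \<Rightarrow> 'n h2 \<Rightarrow> 'n h2) \<Rightarrow> bool" where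
  "model_series f a M \<longleftrightarrow>
    (\<forall>j. f j [] = 0) \<and> (\<forall>j. nc_radius (f j) > 0) \<and> det (nc_jacobian0 f) \<noteq> 0
    \<and> (\<forall>i. nc_comp (coef (a i)) f = nc_var i)
    \<and> (\<forall>i. lmult_series f (nc_var i) (M i))
    \<and> (\<exists>Mf. (\<forall>j. lmult_series f (f j) (Mf j)) \<and> (sot_value f M Mf \<or> rad_value f M Mf))"

definition model_holo ::
  "('n::finite \<Rightarrow> 'n ncps) \<Rightarrow> ('n \<Rightarrow> 'n h2) \<Rightarrow> ('n \<Rightarrow> 'n h2 \<Rightarrow> 'n h2) \<Rightarrow> bool" where
  "model_holo f a M \<longleftrightarrow> (\<exists>\<gamma>>0.
    (\<forall>j. ereal \<gamma> \<le> nc_radius (f j)) \<and> (\<forall>X\<in>row_ball \<gamma>. ball_map f X \<in> row_ball 1)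
    \<and> (\<forall>G. 1 \<le> nc_radius G \<and> G \<noteq> (\<lambda>_. 0) \<longrightarrow>
        (\<exists>X\<in>row_ball \<gamma>. nc_eval G (ball_map f X) \<noteq> (\<lambda>_. 0)))
    \<and> (\<forall>i. \<forall>X\<in>row_ball \<gamma>. nc_eval (coef (a i)) (ball_map f X) = X i)
    \<and> (\<forall>i. lmult_holo \<gamma> f (nc_var i) (M i))
    \<and> (\<exists>Mf. (\<forall>j. lmult_holo \<gamma> f (f j) (Mf j)) \<and> (sot_value f M Mf \<or> rad_value f M Mf)))"

definition model_property ::
  "('n::finite \<Rightarrow> 'n ncps) \<Rightarrow> ('n \<Rightarrow> 'n h2) \<Rightarrow> ('n \<Rightarrow> 'n h2 \<Rightarrow> 'n h2) \<Rightarrow> bool" where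
  "model_property f a M \<longleftrightarrow> model_poly f a M \<or> model_series f a M \<or> model_holo f a M"


section \<open>The noncommutative domain\<close>

text \<open>Here \<open>a\<close> are the coefficients of \<open>Z\<^sub>1, \<dots>, Z\<^sub>n\<close> in \<open>\<bbbH>\<^sup>2(f)\<close>, so that
  \<open>g\<^sub>i = \<Sum>\<^sub>\<alpha> a\<^sup>(\<^sup>i\<^sup>)\<^sub>\<alpha> Z\<^sub>\<alpha>\<close>.\<close>

definition nc_domain ::
  "('n::finite \<Rightarrow> 'n ncps) \<Rightarrow> ('n \<Rightarrow> 'n h2) \<Rightarrow> ('n \<Rightarrow> 'h::chilbert \<Rightarrow> 'h) set" where
  "nc_domain f a = {X. X \<in> conv_set_SOT f \<union> conv_set_rad f
    \<and> (sot_value (\<lambda>i. coef (a i)) (fun_calc f X) X \<or> rad_value (\<lambda>i. coef (a i)) (fun_calc f X) X)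
    \<and> onorm (row_op (fun_calc f X)) \<le> 1}"

definition pure_tuple ::
  "('n::finite \<Rightarrow> 'n ncps) \<Rightarrow> ('n \<Rightarrow> 'h::chilbert \<Rightarrow> 'h) \<Rightarrow> bool" where
  "pure_tuple f T \<longleftrightarrow> (\<forall>x. (\<lambda>k. \<Sum>\<alpha> | length \<alpha> = k.
    op_word (fun_calc f T) \<alpha> (cadj (op_word (fun_calc f T) \<alpha>) x)) \<longlonglongrightarrow> 0)"


section \<open>The characteristic function\<close>

definition defect :: "('n::finite \<Rightarrow> 'n ncps) \<Rightarrow> ('n \<Rightarrow> 'h::chilbert \<Rightarrow> 'h) \<Rightarrow> 'h \<Rightarrow> 'h" where
  "defect f T = op_sqrt (\<lambda>x. x - (\<Sum>i\<in>UNIV. fun_calc f T i (cadj (fun_calc f T i) x)))"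

definition defect_star ::
  "('n::finite \<Rightarrow> 'n ncps) \<Rightarrow> ('n \<Rightarrow> 'h::chilbert \<Rightarrow> 'h) \<Rightarrow> 'h ^ 'n \<Rightarrow> 'h ^ 'n" where
  "defect_star f T = op_sqrt (\<lambda>v. v - cadj (row_op (fun_calc f T)) (row_op (fun_calc f T) v))"

definition defect_space :: "('n::finite \<Rightarrow> 'n ncps) \<Rightarrow> ('n \<Rightarrow> 'h::chilbert \<Rightarrow> 'h) \<Rightarrow> 'h set" where
  "defect_space f T = closure (range (defect f T))"

definition defect_star_space ::
  "('n::finite \<Rightarrow> 'n ncps) \<Rightarrow> ('n \<Rightarrow> 'h::chilbert \<Rightarrow> 'h) \<Rightarrow> ('h ^ 'n) set" where
  "defect_star_space f T = closure (range (defect_star f T))"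

definition Lam :: "'n \<Rightarrow> 'n h2 \<Rightarrow> 'n h2" where
  "Lam i = (THE L. bounded_clinear L \<and> (\<forall>\<alpha>. L (ket \<alpha>) = ket (\<alpha> @ [i])))"

text \<open>\<open>char_fun_r f T r\<close> is the Fourier representation of the characteristic function with each
  \<open>\<Lambda>\<^sub>i\<close> replaced by \<open>r \<Lambda>\<^sub>i\<close>. It acts on \<open>\<bbbH>\<^sup>2(f) \<otimes> H\<^sup>(\<^sup>n\<^sup>)\<close>; the
  characteristic function is its limit on the subspace \<open>\<bbbH>\<^sup>2(f) \<otimes> \<D>\<^bsub>f,T*\<^esub>\<close>. The row
  \<open>[\<Lambda>\<^sub>1 \<otimes> I, \<dots>, \<Lambda>\<^sub>n \<otimes> I]\<close> is written \<open>\<Sum>\<^sub>i \<Lambda>\<^sub>i \<otimes> pr\<^sub>i\<close> with the coordinate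
  projections \<open>pr\<^sub>i : H\<^sup>(\<^sup>n\<^sup>) \<rightarrow> H\<close>.\<close>

definition char_fun_r ::
  "('n::finite \<Rightarrow> 'n ncps) \<Rightarrow> ('n \<Rightarrow> 'h::chilbert \<Rightarrow> 'h) \<Rightarrow> real
    \<Rightarrow> ('n list, 'h ^ 'n) l2 \<Rightarrow> ('n list, 'h) l2" where
  "char_fun_r f T r = (\<lambda>u.
    - op_tensor id (row_op (fun_calc f T)) u
    + op_tensor id (defect f T)
        (inv (\<lambda>w. w - (\<Sum>i\<in>UNIV. op_tensor (\<lambda>c. r *\<^sub>R Lam i c) (cadj (fun_calc f T i)) w))
          (\<Sum>i\<in>UNIV. op_tensor (\<lambda>c. r *\<^sub>R Lam i c) (\<lambda>v. v $ i)
            (op_tensor id (defect_star f T) u))))"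

definition char_fun ::
  "('n::finite \<Rightarrow> 'n ncps) \<Rightarrow> ('n \<Rightarrow> 'h::chilbert \<Rightarrow> 'h)
    \<Rightarrow> ('n list, 'h ^ 'n) l2 \<Rightarrow> ('n list, 'h) l2" where
  "char_fun f T = (\<lambda>u. Lim (at_left 1) (\<lambda>r. char_fun_r f T r u))"

definition model_space ::
  "('n::finite \<Rightarrow> 'n ncps) \<Rightarrow> ('n \<Rightarrow> 'h::chilbert \<Rightarrow> 'h) \<Rightarrow> ('n list, 'h) l2 set" where
  "model_space f T = {u \<in> tens_space (defect_space f T).
    \<forall>v \<in> tens_space (defect_star_space f T). cinner u (char_fun f T v) = 0}"

end

theory Submission
  imports Defs
begin

text \<open>
  Let \<open>A\<close> be the row contraction \<open>f(T)\<close>. Since \<open>A\<close> is pure, \<open>K x = (\<Delta> A\<^sub>\<alpha>\<^sup>* x)\<^sub>\<alpha>\<close> is an isometry of \<open>H\<close> into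
  \<open>\<ell>\<^sup>2 \<otimes> \<D>\<close>, by telescoping over the word length. The characteristic function is the transfer
  function of the Halmos unitary of \<open>A\<close>: the norms of input, output and state balance level by
  level, so \<open>\<Theta>\<close> is contractive, and isometric once purity makes the state norms vanish in the limit.
  The ranges of \<open>K\<close> and \<open>\<Theta>\<close> are orthogonal and together span \<open>\<ell>\<^sup>2 \<otimes> \<D>\<close>, so \<open>K\<close> is a unitary of \<open>H\<close>
  onto the model space. In each of the three cases of the model property
  \<open>M\<^sub>i e\<^sub>\<beta> = \<Sum>\<^sub>\<alpha> a\<^sup>i\<^sub>\<alpha> e\<^sub>\<alpha>\<^sub>\<beta>\<close>; since \<open>T\<^sub>i = \<Sum>\<^sub>\<alpha> a\<^sup>i\<^sub>\<alpha> A\<^sub>\<alpha>\<close> (for radial limits by Abel's theorem), this gives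
  \<open>T\<^sub>i K\<^sup>* = K\<^sup>* (M\<^sub>i \<otimes> I)\<close>.
\<close>

text \<open>At each word the Halmos unitary sends the pair (state, input) to the states at the
  one-letter extensions and to the output there. This recursion makes sense at r = 1, where the
  resolvent may fail to exist, so isometry is shown there first; the radial limit then follows,
  since coordinates are polynomials in r and the norms at r < 1 do not exceed the norm at r = 1.

  For T_i the difficulty is that the coefficients a^i are only square summable and that T_i may be
  given by a radial limit. On the vectors A_\<beta> \<Delta> x the series grouped by degree
  converges, because K* carries a convergent expansion there; these vectors span a dense subspace,
  so either description of T_i is pinned down.

  The formula for M_i rests on uniqueness: M_i e_\<beta> and the shifted coefficients of Z_i both
  represent Z_i f_\<beta>. Composition with f determines the coefficients by the inverse tuple for
  polynomials, by the invertible linear part, degree by degree, for power series, and by the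
  nondegeneracy assumption for free holomorphic functions.\<close>

instance chilbert \<subseteq> banach ..

section \<open>Arithmetic of complex Hilbert spaces\<close>

lemma scaleC_one [simp]: "1 *\<^sub>C x = (x :: 'a::chilbert)"
  using scaleR_scaleC[of 1 x] by simp

lemma scaleC_zero_left [simp]: "0 *\<^sub>C x = (0 :: 'a::chilbert)"
  using scaleR_scaleC[of 0 x] by simp

lemma scaleC_zero_right [simp]: "c *\<^sub>C 0 = (0 :: 'a::chilbert)"
  using norm_scaleC[of c "0::'a"] by simp

lemma scaleC_scaleR: "c *\<^sub>C r *\<^sub>R x = r *\<^sub>R c *\<^sub>C (x :: 'a::chilbert)"
  by (simp add: scaleR_scaleC scaleC_scaleC mult.commute)

lemma scaleC_minus_right: "c *\<^sub>C (- x) = - (c *\<^sub>C (x :: 'a::chilbert))"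
  using scaleC_add_right[of c x "- x"] by (simp add: add_eq_0_iff)

lemma scaleC_diff_right: "c *\<^sub>C (x - y) = c *\<^sub>C x - c *\<^sub>C (y :: 'a::chilbert)"
  using scaleC_add_right[of c x "- y"] by (simp add: scaleC_minus_right)

lemma scaleC_sum_right: "c *\<^sub>C (\<Sum>i\<in>I. x i) = (\<Sum>i\<in>I. c *\<^sub>C (x i :: 'a::chilbert))"
  by (induction I rule: infinite_finite_induct) (auto simp: scaleC_add_right)

lemma bounded_linear_scaleC_right: "bounded_linear (\<lambda>x :: 'a::chilbert. c *\<^sub>C x)"
  by (rule bounded_linear_intro[where K = "cmod c"])
    (auto simp: scaleC_add_right scaleC_scaleR norm_scaleC mult.commute)

lemma cinner_zero_left [simp]: "cinner 0 (x :: 'a::chilbert) = 0"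
  using cinner_scaleC_left[of 0 x x] by simp

lemma cinner_zero_right [simp]: "cinner (x :: 'a::chilbert) 0 = 0"
  by (subst cinner_commute) simp

lemma cinner_minus_left: "cinner (- x) y = - cinner x (y :: 'a::chilbert)"
  using cinner_add_left[of x "- x" y] by (simp add: add_eq_0_iff)

lemma cinner_diff_left: "cinner (x - y) z = cinner x z - cinner y (z :: 'a::chilbert)"
  using cinner_add_left[of x "- y" z] by (simp add: cinner_minus_left)

lemma cinner_add_right: "cinner x (y + z) = cinner x y + cinner x (z :: 'a::chilbert)"
  by (subst (1 2 3) cinner_commute) (simp add: cinner_add_left)

lemma cinner_minus_right: "cinner x (- y) = - cinner x (y :: 'a::chilbert)"
  using cinner_add_right[of x y "- y"] by (simp add: add_eq_0_iff)

lemma cinner_diff_right: "cinner x (y - z) = cinner x y - cinner x (z :: 'a::chilbert)"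
  using cinner_add_right[of x y "- z"] by (simp add: cinner_minus_right)

lemma cinner_scaleC_right: "cinner x (c *\<^sub>C y) = cnj c * cinner x (y :: 'a::chilbert)"
  by (subst (1 2) cinner_commute) (simp add: cinner_scaleC_left)

lemma cinner_scaleR_left: "cinner (r *\<^sub>R x) y = r * cinner x (y :: 'a::chilbert)"
  by (simp add: scaleR_scaleC cinner_scaleC_left)

lemma cinner_scaleR_right: "cinner x (r *\<^sub>R y) = r * cinner x (y :: 'a::chilbert)"
  by (simp add: scaleR_scaleC cinner_scaleC_right)

lemma cinner_sum_left: "cinner (\<Sum>i\<in>I. x i) (y :: 'a::chilbert) = (\<Sum>i\<in>I. cinner (x i) y)"
  by (induction I rule: infinite_finite_induct) (auto simp: cinner_add_left)

lemma cinner_sum_right: "cinner (y :: 'a::chilbert) (\<Sum>i\<in>I. x i) = (\<Sum>i\<in>I. cinner y (x i))"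
  by (induction I rule: infinite_finite_induct) (auto simp: cinner_add_right)

lemma cinner_self: "cinner x (x :: 'a::chilbert) = complex_of_real ((norm x)\<^sup>2)"
proof (rule complex_eqI)
  show "Re (cinner x x) = Re (complex_of_real ((norm x)\<^sup>2))"
    by (simp add: inner_cinner[symmetric] power2_norm_eq_inner)
  have "cinner x x = cnj (cinner x x)" by (rule cinner_commute)
  thus "Im (cinner x x) = Im (complex_of_real ((norm x)\<^sup>2))" by (simp add: complex_eq_iff)
qed

lemma cinner_eqI: "(\<And>y. cinner x y = cinner x' y) \<Longrightarrow> x = (x' :: 'a::chilbert)"
proof -
  assume "\<And>y. cinner x y = cinner x' y"
  hence "cinner (x - x') (x - x') = 0" by (simp add: cinner_diff_left)
  thus ?thesis by (simp add: cinner_self)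
qed

lemma bounded_linear_cinner_left: "bounded_linear (\<lambda>x :: 'a::chilbert. cinner x y)"
  by (rule bounded_linear_intro[where K = "norm y"])
    (auto simp: cinner_add_left cinner_scaleR_left scaleR_conv_of_real cmod_cinner_le)

lemma bounded_linear_cinner_right: "bounded_linear (\<lambda>x :: 'a::chilbert. cinner y x)"
  by (rule bounded_linear_intro[where K = "norm y"])
    (auto simp: cinner_add_right cinner_scaleR_right scaleR_conv_of_real cmod_cinner_le
      mult.commute[of "norm _" "norm y"])

section \<open>Bounded complex-linear operators\<close>

lemma bounded_clinearI:
  assumes "\<And>x y. A (x + y) = A x + A y" and "\<And>c x. A (c *\<^sub>C x) = c *\<^sub>C A x"
    and "\<And>x. norm (A x) \<le> norm x * K"
  shows "bounded_clinear A"
  unfolding bounded_clinear_def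
  using assms by (auto intro!: bounded_linear_intro[where K = K] simp: scaleR_scaleC)

context
  fixes A :: "'a::chilbert \<Rightarrow> 'b::chilbert"
  assumes A: "bounded_clinear A"
begin

lemma bounded_clinear_bounded_linear: "bounded_linear A"
  using A by (simp add: bounded_clinear_def)

lemma bounded_clinear_scaleC: "A (c *\<^sub>C x) = c *\<^sub>C A x"
  using A by (simp add: bounded_clinear_def)

lemma bounded_clinear_add: "A (x + y) = A x + A y"
  by (rule linear_add[OF bounded_linear.linear[OF bounded_clinear_bounded_linear]])

lemma bounded_clinear_diff: "A (x - y) = A x - A y"
  by (rule linear_diff[OF bounded_linear.linear[OF bounded_clinear_bounded_linear]])

lemma bounded_clinear_zero: "A 0 = 0"
  by (rule linear_0[OF bounded_linear.linear[OF bounded_clinear_bounded_linear]])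

lemma bounded_clinear_scaleR: "A (r *\<^sub>R x) = r *\<^sub>R A x"
  by (rule linear_scale[OF bounded_linear.linear[OF bounded_clinear_bounded_linear]])

lemma bounded_clinear_sum: "A (\<Sum>i\<in>I. x i) = (\<Sum>i\<in>I. A (x i))"
  by (rule linear_sum[OF bounded_linear.linear[OF bounded_clinear_bounded_linear]])

end

lemma bounded_clinear_id: "bounded_clinear (\<lambda>x :: 'a::chilbert. x)"
  by (rule bounded_clinearI[where K = 1]) auto

lemma bounded_clinear_compose:
  assumes "bounded_clinear A" "bounded_clinear B"
  shows "bounded_clinear (\<lambda>x. A (B x))"
  using assms bounded_linear_compose[of A B] unfolding bounded_clinear_def by auto

lemma bounded_clinear_setsum:
  assumes "\<And>i. i \<in> I \<Longrightarrow> bounded_clinear (A i)"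
  shows "bounded_clinear (\<lambda>x. \<Sum>i\<in>I. A i x)"
  using assms unfolding bounded_clinear_def
  by (auto intro: bounded_linear_sum simp: scaleC_sum_right)

lemma bounded_clinear_scaleR_op:
  assumes "bounded_clinear A"
  shows "bounded_clinear (\<lambda>x. r *\<^sub>R A x)"
  using assms unfolding bounded_clinear_def
  by (auto intro: bounded_linear_compose[OF bounded_linear_scaleR_right] simp: scaleC_scaleR)

lemma bounded_clinear_vec_nth: "bounded_clinear (\<lambda>v :: 'a::chilbert ^ 'n::finite. v $ i)"
  unfolding bounded_clinear_def by (auto simp: bounded_linear_vec_nth scaleC_vec_def)

subsection \<open>Riesz representation and adjoints\<close>

text \<open>The representing vector is a multiple of the vector of minimal norm on \<open>{x. f x = 1}\<close>;
  a minimizing sequence is Cauchy by the parallelogram law.\<close>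

lemma riesz_real:
  fixes f :: "'a::{real_inner,complete_space} \<Rightarrow> real"
  assumes f: "bounded_linear f"
  shows "\<exists>z. \<forall>x. f x = inner x z"
proof (cases "\<forall>x. f x = 0")
  case True
  thus ?thesis by (intro exI[of _ 0]) simp
next
  case False
  interpret f: bounded_linear f by fact
  obtain x0 where "f x0 \<noteq> 0" using False by blast
  define C where "C = {x. f x = 1}"
  have C0: "x0 /\<^sub>R f x0 \<in> C" using \<open>f x0 \<noteq> 0\<close> by (simp add: C_def f.scaleR)
  define d where "d = (INF x\<in>C. (norm x)\<^sup>2)"
  have bdd: "bdd_below ((\<lambda>x. (norm x)\<^sup>2) ` C)" by (rule bdd_belowI2[of _ 0]) simp
  have dle: "d \<le> (norm x)\<^sup>2" if "x \<in> C" for x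
    unfolding d_def by (rule cINF_lower[OF bdd that])
  have "\<exists>x. x \<in> C \<and> (norm x)\<^sup>2 < d + 1 / (real n + 1)" for n :: nat
  proof -
    have "d < d + 1 / (real n + 1)" by simp
    thus ?thesis using cINF_less_iff[OF _ bdd] C0 unfolding d_def by blast
  qed
  then obtain X where XC: "\<And>n. X n \<in> C" and X: "\<And>n. (norm (X n))\<^sup>2 < d + 1 / (real n + 1)"
    by metis
  have par: "(norm (x - y))\<^sup>2 \<le> 2 * (norm x)\<^sup>2 + 2 * (norm y)\<^sup>2 - 4 * d" if "x \<in> C" "y \<in> C" for x y
  proof -
    have "(1/2) *\<^sub>R (x + y) \<in> C" using that by (simp add: C_def f.scaleR f.add)
    hence "d \<le> (norm ((1/2) *\<^sub>R (x + y)))\<^sup>2" by (rule dle)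
    hence "4 * d \<le> (norm (x + y))\<^sup>2" by (simp add: power_mult_distrib power_divide)
    thus ?thesis
      by (simp add: power2_norm_eq_inner inner_add_left inner_add_right inner_diff_left
          inner_diff_right inner_commute)
  qed
  have "Cauchy X"
  proof (rule CauchyI)
    fix e :: real assume "e > 0"
    obtain N :: nat where N: "4 / e\<^sup>2 < N" using reals_Archimedean2 by blast
    hence "4 < N * e\<^sup>2" using \<open>e > 0\<close> by (simp add: field_simps)
    hence N': "4 / (N + 1) < e\<^sup>2" using \<open>e > 0\<close> by (simp add: field_simps add_strict_increasing2)
    have "norm (X m - X n) < e" if "m \<ge> N" "n \<ge> N" for m n
    proof -
      have "1 / (real m + 1) \<le> 1 / (real N + 1)" "1 / (real n + 1) \<le> 1 / (real N + 1)"
        using that by (auto intro!: divide_left_mono)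
      hence "(norm (X m - X n))\<^sup>2 < 4 / (N + 1)"
        using par[OF XC[of m] XC[of n]] X[of m] X[of n] by (simp add: add.commute)
      hence "(norm (X m - X n))\<^sup>2 < e\<^sup>2" using N' by linarith
      thus ?thesis using \<open>e > 0\<close> by (simp add: power2_less_imp_less)
    qed
    thus "\<exists>N. \<forall>m\<ge>N. \<forall>n\<ge>N. norm (X m - X n) < e" by blast
  qed
  then obtain z where z: "X \<longlonglongrightarrow> z" using Cauchy_convergent_iff convergent_def by blast
  have "(\<lambda>n. f (X n)) \<longlonglongrightarrow> f z" by (rule f.tendsto[OF z])
  moreover have "f (X n) = 1" for n using XC[of n] by (simp add: C_def)
  ultimately have fz: "f z = 1" by (simp add: LIMSEQ_const_iff)
  have "(\<lambda>n. d + 1 / (real n + 1)) \<longlonglongrightarrow> d"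
    using LIMSEQ_inverse_real_of_nat_add[of d] by (simp add: divide_inverse add.commute)
  moreover have "(\<lambda>n. (norm (X n))\<^sup>2) \<longlonglongrightarrow> (norm z)\<^sup>2" by (intro tendsto_intros z)
  ultimately have nz: "(norm z)\<^sup>2 \<le> d"
    using X by (intro LIMSEQ_le[of "\<lambda>n. (norm (X n))\<^sup>2" _ "\<lambda>n. d + 1 / (real n + 1)" d])
      (auto intro!: exI[of _ 0] less_imp_le)
  have orth: "inner x z = 0" if "f x = 0" for x
  proof -
    have *: "0 \<le> 2 * t * inner x z + t\<^sup>2 * inner x x" for t
    proof -
      have "z + t *\<^sub>R x \<in> C" using fz that by (simp add: C_def f.add f.scaleR)
      from dle[OF this] nz have "(norm z)\<^sup>2 \<le> (norm (z + t *\<^sub>R x))\<^sup>2" by linarith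
      thus ?thesis
        unfolding power2_norm_eq_inner
        by (simp add: inner_add_left inner_add_right inner_commute algebra_simps power2_eq_square)
    qed
    \<comment> \<open>The test value t = -<x,z>/q minimises the quadratic with |x|^2 enlarged to q;
      the added 1 keeps q positive when x = 0.\<close>
    define q where "q = inner x x + 1"
    have "q > 0" by (simp add: q_def add_nonneg_pos)
    have "0 \<le> 2 * (- (inner x z / q)) * inner x z + (- (inner x z / q))\<^sup>2 * (q - 1)"
      using *[of "- (inner x z / q)"] by (simp add: q_def)
    also have "\<dots> = - ((inner x z)\<^sup>2 * (q + 1) / q\<^sup>2)"
      using \<open>q > 0\<close> by (simp add: field_simps power2_eq_square)
    finally have "(inner x z)\<^sup>2 * (q + 1) / q\<^sup>2 \<le> 0" by simp
    hence "(inner x z)\<^sup>2 \<le> 0"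
      using \<open>q > 0\<close> by (simp add: divide_le_0_iff mult_le_0_iff)
    thus ?thesis by simp
  qed
  have "inner z z \<noteq> 0" using fz by (auto simp: f.zero)
  have "f x = inner x (z /\<^sub>R inner z z)" for x
  proof -
    have "inner (x - f x *\<^sub>R z) z = 0" by (rule orth) (simp add: f.diff f.scaleR fz)
    thus ?thesis using \<open>inner z z \<noteq> 0\<close> by (simp add: inner_diff_left field_simps)
  qed
  thus ?thesis by blast
qed

text \<open>The real Riesz vector of Re f also represents f: by complex linearity, evaluation at i x
  recovers the imaginary part.\<close>

lemma riesz_complex:
  fixes f :: "'a::chilbert \<Rightarrow> complex"
  assumes f: "bounded_linear f" and fc: "\<And>c x. f (c *\<^sub>C x) = c * f x"
  shows "\<exists>z. \<forall>x. f x = cinner x z"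
proof -
  obtain z where z: "\<And>x. Re (f x) = inner x z"
    using riesz_real[OF bounded_linear_compose[OF bounded_linear_Re f]] by blast
  have "f x = cinner x z" for x
    using z[of x] z[of "\<i> *\<^sub>C x"] by (simp add: complex_eq_iff inner_cinner cinner_scaleC_left fc)
  thus ?thesis by blast
qed

lemma cadj_unique:
  assumes "\<And>x y. cinner (A x) y = cinner x (B y)"
  shows "cadj A = (B :: 'b::chilbert \<Rightarrow> 'a::chilbert)"
  unfolding cadj_def
proof (rule the_equality)
  fix B' assume *: "\<forall>x y. cinner (A x) y = cinner x (B' y)"
  show "B' = B"
  proof
    fix y
    have "cinner (B' y) x = cinner (B y) x" for x
      using * assms by (subst (1 2) cinner_commute) metis
    thus "B' y = B y" by (rule cinner_eqI)
  qed
qed (use assms in blast)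

lemma cadj_left:
  assumes A: "bounded_clinear A"
  shows "cinner (A x) y = cinner x (cadj A (y :: 'b::chilbert) :: 'a::chilbert)"
proof -
  have "\<exists>z. \<forall>x. cinner (A x) y = cinner x z" for y
    by (rule riesz_complex)
      (auto simp: bounded_clinear_scaleC[OF A] cinner_scaleC_left intro!: bounded_linear_compose[OF
        bounded_linear_cinner_left bounded_clinear_bounded_linear[OF A]])
  then obtain B where B: "\<And>x y. cinner (A x) y = cinner x (B y)" by metis
  have "cadj A = B" by (rule cadj_unique) (rule B)
  thus ?thesis using B by simp
qed

lemma cadj_right:
  assumes A: "bounded_clinear A"
  shows "cinner x (A y) = cinner (cadj A (x :: 'b::chilbert) :: 'a::chilbert) y"
  by (subst (1 2) cinner_commute) (simp add: cadj_left[OF A])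

lemma norm_cadj_le:
  assumes A: "bounded_clinear A" and K: "\<And>x. norm (A x) \<le> norm x * K" "0 \<le> K"
  shows "norm (cadj A (y :: 'b::chilbert) :: 'a::chilbert) \<le> norm y * K"
proof (cases "cadj A y = 0")
  case False
  have "(norm (cadj A y))\<^sup>2 = cmod (cinner (cadj A y) (cadj A y))" by (simp add: cinner_self norm_power)
  also have "\<dots> = cmod (cinner (A (cadj A y)) y)" by (simp add: cadj_left[OF A])
  also have "\<dots> \<le> norm (A (cadj A y)) * norm y" by (rule cmod_cinner_le)
  also have "\<dots> \<le> (norm (cadj A y) * K) * norm y" by (intro mult_right_mono K) simp
  finally show ?thesis using False by (simp add: power2_eq_square field_simps)
qed (use K in simp)

lemma bounded_clinear_cadj:
  assumes A: "bounded_clinear (A :: 'a::chilbert \<Rightarrow> 'b::chilbert)"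
  shows "bounded_clinear (cadj A)"
proof -
  obtain K where K: "0 \<le> K" "\<And>x. norm (A x) \<le> norm x * K"
    using bounded_linear.nonneg_bounded[OF bounded_clinear_bounded_linear[OF A]] by blast
  show ?thesis
  proof (rule bounded_clinearI)
    show "norm (cadj A y) \<le> norm y * K" for y by (rule norm_cadj_le[OF A K(2,1)])
    show "cadj A (x + y) = cadj A x + cadj A y" for x y
      by (rule cinner_eqI) (simp add: cadj_right[OF A, symmetric] cinner_add_left)
    show "cadj A (c *\<^sub>C x) = c *\<^sub>C cadj A x" for c x
      by (rule cinner_eqI) (simp add: cadj_right[OF A, symmetric] cinner_scaleC_left)
  qed
qed

lemma cadj_compose:
  assumes "bounded_clinear A" "bounded_clinear B"
  shows "cadj (\<lambda>x. A (B x)) = (\<lambda>y. cadj B (cadj A y))"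
  by (rule cadj_unique) (simp add: cadj_left assms)

lemma cadj_id: "cadj (\<lambda>x. x) = (\<lambda>x. x)"
  by (rule cadj_unique) simp

subsection \<open>Positive square roots\<close>

text \<open>Taylor coefficients of (1 - t)^(1/2).\<close>

definition sqrt_coeff :: "nat \<Rightarrow> real" where
  "sqrt_coeff k = (-1) ^ k * ((1/2) gchoose k)"

lemma sqrt_coeff_0: "sqrt_coeff 0 = 1"
  by (simp add: sqrt_coeff_def)

lemma sqrt_coeff_Suc_nonpos: "sqrt_coeff (Suc k) \<le> 0"
proof -
  have "sqrt_coeff (Suc k) = - (pochhammer (1/2) k / (2 * fact (Suc k)))"
    by (simp add: sqrt_coeff_def gbinomial_pochhammer pochhammer_rec power_mult_distrib[symmetric]
        mult.assoc[symmetric] flip: power_add)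
  thus ?thesis by (simp add: pochhammer_nonneg)
qed

text \<open>Partial sums of coefficients are the coefficients after division by 1 - t, here those of
  (1 - t)^(-1/2), which are nonnegative.\<close>

lemma sum_sqrt_coeff_nonneg: "0 \<le> (\<Sum>k\<le>n. sqrt_coeff k)"
proof -
  have "(\<Sum>k\<le>n. sqrt_coeff k) = (-1) ^ n * ((1/2 - 1) gchoose n)"
    using gbinomial_sum_lower_neg[of "1/2 :: real" n] by (simp add: sqrt_coeff_def mult.commute)
  also have "\<dots> = pochhammer (1/2) n / fact n"
    by (simp add: gbinomial_pochhammer mult.assoc[symmetric] flip: power_add power_mult_distrib)
  finally show ?thesis by (simp add: pochhammer_nonneg)
qed

text \<open>Only the constant coefficient is positive, so the absolute sum is 1 minus a partial sum.
  This gives absolute convergence up to the boundary, which covers contractions of norm 1, and the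
  bound 1 is exactly what positivity of the root requires.\<close>

lemma sum_abs_sqrt_coeff: "(\<Sum>k=1..n. \<bar>sqrt_coeff k\<bar>) \<le> 1"
proof -
  have "(\<Sum>k=1..n. \<bar>sqrt_coeff k\<bar>) = (\<Sum>k=1..n. - sqrt_coeff k)"
  proof (intro sum.cong refl)
    fix k assume "k \<in> {1..n}"
    then obtain m where "k = Suc m" by (cases k) auto
    thus "\<bar>sqrt_coeff k\<bar> = - sqrt_coeff k" using sqrt_coeff_Suc_nonpos[of m] by simp
  qed
  also have "\<dots> = 1 - (\<Sum>k\<le>n. sqrt_coeff k)"
    by (simp add: atMost_atLeast0 sum.atLeast_Suc_atMost sqrt_coeff_0 sum_negf)
  finally show ?thesis using sum_sqrt_coeff_nonneg[of n] by linarith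
qed

lemma summable_sqrt_coeff: "summable (\<lambda>k. \<bar>sqrt_coeff k\<bar>)"
proof (rule summableI_nonneg_bounded)
  fix n
  have "(\<Sum>k<n. \<bar>sqrt_coeff k\<bar>) \<le> (\<Sum>k\<le>n. \<bar>sqrt_coeff k\<bar>)" by (intro sum_mono2) auto
  also have "\<dots> = 1 + (\<Sum>k=1..n. \<bar>sqrt_coeff k\<bar>)"
    by (simp add: atMost_atLeast0 sum.atLeast_Suc_atMost sqrt_coeff_0)
  also have "\<dots> \<le> 2" using sum_abs_sqrt_coeff[of n] by simp
  finally show "(\<Sum>k<n. \<bar>sqrt_coeff k\<bar>) \<le> 2" .
qed simp

text \<open>Vandermonde's identity for 1/2 + 1/2 = 1: squaring the root series returns 1 -
  t.\<close>

lemma sqrt_coeff_convolution: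
  "(\<Sum>k\<le>n. sqrt_coeff k * sqrt_coeff (n - k)) = (if n = 0 then 1 else if n = 1 then -1 else 0)"
proof -
  have "(\<Sum>k\<le>n. sqrt_coeff k * sqrt_coeff (n - k))
      = (\<Sum>k\<le>n. (-1) ^ n * (((1/2) gchoose k) * ((1/2) gchoose (n - k))))"
    by (intro sum.cong refl) (simp add: sqrt_coeff_def flip: power_add)
  also have "\<dots> = (-1) ^ n * (1 gchoose n)"
    using gbinomial_Vandermonde[of "1/2 :: real" "1/2" n]
    by (simp add: atMost_atLeast0 flip: sum_distrib_left)
  also have "(1::real) gchoose n = of_nat (1 choose n)"
    using binomial_gbinomial[of 1 n, where 'a = real] by simp
  also have "(-1) ^ n * of_nat (1 choose n) = (if n = 0 then 1 else if n = 1 then -1 else 0 :: real)"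
    by (cases n) (auto simp: binomial_eq_0)
  finally show ?thesis .
qed

definition sqrt_series :: "('a::chilbert \<Rightarrow> 'a) \<Rightarrow> 'a \<Rightarrow> 'a" where
  "sqrt_series Q x = (\<Sum>k. sqrt_coeff k *\<^sub>R (Q ^^ k) x)"

context
  fixes Q :: "'a::chilbert \<Rightarrow> 'a"
  assumes Q: "bounded_clinear Q" and Q1: "\<And>x. norm (Q x) \<le> norm x"
begin

lemma bounded_clinear_funpow: "bounded_clinear (Q ^^ k)"
proof (induction k)
  case (Suc k)
  show ?case using bounded_clinear_compose[OF Q Suc] by (simp add: comp_def)
qed (simp add: id_def bounded_clinear_id)

lemma norm_funpow_le: "norm ((Q ^^ k) x) \<le> norm x"
proof (induction k)
  case (Suc k)
  show ?case using order_trans[OF Q1 Suc] by simp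
qed simp

lemma norm_sqrt_term_le: "norm (sqrt_coeff k *\<^sub>R (Q ^^ k) x) \<le> \<bar>sqrt_coeff k\<bar> * norm x"
  unfolding norm_scaleR by (intro mult_left_mono norm_funpow_le abs_ge_zero)

lemma summable_norm_sqrt_term: "summable (\<lambda>k. norm (sqrt_coeff k *\<^sub>R (Q ^^ k) x))"
  by (rule summable_comparison_test'[of "\<lambda>k. \<bar>sqrt_coeff k\<bar> * norm x" 0])
    (use norm_sqrt_term_le in \<open>auto intro: summable_mult2 summable_sqrt_coeff\<close>)

lemma sqrt_series_sums: "(\<lambda>k. sqrt_coeff k *\<^sub>R (Q ^^ k) x) sums sqrt_series Q x"
  unfolding sqrt_series_def
  by (rule summable_sums[OF summable_norm_cancel[OF summable_norm_sqrt_term]])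

lemma sqrt_series_has_sum: "((\<lambda>k. sqrt_coeff k *\<^sub>R (Q ^^ k) x) has_sum sqrt_series Q x) UNIV"
  by (rule norm_summable_imp_has_sum[OF summable_norm_sqrt_term sqrt_series_sums])

lemma bounded_clinear_sqrt_series: "bounded_clinear (sqrt_series Q)"
proof (rule bounded_clinearI[where K = "\<Sum>k. \<bar>sqrt_coeff k\<bar>"])
  note P = bounded_clinear_funpow
  fix x y and c :: complex
  show "sqrt_series Q (x + y) = sqrt_series Q x + sqrt_series Q y"
    using sums_add[OF sqrt_series_sums[of x] sqrt_series_sums[of y]] sqrt_series_sums[of "x + y"]
    by (auto simp: bounded_clinear_add[OF P] scaleR_add_right intro: sums_unique2)
  show "sqrt_series Q (c *\<^sub>C x) = c *\<^sub>C sqrt_series Q x"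
    using bounded_linear.sums[OF bounded_linear_scaleC_right[of c] sqrt_series_sums[of x]]
      sqrt_series_sums[of "c *\<^sub>C x"]
    by (auto simp: bounded_clinear_scaleC[OF P] scaleC_scaleR intro: sums_unique2)
  have "norm (sqrt_series Q x) \<le> (\<Sum>k. norm (sqrt_coeff k *\<^sub>R (Q ^^ k) x))"
    unfolding sqrt_series_def by (rule summable_norm[OF summable_norm_sqrt_term])
  also have "\<dots> \<le> (\<Sum>k. \<bar>sqrt_coeff k\<bar> * norm x)"
    by (intro suminf_le norm_sqrt_term_le summable_norm_sqrt_term summable_mult2 summable_sqrt_coeff)
  also have "\<dots> = norm x * (\<Sum>k. \<bar>sqrt_coeff k\<bar>)"
    using suminf_mult[OF summable_sqrt_coeff, of "norm x"] by (simp add: mult.commute)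
  finally show "norm (sqrt_series Q x) \<le> norm x * (\<Sum>k. \<bar>sqrt_coeff k\<bar>)" .
qed

text \<open>The absolutely summable double family \<open>F\<close> is summed in two ways: by rows it
  is the root applied twice, by antidiagonals j + k = n it is the Cauchy product, which collapses to
  two terms.\<close>

lemma sqrt_series_square: "sqrt_series Q (sqrt_series Q x) = x - Q x"
proof -
  note P = bounded_clinear_funpow
  define F where "F = (\<lambda>(j, k). (sqrt_coeff j * sqrt_coeff k) *\<^sub>R (Q ^^ (j + k)) x)"
  have inner: "((\<lambda>k. F (j, k)) has_sum (sqrt_coeff j *\<^sub>R (Q ^^ j) (sqrt_series Q x))) UNIV" for j
  proof -
    have "((\<lambda>k. sqrt_coeff j *\<^sub>R (Q ^^ j) (sqrt_coeff k *\<^sub>R (Q ^^ k) x))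
        has_sum (sqrt_coeff j *\<^sub>R (Q ^^ j) (sqrt_series Q x))) UNIV"
      by (rule has_sum_bounded_linear[OF bounded_linear_compose[OF bounded_linear_scaleR_right
              bounded_clinear_bounded_linear[OF P]] sqrt_series_has_sum])
    thus ?thesis by (simp add: F_def bounded_clinear_scaleR[OF P] funpow_add)
  qed
  have abs: "(\<lambda>k. \<bar>sqrt_coeff k\<bar>) summable_on UNIV"
    by (rule summable_nonneg_imp_summable_on[OF summable_sqrt_coeff]) simp
  have "(\<lambda>(j, k). \<bar>sqrt_coeff j\<bar> * (\<bar>sqrt_coeff k\<bar> * norm x)) summable_on UNIV \<times> UNIV"
    by (rule summable_on_SigmaI[where g = "\<lambda>j. \<bar>sqrt_coeff j\<bar> * ((\<Sum>\<^sub>\<infinity>k. \<bar>sqrt_coeff k\<bar>) * norm x)"])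
      (auto intro!: has_sum_cmult_right has_sum_cmult_left has_sum_infsum abs summable_on_cmult_left)
  hence "(\<lambda>p. norm (F p)) summable_on UNIV \<times> UNIV"
    by (rule Infinite_Sum.abs_summable_on_comparison_test')
      (auto simp: F_def abs_mult mult.assoc intro!: mult_left_mono norm_funpow_le)
  hence Fs: "F summable_on UNIV \<times> UNIV" by (rule Infinite_Sum.abs_summable_summable)
  define S where "S = infsum F (UNIV \<times> UNIV)"
  have FS: "(F has_sum S) (UNIV \<times> UNIV)" unfolding S_def by (rule has_sum_infsum[OF Fs])
  have "((\<lambda>j. sqrt_coeff j *\<^sub>R (Q ^^ j) (sqrt_series Q x)) has_sum S) UNIV"
    by (rule has_sum_SigmaD[OF FS]) (rule inner)
  hence 1: "sqrt_series Q (sqrt_series Q x) = S"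
    by (rule has_sum_unique[OF sqrt_series_has_sum])
  have "((\<lambda>(n, k). F (k, n - k)) has_sum S) (SIGMA n:UNIV. {..n})"
    by (rule has_sum_reindex_bij_witness[where S = "UNIV \<times> UNIV" and g = F and s = S
          and j = "\<lambda>(j, k). (j + k, j)" and i = "\<lambda>(n, k). (k, n - k)", THEN iffD1, OF _ _ _ _ _ _ FS])
      auto
  hence "((\<lambda>n. \<Sum>k\<le>n. F (k, n - k)) has_sum S) UNIV"
    by (rule has_sum_SigmaD) (auto intro: has_sum_finiteI)
  moreover have "(\<Sum>k\<le>n. F (k, n - k)) = (\<Sum>k\<le>n. sqrt_coeff k * sqrt_coeff (n - k)) *\<^sub>R (Q ^^ n) x" for n
    by (auto simp: F_def scaleR_sum_left intro!: sum.cong)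
  ultimately have 2: "((\<lambda>n. (if n = 0 then 1 else if n = 1 then -1 else 0) *\<^sub>R (Q ^^ n) x) has_sum S) UNIV"
    by (simp only: sqrt_coeff_convolution)
  have "((\<lambda>n. (if n = 0 then 1 else if n = 1 then -1 else 0) *\<^sub>R (Q ^^ n) x) has_sum (x - Q x)) UNIV"
    by (rule has_sum_finite_neutralI[of "{0, 1}"]) auto
  thus ?thesis using 1 has_sum_unique[OF 2] by simp
qed

lemma sqrt_series_cinner:
  assumes "\<And>x y. cinner (Q x) y = cinner x (Q y)"
  shows "cinner (sqrt_series Q x) y = cinner x (sqrt_series Q y)"
proof -
  have Qk: "cinner ((Q ^^ k) x) y = cinner x ((Q ^^ k) y)" for k x y
    by (induction k arbitrary: x y) (simp_all add: assms funpow_swap1)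
  have "(\<lambda>k. cinner (sqrt_coeff k *\<^sub>R (Q ^^ k) x) y) sums cinner (sqrt_series Q x) y"
    by (rule bounded_linear.sums[OF bounded_linear_cinner_left sqrt_series_sums])
  moreover have "(\<lambda>k. cinner x (sqrt_coeff k *\<^sub>R (Q ^^ k) y)) sums cinner x (sqrt_series Q y)"
    by (rule bounded_linear.sums[OF bounded_linear_cinner_right sqrt_series_sums])
  ultimately show ?thesis
    by (simp add: cinner_scaleR_left cinner_scaleR_right Qk sums_unique2)
qed

text \<open>The k = 0 term contributes |x|^2, and since powers of Q are contractions, the other
  terms take away at most |x|^2 by \<open>sum_abs_sqrt_coeff\<close>.\<close>

lemma positive_op_sqrt_series:
  assumes sa: "\<And>x y. cinner (Q x) y = cinner x (Q y)"
  shows "positive_op (sqrt_series Q)"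
  unfolding positive_op_def
proof (intro conjI allI bounded_clinear_sqrt_series)
  fix x
  have "cinner (sqrt_series Q x) x = cnj (cinner (sqrt_series Q x) x)"
    by (subst (2) cinner_commute) (simp add: sqrt_series_cinner[OF sa])
  thus "cinner (sqrt_series Q x) x \<in> \<real>" by (metis Reals_cnj_iff)
  have lim: "(\<lambda>k. inner (sqrt_coeff k *\<^sub>R (Q ^^ k) x) x) sums inner (sqrt_series Q x) x"
    by (rule bounded_linear.sums[OF bounded_linear_inner_left sqrt_series_sums])
  have "0 \<le> (\<Sum>k\<le>n. inner (sqrt_coeff k *\<^sub>R (Q ^^ k) x) x)" for n
  proof -
    have "- (\<bar>sqrt_coeff k\<bar> * (norm x)\<^sup>2) \<le> inner (sqrt_coeff k *\<^sub>R (Q ^^ k) x) x" for k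
    proof -
      have "\<bar>inner (sqrt_coeff k *\<^sub>R (Q ^^ k) x) x\<bar> \<le> norm (sqrt_coeff k *\<^sub>R (Q ^^ k) x) * norm x"
        by (rule Cauchy_Schwarz_ineq2)
      also have "\<dots> \<le> (\<bar>sqrt_coeff k\<bar> * norm x) * norm x"
        by (intro mult_right_mono norm_sqrt_term_le) simp
      finally show ?thesis by (simp add: power2_eq_square mult.assoc)
    qed
    hence "(\<Sum>k=1..n. - (\<bar>sqrt_coeff k\<bar> * (norm x)\<^sup>2)) \<le> (\<Sum>k=1..n. inner (sqrt_coeff k *\<^sub>R (Q ^^ k) x) x)"
      by (intro sum_mono)
    moreover have "(\<Sum>k=1..n. \<bar>sqrt_coeff k\<bar>) * (norm x)\<^sup>2 \<le> 1 * (norm x)\<^sup>2"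
      by (intro mult_right_mono sum_abs_sqrt_coeff) simp
    moreover have "(\<Sum>k\<le>n. inner (sqrt_coeff k *\<^sub>R (Q ^^ k) x) x)
        = (norm x)\<^sup>2 + (\<Sum>k=1..n. inner (sqrt_coeff k *\<^sub>R (Q ^^ k) x) x)"
      by (simp add: atMost_atLeast0 sum.atLeast_Suc_atMost sqrt_coeff_0 power2_norm_eq_inner)
    ultimately show ?thesis by (simp add: sum_negf sum_distrib_right)
  qed
  hence "0 \<le> inner (sqrt_series Q x) x"
    using lim unfolding sums_def_le by (intro LIMSEQ_le_const) auto
  thus "0 \<le> Re (cinner (sqrt_series Q x) x)" by (simp add: inner_cinner)
qed

end

text \<open>The relation passes to powers and, by continuity of B, to the series. It yields
  \<open>B_Dr\<close> and \<open>cadj_Dl\<close>, and the commutation in the uniqueness of positive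
  roots.\<close>

lemma sqrt_series_intertwine:
  assumes B: "bounded_clinear B" and Q: "bounded_clinear Q" "\<And>x. norm (Q x) \<le> norm x"
    and Q': "bounded_clinear Q'" "\<And>x. norm (Q' x) \<le> norm x" and eq: "\<And>x. B (Q x) = Q' (B x)"
  shows "B (sqrt_series Q x) = sqrt_series Q' (B x)"
proof -
  have Bk: "B ((Q ^^ k) x) = (Q' ^^ k) (B x)" for k by (induction k) (simp_all add: eq)
  have "(\<lambda>k. B (sqrt_coeff k *\<^sub>R (Q ^^ k) x)) sums B (sqrt_series Q x)"
    by (rule bounded_linear.sums[OF bounded_clinear_bounded_linear[OF B] sqrt_series_sums[OF Q]])
  moreover have "(\<lambda>k. sqrt_coeff k *\<^sub>R (Q' ^^ k) (B x)) sums sqrt_series Q' (B x)"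
    by (rule sqrt_series_sums[OF Q'])
  ultimately show ?thesis by (simp add: bounded_clinear_scaleR[OF B] Bk sums_unique2)
qed

text \<open>Polarization: the form s measuring the failure of symmetry vanishes on the diagonal;
  evaluating it at x + y and x + i y gives two relations that force s = 0.\<close>

lemma positive_op_cinner:
  assumes "positive_op R"
  shows "cinner (R x) y = cinner x (R y)"
proof -
  have R: "bounded_clinear R" and real: "\<And>x. cinner (R x) x \<in> \<real>"
    using assms by (auto simp: positive_op_def)
  define s where "s x y = cinner (R x) y - cinner x (R y)" for x y
  have s0: "s z z = 0" for z
    using real[of z] by (subst s_def, subst (2) cinner_commute) (simp add: Reals_cnj_iff)
  have "s (x + y) (x + y) = s x x + s x y + s y x + s y y"
    by (simp add: s_def bounded_clinear_add[OF R] cinner_add_left cinner_add_right)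
  hence 1: "s x y + s y x = 0" by (simp add: s0)
  have "s (x + \<i> *\<^sub>C y) (x + \<i> *\<^sub>C y) = s x x - \<i> * s x y + \<i> * s y x + s y y"
    by (simp add: s_def bounded_clinear_add[OF R] cinner_add_left cinner_add_right
        bounded_clinear_scaleC[OF R] cinner_scaleC_left cinner_scaleC_right algebra_simps)
  hence "\<i> * (s y x - s x y) = 0" by (simp add: s0 algebra_simps)
  hence "s x y = 0" using 1 by simp
  thus ?thesis by (simp add: s_def)
qed

text \<open>Moving from y to y + t R y changes the form from 0 to 2 t q + t^2 c with q = |R y|^2. At
  t = -q/(c + 1) this is negative unless q = 0; the added 1 covers c = 0.\<close>

lemma positive_op_null:
  assumes "positive_op R" and "inner (R y) y = 0"
  shows "R y = 0"
proof -
  have R: "bounded_clinear R" and pos: "\<And>x. 0 \<le> inner (R x) x"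
    using assms by (auto simp: positive_op_def inner_cinner)
  have sym: "inner (R x) z = inner x (R z)" for x z
    by (simp add: inner_cinner positive_op_cinner[OF assms(1)])
  define c where "c = inner (R (R y)) (R y)"
  define q where "q = inner (R y) (R y)"
  have "c \<ge> 0" unfolding c_def by (rule pos)
  have "inner (R (y + t *\<^sub>R R y)) (y + t *\<^sub>R R y) = 2 * t * q + t\<^sup>2 * c" for t
    using assms(2) sym[of "R y" y]
    by (simp add: bounded_clinear_add[OF R] bounded_clinear_scaleR[OF R] inner_add_left
        inner_add_right c_def q_def power2_eq_square algebra_simps)
  hence *: "0 \<le> 2 * t * q + t\<^sup>2 * c" for t by (metis pos)
  define p where "p = c + 1"
  have "p > 0" using \<open>c \<ge> 0\<close> by (simp add: p_def)
  have "0 \<le> 2 * (- (q / p)) * q + (- (q / p))\<^sup>2 * (p - 1)"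
    using *[of "- (q / p)"] by (simp add: p_def)
  also have "\<dots> = - (q\<^sup>2 * (p + 1) / p\<^sup>2)"
    using \<open>p > 0\<close> by (simp add: field_simps power2_eq_square)
  finally have "q\<^sup>2 * (p + 1) / p\<^sup>2 \<le> 0" by simp
  hence "q\<^sup>2 \<le> 0" using \<open>p > 0\<close> by (simp add: divide_le_0_iff mult_le_0_iff)
  thus ?thesis by (simp add: q_def)
qed

text \<open>Uniqueness of the positive square root: \<open>R\<close> and \<open>S\<close> commute, so with \<open>y = (R - S) x\<close> we
  have \<open>\<langle>R y, y\<rangle> + \<langle>S y, y\<rangle> = \<langle>(R\<^sup>2 - S\<^sup>2) x, y\<rangle> = 0\<close>.\<close>

lemma op_sqrt_eq:
  assumes Q: "bounded_clinear Q" "\<And>x. norm (Q x) \<le> norm x"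
    and sa: "\<And>x y. cinner (Q x) y = cinner x (Q y)"
  shows "op_sqrt (\<lambda>x. x - Q x) = sqrt_series Q"
  unfolding op_sqrt_def
proof (rule the_equality)
  let ?S = "sqrt_series Q"
  show S: "positive_op ?S \<and> ?S \<circ> ?S = (\<lambda>x. x - Q x)"
    using positive_op_sqrt_series[OF Q sa] sqrt_series_square[OF Q] by (simp add: comp_def)
  fix R assume "positive_op R \<and> R \<circ> R = (\<lambda>x. x - Q x)"
  hence Rp: "positive_op R" and RR: "\<And>x. R (R x) = x - Q x" by (auto simp: fun_eq_iff)
  have R: "bounded_clinear R" using Rp by (simp add: positive_op_def)
  have Sb: "bounded_clinear ?S" by (rule bounded_clinear_sqrt_series[OF Q])
  \<comment> \<open>Q is I minus the square of R, so R commutes with Q and hence with every series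
    in Q.\<close>
  have "R (Q x) = Q (R x)" for x
    using RR[of "R x"] RR[of x] bounded_clinear_diff[OF R, of x "Q x"] by simp
  hence comm: "R (?S x) = ?S (R x)" for x by (rule sqrt_series_intertwine[OF R Q Q])
  show "R = ?S"
  proof
    fix x
    define y where "y = R x - ?S x"
    have "R y + ?S y = 0"
      by (simp add: y_def bounded_clinear_diff[OF R] bounded_clinear_diff[OF Sb] RR comm
          sqrt_series_square[OF Q])
    hence "inner (R y) y + inner (?S y) y = 0" by (simp flip: inner_add_left)
    moreover have "0 \<le> inner (R y) y" "0 \<le> inner (?S y) y"
      using Rp S by (auto simp: positive_op_def inner_cinner)
    ultimately have "R y = 0" "?S y = 0"
      using positive_op_null[OF Rp] positive_op_null[of ?S] S by auto
    hence "cinner y y = 0"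
      by (subst (1) y_def) (simp add: cinner_diff_left positive_op_cinner[OF Rp]
          positive_op_cinner[of ?S] S)
    thus "R x = ?S x" by (simp add: cinner_self y_def)
  qed
qed

lemma power2_norm_cinner: "(norm x)\<^sup>2 = Re (cinner x x)"
  by (simp add: cinner_self)

subsection \<open>Halmos's unitary of a contraction\<close>

locale contraction =
  fixes B :: "'k::chilbert \<Rightarrow> 'h::chilbert"
  assumes B: "bounded_clinear B" and B1: "\<And>v. norm (B v) \<le> norm v"
begin

text \<open>Left is the codomain side of \<open>B\<close>, right the domain side. For the row f(T),
  \<open>Dl\<close> and \<open>Dr\<close> become the two defect operators of the characteristic
  function, which are also given by \<open>op_sqrt\<close>.\<close>

definition Dl :: "'h \<Rightarrow> 'h" where "Dl = op_sqrt (\<lambda>x. x - B (cadj B x))"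

definition Dr :: "'k \<Rightarrow> 'k" where "Dr = op_sqrt (\<lambda>v. v - cadj B (B v))"

lemma norm_cadj1: "norm (cadj B x) \<le> norm x"
  using norm_cadj_le[OF B, of 1 x] B1 by simp

lemmas bounded_clinear_cadj_B = bounded_clinear_cadj[OF B]

lemma B_cadj_B:
  shows "bounded_clinear (\<lambda>x. B (cadj B x))" "norm (B (cadj B x)) \<le> norm x"
    "cinner (B (cadj B x)) y = cinner x (B (cadj B y))"
  by (rule bounded_clinear_compose[OF B bounded_clinear_cadj_B]) (auto intro: order_trans[OF B1 norm_cadj1]
      simp: cadj_left[OF B] cadj_right[OF B])

lemma cadj_B_B:
  shows "bounded_clinear (\<lambda>v. cadj B (B v))" "norm (cadj B (B v)) \<le> norm v"
    "cinner (cadj B (B v)) w = cinner v (cadj B (B w))"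
  by (rule bounded_clinear_compose[OF bounded_clinear_cadj_B B]) (auto intro: order_trans[OF norm_cadj1 B1]
      simp: cadj_left[OF B, symmetric] cadj_right[OF B, symmetric])

lemma Dl_series: "Dl = sqrt_series (\<lambda>x. B (cadj B x))"
  unfolding Dl_def by (rule op_sqrt_eq) (rule B_cadj_B)+

lemma Dr_series: "Dr = sqrt_series (\<lambda>v. cadj B (B v))"
  unfolding Dr_def by (rule op_sqrt_eq) (rule cadj_B_B)+

lemma bounded_clinear_Dl: "bounded_clinear Dl"
  unfolding Dl_series by (rule bounded_clinear_sqrt_series) (rule B_cadj_B)+

lemma bounded_clinear_Dr: "bounded_clinear Dr"
  unfolding Dr_series by (rule bounded_clinear_sqrt_series) (rule cadj_B_B)+

lemma Dl_Dl: "Dl (Dl x) = x - B (cadj B x)"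
  unfolding Dl_series by (rule sqrt_series_square) (rule B_cadj_B)+

lemma Dr_Dr: "Dr (Dr v) = v - cadj B (B v)"
  unfolding Dr_series by (rule sqrt_series_square) (rule cadj_B_B)+

lemma Dl_cinner: "cinner (Dl x) y = cinner x (Dl y)"
  unfolding Dl_series by (rule sqrt_series_cinner) (rule B_cadj_B)+

lemma Dr_cinner: "cinner (Dr v) w = cinner v (Dr w)"
  unfolding Dr_series by (rule sqrt_series_cinner) (rule cadj_B_B)+

lemma B_Dr: "B (Dr v) = Dl (B v)"
  unfolding Dl_series Dr_series by (rule sqrt_series_intertwine[OF B cadj_B_B(1,2) B_cadj_B(1,2)]) simp

lemma cadj_Dl: "cadj B (Dl x) = Dr (cadj B x)"
  unfolding Dl_series Dr_series by (rule sqrt_series_intertwine[OF bounded_clinear_cadj_B B_cadj_B(1,2) cadj_B_B(1,2)]) simp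

lemma norm_Dl: "(norm (Dl x))\<^sup>2 = (norm x)\<^sup>2 - (norm (cadj B x))\<^sup>2"
  by (simp add: power2_norm_cinner Dl_cinner Dl_Dl cinner_diff_right cadj_right[OF B])

lemma norm_Dr: "(norm (Dr v))\<^sup>2 = (norm v)\<^sup>2 - (norm (B v))\<^sup>2"
  by (simp add: power2_norm_cinner Dr_cinner Dr_Dr cinner_diff_right cadj_left[OF B])

text \<open>The block matrix with rows (B*, Dr) and (Dl, -B) is isometric: the diagonal terms add up
  by \<open>norm_Dl\<close> and \<open>norm_Dr\<close>, and the cross terms cancel since B* Dl = Dr
  B*.\<close>

lemma halmos:
  "(norm (cadj B y + Dr u))\<^sup>2 + (norm (Dl y - B u))\<^sup>2 = (norm y)\<^sup>2 + (norm u)\<^sup>2"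
proof -
  have "cinner (Dl y) (B u) = cinner (cadj B y) (Dr u)"
    by (simp add: cadj_right[OF B] cadj_Dl Dr_cinner)
  hence "inner (Dl y) (B u) = inner (cadj B y) (Dr u)" by (simp add: inner_cinner)
  moreover have "(norm (cadj B y + Dr u))\<^sup>2
      = (norm (cadj B y))\<^sup>2 + 2 * inner (cadj B y) (Dr u) + (norm (Dr u))\<^sup>2"
    unfolding power2_norm_eq_inner by (simp add: inner_add_left inner_add_right inner_commute)
  moreover have "(norm (Dl y - B u))\<^sup>2
      = (norm (Dl y))\<^sup>2 - 2 * inner (Dl y) (B u) + (norm (B u))\<^sup>2"
    unfolding power2_norm_eq_inner by (simp add: inner_diff_left inner_diff_right inner_commute)
  ultimately show ?thesis using norm_Dl[of y] norm_Dr[of u] by simp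
qed

end

subsection \<open>Vector-valued \<open>\<ell>\<^sup>2\<close> spaces\<close>

lemma coef_Abs_l2: "(\<lambda>a. (norm (u a))\<^sup>2) summable_on UNIV \<Longrightarrow> coef (Abs_l2 u) = u"
  by (rule Abs_l2_inverse) simp

lemma l2_eqI: "(\<And>a. coef u a = coef v a) \<Longrightarrow> u = v"
  by (metis coef_inject ext)

lemma coef_sum: "coef (\<Sum>i\<in>I. u i) a = (\<Sum>i\<in>I. coef (u i) a)"
  by (induction I rule: infinite_finite_induct) (simp_all add: zero_l2.rep_eq plus_l2.rep_eq)

lemmas coef_simps = zero_l2.rep_eq plus_l2.rep_eq minus_l2.rep_eq uminus_l2.rep_eq scaleR_l2.rep_eq
  scaleC_l2.rep_eq coef_sum tens.rep_eq ket.rep_eq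

lemma norm_l2_has_sum: "((\<lambda>a. (norm (coef u a))\<^sup>2) has_sum (norm u)\<^sup>2) UNIV"
  unfolding norm_l2_sq by (rule has_sum_infsum[OF l2_summable])

lemma cinner_l2_has_sum: "((\<lambda>a. cinner (coef u a) (coef v a)) has_sum cinner u v) UNIV"
  unfolding cinner_l2_def by (rule has_sum_infsum[OF l2_cinner_summable])

lemma cinner_tens: "cinner (tens u x) (tens v y) = cinner u v * cinner x y"
proof -
  have "((\<lambda>a. cinner (coef u a) (coef v a) * cinner x y) has_sum (cinner u v * cinner x y)) UNIV"
    by (rule has_sum_cmult_left[OF cinner_l2_has_sum])
  moreover have "((\<lambda>a. cinner (coef u a) (coef v a) * cinner x y) has_sum cinner (tens u x) (tens v y)) UNIV"
    using cinner_l2_has_sum[of "tens u x" "tens v y"]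
    by (simp add: tens.rep_eq cinner_scaleC_left cinner_scaleC_right cinner_complex_def
        scaleC_complex_def mult.assoc mult.left_commute)
  ultimately show ?thesis by (rule has_sum_unique[symmetric])
qed

lemma norm_tens: "norm (tens u x) = norm u * norm x"
proof -
  have "(norm (tens u x))\<^sup>2 = (norm u * norm x)\<^sup>2"
    unfolding power2_norm_cinner[of "tens u x"] cinner_tens
    by (simp add: cinner_self power_mult_distrib)
  thus ?thesis by (rule power2_eq_imp_eq) simp_all
qed

lemma tens_simps:
  "tens (u + v) x = tens u x + tens v x" "tens u (x + y) = tens u x + tens u y"
  "tens (c *\<^sub>C u) x = c *\<^sub>C tens u x" "tens u (c *\<^sub>C x) = c *\<^sub>C tens u x"
  "tens u (x - y) = tens u x - tens u y" "tens 0 x = 0" "tens u 0 = 0"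
  "tens (r *\<^sub>R u) x = r *\<^sub>R tens u x"
proof -
  show "tens (r *\<^sub>R u) x = r *\<^sub>R tens u x"
    by (rule l2_eqI) (simp add: coef_simps scaleR_scaleC scaleC_scaleC scaleR_conv_of_real
        scaleC_complex_def)
qed (rule l2_eqI, simp add: coef_simps scaleC_add_left scaleC_add_right scaleC_scaleC
    scaleC_complex_def scaleC_diff_right mult.commute)+

lemma bounded_clinear_tens_left: "bounded_clinear (\<lambda>u. tens u x)"
  by (rule bounded_clinearI[where K = "norm x"]) (simp_all add: tens_simps norm_tens)

lemma coef_tens_ket: "coef (tens (ket a) x) b = (if b = a then x else 0)"
  by (simp add: coef_simps)

lemma cinner_tens_ket: "cinner w (tens (ket a) x) = cinner (coef w a) x"
proof -
  have "((\<lambda>b. cinner (coef w b) (coef (tens (ket a) x) b)) has_sum cinner (coef w a) x) UNIV"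
    by (rule has_sum_finite_neutralI[of "{a}"]) (auto simp: coef_tens_ket)
  thus ?thesis by (rule has_sum_unique[OF cinner_l2_has_sum])
qed

lemma norm_sum_tens_ket:
  assumes "finite F"
  shows "(norm (\<Sum>a\<in>F. tens (ket a) (w a)))\<^sup>2 = (\<Sum>a\<in>F. (norm (w a))\<^sup>2)"
proof -
  have "((\<lambda>b. (norm (coef (\<Sum>a\<in>F. tens (ket a) (w a)) b))\<^sup>2) has_sum (\<Sum>a\<in>F. (norm (w a))\<^sup>2)) UNIV"
    using assms by (intro has_sum_finite_neutralI[of F])
      (auto simp: coef_sum coef_tens_ket intro!: sum.cong)
  thus ?thesis by (rule has_sum_unique[OF norm_l2_has_sum])
qed

text \<open>A finite partial sum is an orthogonal projection of w, so its squared distance to w is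
  |w|^2 minus a partial sum of the squared coordinate norms.\<close>

lemma has_sum_tens_ket: "((\<lambda>a. tens (ket a) (coef w a)) has_sum w) UNIV"
  unfolding has_sum_def
proof (rule tendstoI)
  fix e :: real assume "e > 0"
  hence "\<forall>\<^sub>F F in finite_subsets_at_top UNIV. dist (\<Sum>a\<in>F. (norm (coef w a))\<^sup>2) ((norm w)\<^sup>2) < e\<^sup>2"
    using norm_l2_has_sum[of w] unfolding has_sum_def by (intro tendstoD) auto
  moreover have "\<forall>\<^sub>F F in finite_subsets_at_top (UNIV :: 'a set). finite F"
    by (simp add: eventually_finite_subsets_at_top_weakI)
  ultimately show "\<forall>\<^sub>F F in finite_subsets_at_top UNIV. dist (\<Sum>a\<in>F. tens (ket a) (coef w a)) w < e"
  proof eventually_elim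
    case (elim F)
    let ?s = "\<Sum>a\<in>F. tens (ket a) (coef w a)"
    have "inner w ?s = (\<Sum>a\<in>F. (norm (coef w a))\<^sup>2)"
      by (simp add: inner_sum_right inner_cinner cinner_sum_right cinner_tens_ket power2_norm_cinner)
    moreover have "(norm (?s - w))\<^sup>2 = (norm ?s)\<^sup>2 - 2 * inner w ?s + (norm w)\<^sup>2"
      unfolding power2_norm_eq_inner by (simp add: inner_diff_left inner_diff_right inner_commute)
    ultimately have "(norm (?s - w))\<^sup>2 = (norm w)\<^sup>2 - (\<Sum>a\<in>F. (norm (coef w a))\<^sup>2)"
      using norm_sum_tens_ket[OF \<open>finite F\<close>] by simp
    also have "\<dots> < e\<^sup>2" using elim by (simp add: dist_real_def)
    finally show ?case using \<open>e > 0\<close> by (simp add: dist_norm power2_less_imp_less)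
  qed
qed

lemma tens_complex: "tens u (x :: complex) = x *\<^sub>C u"
  by (rule l2_eqI) (simp add: coef_simps scaleC_complex_def mult.commute)

lemma has_sum_ket: "((\<lambda>a. coef u a *\<^sub>C ket a) has_sum u) UNIV"
  using has_sum_tens_ket[of u] by (simp add: tens_complex)

lemma l2_complex_op_eqI:
  assumes "bounded_clinear A" "bounded_clinear B" "\<And>a. A (ket a) = B (ket a)"
  shows "A u = B u"
proof -
  have "((\<lambda>a. A (coef u a *\<^sub>C ket a)) has_sum A u) UNIV" "((\<lambda>a. B (coef u a *\<^sub>C ket a)) has_sum B u) UNIV"
    by (auto intro!: has_sum_bounded_linear[OF _ has_sum_ket] bounded_clinear_bounded_linear assms)
  thus ?thesis
    by (auto simp: bounded_clinear_scaleC[OF assms(1)] bounded_clinear_scaleC[OF assms(2)] assms(3)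
        intro: has_sum_unique)
qed

lemma l2_op_eqI:
  assumes "bounded_clinear A" "bounded_clinear B" "\<And>a x. A (tens (ket a) x) = B (tens (ket a) x)"
  shows "A u = B u"
proof -
  have "((\<lambda>a. A (tens (ket a) (coef u a))) has_sum A u) UNIV"
    "((\<lambda>a. B (tens (ket a) (coef u a))) has_sum B u) UNIV"
    by (auto intro!: has_sum_bounded_linear[OF _ has_sum_tens_ket] bounded_clinear_bounded_linear assms)
  thus ?thesis by (auto simp: assms(3) intro: has_sum_unique)
qed

text \<open>Tensors over basis vectors already determine a bounded operator, so the definite
  description in \<open>op_tensor\<close> denotes any candidate that has the right values.\<close>

lemma op_tensor_eqI:
  assumes "bounded_clinear C" and "\<And>u x. C (tens u x) = tens (A u) (B x)"
  shows "op_tensor A B = C"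
  unfolding op_tensor_def
proof (rule the_equality)
  fix C' assume C': "bounded_clinear C' \<and> (\<forall>u x. C' (tens u x) = tens (A u) (B x))"
  show "C' = C" by (rule ext, rule l2_op_eqI) (use C' assms in auto)
qed (use assms in blast)

subsection \<open>Operators acting on the coordinates\<close>

lemma sq_summable_map:
  assumes B: "bounded_clinear B"
  shows "(\<lambda>a. (norm (B (coef u a)))\<^sup>2) summable_on UNIV"
proof -
  obtain K where K: "0 \<le> K" "\<And>x. norm (B x) \<le> norm x * K"
    using bounded_linear.nonneg_bounded[OF bounded_clinear_bounded_linear[OF B]] by blast
  show ?thesis
  proof (rule sq_summable_bound)
    show "(\<lambda>a. K\<^sup>2 * (norm (coef u a))\<^sup>2) summable_on UNIV"
      by (rule summable_on_cmult_right[OF l2_summable])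
    show "(norm (B (coef u a)))\<^sup>2 \<le> K\<^sup>2 * (norm (coef u a))\<^sup>2" for a
      using power_mono[OF K(2), of "coef u a" 2] by (simp add: power_mult_distrib mult.commute)
  qed simp
qed

definition l2_map :: "('h::chilbert \<Rightarrow> 'k::chilbert) \<Rightarrow> ('a, 'h) l2 \<Rightarrow> ('a, 'k) l2" where
  "l2_map B u = Abs_l2 (\<lambda>a. B (coef u a))"

lemma coef_l2_map: "bounded_clinear B \<Longrightarrow> coef (l2_map B u) a = B (coef u a)"
  by (simp add: l2_map_def coef_Abs_l2 sq_summable_map)

lemma bounded_clinear_l2_map:
  assumes B: "bounded_clinear (B :: 'h::chilbert \<Rightarrow> 'k::chilbert)"
  shows "bounded_clinear (l2_map B :: ('a, 'h) l2 \<Rightarrow> ('a, 'k) l2)"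
proof -
  obtain K where K: "0 \<le> K" "\<And>x. norm (B x) \<le> norm x * K"
    using bounded_linear.nonneg_bounded[OF bounded_clinear_bounded_linear[OF B]] by blast
  show ?thesis
  proof (rule bounded_clinearI)
    fix u v :: "('a, 'h) l2" and c
    show "l2_map B (u + v) = l2_map B u + l2_map B v"
      by (rule l2_eqI) (simp add: coef_simps coef_l2_map[OF B] bounded_clinear_add[OF B])
    show "l2_map B (c *\<^sub>C u) = c *\<^sub>C l2_map B u"
      by (rule l2_eqI) (simp add: coef_simps coef_l2_map[OF B] bounded_clinear_scaleC[OF B])
    have "(norm (l2_map B u))\<^sup>2 \<le> (norm u)\<^sup>2 * K\<^sup>2"
    proof (rule has_sum_mono[OF norm_l2_has_sum])
      show "((\<lambda>a. (norm (coef u a))\<^sup>2 * K\<^sup>2) has_sum (norm u)\<^sup>2 * K\<^sup>2) UNIV"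
        by (rule has_sum_cmult_left[OF norm_l2_has_sum])
      show "(norm (coef (l2_map B u) a))\<^sup>2 \<le> (norm (coef u a))\<^sup>2 * K\<^sup>2" for a
        using power_mono[OF K(2), of "coef u a" 2] by (simp add: power_mult_distrib coef_l2_map[OF B])
    qed
    hence "(norm (l2_map B u))\<^sup>2 \<le> (norm u * K)\<^sup>2" by (simp add: power_mult_distrib)
    thus "norm (l2_map B u) \<le> norm u * K" by (rule power2_le_imp_le) (use K in simp)
  qed
qed

lemma op_tensor_id_left:
  assumes B: "bounded_clinear B"
  shows "op_tensor id B = l2_map B"
  by (rule op_tensor_eqI[OF bounded_clinear_l2_map[OF B]])
    (simp add: l2_eqI coef_l2_map[OF B] coef_simps bounded_clinear_scaleC[OF B])

text \<open>The isometry induced by an injection of index sets. For appending a word \<beta> on the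
  right it is right multiplication by f_\<beta>, tensored with the identity; this describes both
  \<open>Lam\<close> and the universal model.\<close>

definition l2_push :: "('a \<Rightarrow> 'b) \<Rightarrow> ('a, 'h::chilbert) l2 \<Rightarrow> ('b, 'h) l2" where
  "l2_push \<phi> u = Abs_l2 (\<lambda>b. if b \<in> range \<phi> then coef u (the_inv \<phi> b) else 0)"

context
  fixes \<phi> :: "'a \<Rightarrow> 'b"
  assumes inj: "inj \<phi>"
begin

lemma l2_push_aux:
  "((\<lambda>b. (norm (if b \<in> range \<phi> then coef u (the_inv \<phi> b) else 0))\<^sup>2) has_sum (norm u)\<^sup>2) UNIV"
proof -
  have "((\<lambda>b. (norm (if b \<in> range \<phi> then coef u (the_inv \<phi> b) else 0))\<^sup>2) has_sum (norm u)\<^sup>2) (range \<phi>)"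
    by (subst has_sum_reindex[OF inj]) (simp add: comp_def the_inv_f_f[OF inj] norm_l2_has_sum)
  thus ?thesis by (rule has_sum_cong_neutral[THEN iffD1, rotated -1]) auto
qed

lemma coef_l2_push:
  "coef (l2_push \<phi> u) b = (if b \<in> range \<phi> then coef u (the_inv \<phi> b) else 0)"
  unfolding l2_push_def by (subst coef_Abs_l2[OF has_sum_imp_summable[OF l2_push_aux]]) (rule refl)

lemma coef_l2_push_image: "coef (l2_push \<phi> u) (\<phi> a) = coef u a"
  by (simp add: coef_l2_push the_inv_f_f[OF inj])

lemma coef_l2_push_outside: "b \<notin> range \<phi> \<Longrightarrow> coef (l2_push \<phi> u) b = 0"
  by (simp add: coef_l2_push)

lemma norm_l2_push: "norm (l2_push \<phi> u) = norm u"
proof -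
  have "((\<lambda>b. (norm (coef (l2_push \<phi> u) b))\<^sup>2) has_sum (norm u)\<^sup>2) UNIV"
    unfolding coef_l2_push by (rule l2_push_aux)
  hence "(norm (l2_push \<phi> u))\<^sup>2 = (norm u)\<^sup>2" by (rule has_sum_unique[OF norm_l2_has_sum])
  thus ?thesis by (rule power2_eq_imp_eq) simp_all
qed

lemma bounded_clinear_l2_push: "bounded_clinear (l2_push \<phi> :: ('a, 'h::chilbert) l2 \<Rightarrow> ('b, 'h) l2)"
  by (rule bounded_clinearI[where K = 1])
    (auto simp: norm_l2_push coef_simps coef_l2_push intro!: l2_eqI)

lemma l2_push_ket: "l2_push \<phi> (ket a) = ket (\<phi> a)"
  using inj by (intro l2_eqI) (auto simp: coef_l2_push coef_simps the_inv_f_f[OF inj] inj_eq)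

lemma l2_push_tens: "l2_push \<phi> (tens u x) = tens (l2_push \<phi> u) x"
  by (rule l2_eqI) (simp add: coef_l2_push coef_simps)

end

subsection \<open>Ampliations \<open>A \<otimes> I\<close>\<close>

text \<open>For a contraction \<open>A\<close> with defect operator \<open>D\<close> one has
  \<open>\<langle>A e\<^sub>a, A e\<^sub>b\<rangle> + \<langle>D e\<^sub>a, D e\<^sub>b\<rangle> = \<delta>\<^sub>a\<^sub>b\<close>, which bounds \<open>A \<otimes> I\<close> on finite sums without choosing
  an orthonormal basis.\<close>

lemma ampliation_bound:
  fixes A :: "('a, complex) l2 \<Rightarrow> ('b, complex) l2" and w :: "'a \<Rightarrow> 'h::chilbert"
  assumes A: "bounded_clinear A" "\<And>u. norm (A u) \<le> norm u" and F: "finite F"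
  shows "(norm (\<Sum>a\<in>F. tens (A (ket a)) (w a)))\<^sup>2 \<le> (\<Sum>a\<in>F. (norm (w a))\<^sup>2)"
proof -
  interpret contraction A by unfold_locales (fact A)+
  have *: "cinner (\<Sum>a\<in>F. tens (C a) (w a)) (\<Sum>a\<in>F. tens (C a) (w a))
      = (\<Sum>a\<in>F. \<Sum>b\<in>F. cinner (C b) (C a) * cinner (w b) (w a))"
    for C :: "'a \<Rightarrow> ('c, complex) l2"
    by (simp add: cinner_sum_left cinner_sum_right cinner_tens)
  have "cinner (A (ket b)) (A (ket a)) + cinner (Dr (ket b)) (Dr (ket a)) = cinner (ket b) (ket a)" for a b
    by (simp add: Dr_cinner Dr_Dr cinner_diff_right cadj_left[OF A(1)])
  hence "cinner (\<Sum>a\<in>F. tens (A (ket a)) (w a)) (\<Sum>a\<in>F. tens (A (ket a)) (w a))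
      + cinner (\<Sum>a\<in>F. tens (Dr (ket a)) (w a)) (\<Sum>a\<in>F. tens (Dr (ket a)) (w a))
      = cinner (\<Sum>a\<in>F. tens (ket a) (w a)) (\<Sum>a\<in>F. tens (ket a) (w a))"
    unfolding * by (simp flip: sum.distrib distrib_right)
  hence "(norm (\<Sum>a\<in>F. tens (A (ket a)) (w a)))\<^sup>2 + (norm (\<Sum>a\<in>F. tens (Dr (ket a)) (w a)))\<^sup>2
      = (norm (\<Sum>a\<in>F. tens (ket a) (w a)))\<^sup>2"
    unfolding cinner_self by (simp only: of_real_eq_iff flip: of_real_add)
  thus ?thesis using norm_sum_tens_ket[OF F, of w] zero_le_power2[of "norm (\<Sum>a\<in>F. tens (Dr (ket a)) (w a))"]
    by linarith
qed

text \<open>The vectors f a may be far from orthogonal; the net of finite sums is Cauchy because a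
  block of f outside F0 is controlled by the same block of g.\<close>

lemma summable_on_norm_sq_bound:
  fixes f :: "'a \<Rightarrow> 'b::banach"
  assumes g: "g summable_on UNIV" and le: "\<And>F. finite F \<Longrightarrow> (norm (sum f F))\<^sup>2 \<le> sum g F"
  shows "f summable_on UNIV" and "(norm (infsum f UNIV))\<^sup>2 \<le> infsum g UNIV"
proof -
  let ?T = "finite_subsets_at_top (UNIV :: 'a set)"
  have glim: "(sum g \<longlongrightarrow> infsum g UNIV) ?T"
    using has_sum_infsum[OF g] by (simp add: has_sum_def)
  have "\<exists>P. eventually P ?T \<and> (\<forall>F F'. P F \<and> P F' \<longrightarrow> dist (sum f F) (sum f F') < e)" if "e > 0" for e
  proof -
    \<comment> \<open>Two sums of g within half of \<open>(e/2)\<^sup>2\<close> of the limit differ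
      by less than \<open>(e/2)\<^sup>2\<close>, so the block of f has norm below e/2; comparing two
      sums through F0 then gives e.\<close>
    have "(e/2)\<^sup>2 / 2 > 0" using that by simp
    from tendstoD[OF glim this] obtain F0 where F0: "finite F0"
      and F0': "\<And>F. finite F \<Longrightarrow> F0 \<subseteq> F \<Longrightarrow> dist (sum g F) (infsum g UNIV) < (e/2)\<^sup>2 / 2"
      unfolding eventually_finite_subsets_at_top by auto
    have *: "dist (sum f F) (sum f F0) < e/2" if "finite F" "F0 \<subseteq> F" for F
    proof -
      have "(dist (sum f F) (sum f F0))\<^sup>2 = (norm (sum f (F - F0)))\<^sup>2"
        unfolding dist_norm using that by (subst sum_diff) auto
      also have "\<dots> \<le> sum g (F - F0)" using that by (intro le) auto
      also have "\<dots> = sum g F - sum g F0" using that by (intro sum_diff) auto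
      also have "\<dots> < (e/2)\<^sup>2"
      proof -
        have *: "x - y < c" if "\<bar>x - z\<bar> < c / 2" "\<bar>y - z\<bar> < c / 2" for x y z c :: real
          using that by linarith
        show ?thesis using F0'[OF that] F0'[OF F0 order_refl] unfolding dist_real_def by (rule *)
      qed
      finally show ?thesis by (rule power2_less_imp_less) (use \<open>e > 0\<close> in simp)
    qed
    have "dist (sum f F) (sum f F') < e" if "finite F" "F0 \<subseteq> F" "finite F'" "F0 \<subseteq> F'" for F F'
      using *[OF that(1,2)] *[OF that(3,4)] by (rule dist_triangle_half_l)
    moreover have "\<forall>\<^sub>F F in ?T. finite F \<and> F0 \<subseteq> F"
      unfolding eventually_finite_subsets_at_top using F0 by blast
    ultimately show ?thesis by blast
  qed
  hence "cauchy_filter (filtermap (sum f) ?T)" by (simp add: cauchy_filter_metric_filtermap)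
  moreover have "complete (UNIV :: 'b set)"
    by (meson Cauchy_convergent UNIV_I complete_def convergent_def)
  ultimately obtain L where L: "(sum f \<longlongrightarrow> L) ?T"
    using complete_uniform[where S = UNIV] by (force simp add: filterlim_def)
  hence hs: "(f has_sum L) UNIV" by (simp add: has_sum_def)
  thus "f summable_on UNIV" by (rule has_sum_imp_summable)
  have "(norm L)\<^sup>2 \<le> infsum g UNIV"
  proof (rule tendsto_le[OF _ glim])
    show "((\<lambda>F. (norm (sum f F))\<^sup>2) \<longlongrightarrow> (norm L)\<^sup>2) ?T" by (intro tendsto_intros L)
    show "\<forall>\<^sub>F F in ?T. (norm (sum f F))\<^sup>2 \<le> sum g F"
      by (rule eventually_finite_subsets_at_top_weakI) (rule le)
  qed simp
  thus "(norm (infsum f UNIV))\<^sup>2 \<le> infsum g UNIV" using infsumI[OF hs] by simp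
qed

lemma ampliation_bounded:
  fixes A :: "('a, complex) l2 \<Rightarrow> ('b, complex) l2" and w :: "'a \<Rightarrow> 'h::chilbert"
  assumes A: "bounded_clinear A" and K: "\<And>u. norm (A u) \<le> norm u * K" "K > 0" and F: "finite F"
  shows "(norm (\<Sum>a\<in>F. tens (A (ket a)) (w a)))\<^sup>2 \<le> (\<Sum>a\<in>F. (norm (w a))\<^sup>2 * K\<^sup>2)"
proof -
  have A': "bounded_clinear (\<lambda>u. (1 / K) *\<^sub>R A u)" by (rule bounded_clinear_scaleR_op[OF A])
  have "norm ((1 / K) *\<^sub>R A u) \<le> norm u" for u
    using K(1)[of u] K(2) by (simp add: field_simps)
  from ampliation_bound[OF A' this F, of w]
  have "(norm ((1 / K) *\<^sub>R (\<Sum>a\<in>F. tens (A (ket a)) (w a))))\<^sup>2 \<le> (\<Sum>a\<in>F. (norm (w a))\<^sup>2)"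
    by (simp only: tens_simps scaleR_sum_right)
  thus ?thesis using K(2) by (simp add: field_simps power_mult_distrib sum_distrib_left)
qed

text \<open>The operator sends w to the sum of A e_a \<otimes> w_a. These terms are not orthogonal
  in general, so convergence and the norm bound come from \<open>ampliation_bounded\<close>.\<close>

lemma op_tensor_id_right:
  fixes A :: "('a, complex) l2 \<Rightarrow> ('b, complex) l2"
  assumes A: "bounded_clinear A"
  shows "bounded_clinear (op_tensor A id :: ('a, 'h::chilbert) l2 \<Rightarrow> ('b, 'h) l2)"
    and "op_tensor A id (tens u (x :: 'h)) = tens (A u) x"
proof -
  obtain K where K: "K > 0" "\<And>u. norm (A u) \<le> norm u * K"
    using bounded_linear.pos_bounded[OF bounded_clinear_bounded_linear[OF A]] by blast
  define C :: "('a, 'h) l2 \<Rightarrow> ('b, 'h) l2" where "C w = (\<Sum>\<^sub>\<infinity>a. tens (A (ket a)) (coef w a))" for w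
  have sm: "(\<lambda>a. (norm (coef w a))\<^sup>2 * K\<^sup>2) summable_on UNIV" for w :: "('a, 'h) l2"
    by (rule summable_on_cmult_left[OF l2_summable])
  note bd = summable_on_norm_sq_bound[OF sm ampliation_bounded[OF A K(2,1)]]
  have hs: "((\<lambda>a. tens (A (ket a)) (coef w a)) has_sum C w) UNIV" for w :: "('a, 'h) l2"
    unfolding C_def by (rule has_sum_infsum[OF bd(1)])
  have C: "bounded_clinear C"
  proof (rule bounded_clinearI)
    fix v w and c :: complex
    have "((\<lambda>a. tens (A (ket a)) (coef (v + w) a)) has_sum C v + C w) UNIV"
      using has_sum_add[OF hs[of v] hs[of w]] by (simp add: coef_simps tens_simps)
    thus "C (v + w) = C v + C w" by (rule has_sum_unique[OF hs])
    have "((\<lambda>a. tens (A (ket a)) (coef (c *\<^sub>C w) a)) has_sum c *\<^sub>C C w) UNIV"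
      using has_sum_bounded_linear[OF bounded_linear_scaleC_right hs[of w], of c]
      by (simp add: scaleC_l2.rep_eq tens_simps)
    thus "C (c *\<^sub>C w) = c *\<^sub>C C w" by (rule has_sum_unique[OF hs])
    have "(norm (C w))\<^sup>2 \<le> (\<Sum>\<^sub>\<infinity>a. (norm (coef w a))\<^sup>2 * K\<^sup>2)"
      unfolding C_def by (rule bd(2))
    also have "\<dots> = (norm w * K)\<^sup>2"
      by (simp add: infsum_cmult_left' norm_l2_sq power_mult_distrib)
    finally show "norm (C w) \<le> norm w * K" by (rule power2_le_imp_le) (use K in simp)
  qed
  have "C (tens u x) = tens (A u) x" for u x
  proof -
    have "((\<lambda>a. tens (A (coef u a *\<^sub>C ket a)) x) has_sum tens (A u) x) UNIV"
      by (rule has_sum_bounded_linear[OF bounded_linear_compose[OF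
              bounded_clinear_bounded_linear[OF bounded_clinear_tens_left]
              bounded_clinear_bounded_linear[OF A]] has_sum_ket])
    hence "((\<lambda>a. tens (A (ket a)) (coef (tens u x) a)) has_sum tens (A u) x) UNIV"
      by (simp add: bounded_clinear_scaleC[OF A] tens_simps tens.rep_eq)
    thus ?thesis by (rule has_sum_unique[OF hs])
  qed
  hence eq: "op_tensor A id = C" by (intro op_tensor_eqI[OF C]) simp
  show "bounded_clinear (op_tensor A id :: ('a, 'h) l2 \<Rightarrow> ('b, 'h) l2)" unfolding eq by (rule C)
  show "op_tensor A id (tens u x) = tens (A u) x"
    unfolding eq by (rule \<open>\<And>x u. C (tens u x) = tens (A u) x\<close>)
qed

subsection \<open>Words by length\<close>

lemma finite_words: "finite {\<alpha> :: 'n::finite list. length \<alpha> = k}"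
  using finite_lists_length_eq[of "UNIV :: 'n set" k] by simp

lemma words_0: "{\<alpha> :: 'n list. length \<alpha> = 0} = {[]}"
  by auto

lemma sum_words_snoc:
  fixes F :: "'n::finite list \<Rightarrow> 'b::comm_monoid_add"
  shows "(\<Sum>\<alpha> | length \<alpha> = Suc k. F \<alpha>) = (\<Sum>\<alpha> | length \<alpha> = k. \<Sum>i\<in>UNIV. F (\<alpha> @ [i]))"
proof -
  have "(\<Sum>\<alpha> | length \<alpha> = k. \<Sum>i\<in>UNIV. F (\<alpha> @ [i]))
      = (\<Sum>(\<alpha>, i)\<in>{\<alpha>. length \<alpha> = k} \<times> UNIV. F (\<alpha> @ [i]))"
    by (simp add: sum.cartesian_product)
  also have "\<dots> = (\<Sum>\<alpha> | length \<alpha> = Suc k. F \<alpha>)"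
    by (rule sum.reindex_bij_witness[where j = "\<lambda>(\<alpha>, i). \<alpha> @ [i]" and i = "\<lambda>\<alpha>. (butlast \<alpha>, last \<alpha>)"])
      (auto simp: length_Suc_conv_rev)
  finally show ?thesis ..
qed

lemma sum_words_append:
  fixes F :: "'n::finite list \<Rightarrow> 'b::comm_monoid_add"
  shows "(\<Sum>\<gamma> | length \<gamma> = k + l. F \<gamma>) = (\<Sum>\<alpha> | length \<alpha> = k. \<Sum>\<beta> | length \<beta> = l. F (\<alpha> @ \<beta>))"
proof -
  have "(\<Sum>\<alpha> | length \<alpha> = k. \<Sum>\<beta> | length \<beta> = l. F (\<alpha> @ \<beta>))
      = (\<Sum>(\<alpha>, \<beta>)\<in>{\<alpha>. length \<alpha> = k} \<times> {\<beta>. length \<beta> = l}. F (\<alpha> @ \<beta>))"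
    by (simp add: sum.cartesian_product)
  also have "\<dots> = (\<Sum>\<gamma> | length \<gamma> = k + l. F \<gamma>)"
    by (rule sum.reindex_bij_witness[where j = "\<lambda>(\<alpha>, \<beta>). \<alpha> @ \<beta>" and i = "\<lambda>\<gamma>. (take k \<gamma>, drop k \<gamma>)"]) auto
  finally show ?thesis ..
qed

lemma sum_words_lessThan:
  fixes F :: "'n::finite list \<Rightarrow> 'b::comm_monoid_add"
  shows "(\<Sum>k<N. \<Sum>\<alpha> | length \<alpha> = k. F \<alpha>) = (\<Sum>\<alpha> | length \<alpha> < N. F \<alpha>)"
proof -
  have "(\<Sum>\<alpha> | length \<alpha> < N. F \<alpha>) = sum F (\<Union>k\<in>{..<N}. {\<alpha>. length \<alpha> = k})"
    by (rule arg_cong[of _ _ "sum F"]) auto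
  also have "\<dots> = (\<Sum>k<N. \<Sum>\<alpha> | length \<alpha> = k. F \<alpha>)"
    by (rule sum.UNION_disjoint) (auto simp: finite_words)
  finally show ?thesis ..
qed

lemma finite_words_less: "finite {\<alpha> :: 'n::finite list. length \<alpha> < N}"
proof -
  have "{\<alpha> :: 'n list. length \<alpha> < N} = (\<Union>k\<in>{..<N}. {\<alpha>. length \<alpha> = k})" by auto
  thus ?thesis by (simp add: finite_words)
qed

lemma has_sum_by_length:
  "(F has_sum S) UNIV \<longleftrightarrow> ((\<lambda>(k, \<alpha>). F \<alpha>) has_sum S) (SIGMA k:UNIV. {\<alpha>. length \<alpha> = k})"
  by (rule has_sum_reindex_bij_witness[where j = "\<lambda>\<alpha>. (length \<alpha>, \<alpha>)" and i = snd]) auto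

lemma has_sum_words:
  fixes F :: "'n::finite list \<Rightarrow> 'b::{topological_comm_monoid_add,t3_space}"
  assumes "(F has_sum S) UNIV"
  shows "(\<lambda>k. \<Sum>\<alpha> | length \<alpha> = k. F \<alpha>) sums S"
proof -
  have "((\<lambda>k. \<Sum>\<alpha> | length \<alpha> = k. F \<alpha>) has_sum S) UNIV"
    by (rule has_sum_SigmaD[OF assms[unfolded has_sum_by_length]])
      (auto intro!: has_sum_finiteI finite_words)
  thus ?thesis by (rule has_sum_imp_sums)
qed

text \<open>The telescoping arguments produce sums by levels only; for nonnegative terms these
  already yield unconditional summability over all words.\<close>

lemma has_sum_words_nonneg:
  fixes F :: "'n::finite list \<Rightarrow> real"
  assumes "(\<lambda>k. \<Sum>\<alpha> | length \<alpha> = k. F \<alpha>) sums S" and nn: "\<And>\<alpha>. 0 \<le> F \<alpha>"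
  shows "(F has_sum S) UNIV"
proof -
  have s: "((\<lambda>k. \<Sum>\<alpha> | length \<alpha> = k. F \<alpha>) has_sum S) UNIV"
    by (rule sums_nonneg_imp_has_sum[OF assms(1)]) (simp add: sum_nonneg nn)
  have f: "((\<lambda>\<alpha>. (\<lambda>(k, \<alpha>). F \<alpha>) (k, \<alpha>)) has_sum (\<Sum>\<alpha> | length \<alpha> = k. F \<alpha>)) {\<alpha>. length \<alpha> = k}" for k
    by (auto intro!: has_sum_finiteI finite_words)
  have "(\<lambda>(k, \<alpha>). F \<alpha>) summable_on (SIGMA k:UNIV. {\<alpha>. length \<alpha> = k})"
    by (rule summable_on_SigmaI[OF f has_sum_imp_summable[OF s]]) (use nn in auto)
  thus ?thesis
    unfolding has_sum_by_length by (rule has_sum_SigmaI[OF f s])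
qed

lemma norm_l2_levels:
  fixes u :: "('n::finite list, 'h::chilbert) l2"
  shows "(\<lambda>k. \<Sum>\<alpha> | length \<alpha> = k. (norm (coef u \<alpha>))\<^sup>2) sums (norm u)\<^sup>2"
  by (rule has_sum_words[OF norm_l2_has_sum])

section \<open>Right multiplication operators in coordinates\<close>

lemma inj_append_right: "inj (\<lambda>\<alpha>. \<alpha> @ \<beta>)"
  by (rule injI) simp

lemma Lam_eq: "Lam i = l2_push (\<lambda>\<alpha>. \<alpha> @ [i])"
  unfolding Lam_def
proof (rule the_equality)
  show *: "bounded_clinear (l2_push (\<lambda>\<alpha>. \<alpha> @ [i]) :: 'a h2 \<Rightarrow> 'a h2) \<and>
      (\<forall>\<alpha>. l2_push (\<lambda>\<alpha>. \<alpha> @ [i]) (ket \<alpha>) = ket (\<alpha> @ [i]))"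
    using bounded_clinear_l2_push[OF inj_append_right] l2_push_ket[OF inj_append_right] by blast
  fix L :: "'a h2 \<Rightarrow> 'a h2" assume L: "bounded_clinear L \<and> (\<forall>\<alpha>. L (ket \<alpha>) = ket (\<alpha> @ [i]))"
  have "L u = l2_push (\<lambda>\<alpha>. \<alpha> @ [i]) u" for u
    by (rule l2_complex_op_eqI[OF conjunct1[OF L] conjunct1[OF *]]) (metis L *)
  thus "L = l2_push (\<lambda>\<alpha>. \<alpha> @ [i])" by (rule ext)
qed

lemma op_tensor_Lam:
  fixes i :: 'n
  assumes B: "bounded_clinear B"
  shows "op_tensor (\<lambda>c. r *\<^sub>R Lam i c) B = (\<lambda>w. r *\<^sub>R l2_push (\<lambda>\<alpha>. \<alpha> @ [i]) (l2_map B w))"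
proof (rule op_tensor_eqI)
  show "bounded_clinear (\<lambda>w. r *\<^sub>R l2_push (\<lambda>\<alpha>. \<alpha> @ [i]) (l2_map B w))"
    by (intro bounded_clinear_scaleR_op bounded_clinear_compose[OF bounded_clinear_l2_push]
        bounded_clinear_l2_map B inj_append_right)
  have "l2_map B (tens u x) = tens u (B x)" for u :: "'n h2" and x
    by (rule l2_eqI) (simp add: coef_l2_map[OF B] tens.rep_eq bounded_clinear_scaleC[OF B])
  thus "r *\<^sub>R l2_push (\<lambda>\<alpha>. \<alpha> @ [i]) (l2_map B (tens u x)) = tens (r *\<^sub>R Lam i u) (B x)" for u x
    by (simp add: Lam_eq l2_push_tens[OF inj_append_right] tens_simps)
qed

text \<open>At a nonempty word only the operator indexed by its last letter contributes, so summing
  over i leaves a one-step recursion along the word.\<close>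

lemma coef_op_tensor_Lam:
  assumes B: "bounded_clinear B"
  shows "coef (op_tensor (\<lambda>c. r *\<^sub>R Lam i c) B w) [] = 0"
    and "coef (op_tensor (\<lambda>c. r *\<^sub>R Lam i c) B w) (\<gamma> @ [j]) = (if i = j then r *\<^sub>R B (coef w \<gamma>) else 0)"
proof -
  note inj = inj_append_right[of "[i]"]
  show "coef (op_tensor (\<lambda>c. r *\<^sub>R Lam i c) B w) [] = 0"
    unfolding op_tensor_Lam[OF B] scaleR_l2.rep_eq by (subst coef_l2_push_outside[OF inj]) auto
  show "coef (op_tensor (\<lambda>c. r *\<^sub>R Lam i c) B w) (\<gamma> @ [j]) = (if i = j then r *\<^sub>R B (coef w \<gamma>) else 0)"
  proof (cases "i = j")
    case True
    thus ?thesis unfolding op_tensor_Lam[OF B] scaleR_l2.rep_eq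
      using coef_l2_push_image[OF inj, of "l2_map B w" \<gamma>] by (simp add: coef_l2_map[OF B])
  next
    case False
    thus ?thesis unfolding op_tensor_Lam[OF B] scaleR_l2.rep_eq
      by (subst coef_l2_push_outside[OF inj]) auto
  qed
qed

lemma words_summable:
  fixes F :: "'n::finite list \<Rightarrow> real"
  assumes nn: "\<And>\<alpha>. 0 \<le> F \<alpha>" and le: "\<And>N. (\<Sum>k<N. \<Sum>\<alpha> | length \<alpha> = k. F \<alpha>) \<le> C"
  shows "F summable_on UNIV" and "infsum F UNIV \<le> C"
proof -
  have sm: "summable (\<lambda>k. \<Sum>\<alpha> | length \<alpha> = k. F \<alpha>)"
    by (rule summableI_nonneg_bounded[OF _ le]) (simp add: sum_nonneg nn)
  have *: "(F has_sum (\<Sum>k. \<Sum>\<alpha> | length \<alpha> = k. F \<alpha>)) UNIV"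
    by (rule has_sum_words_nonneg[OF summable_sums[OF sm] nn])
  show "F summable_on UNIV" by (rule has_sum_imp_summable[OF *])
  show "infsum F UNIV \<le> C" unfolding infsumI[OF *] by (rule suminf_le_const[OF sm le])
qed

lemma norm_vec_sq: "(norm v)\<^sup>2 = (\<Sum>i\<in>UNIV. (norm (v $ i))\<^sup>2)" for v :: "'a::chilbert ^ 'n::finite"
  by (simp add: power2_norm_eq_inner inner_vec_def)

text \<open>Coordinatewise convergence with bounded norms is weak convergence; norms not exceeding
  that of the limit upgrade it to norm convergence by |w - v|^2 = |w|^2 - |v|^2 - 2 <w - v,
  v>.\<close>

lemma l2_tendsto:
  fixes v :: "('a, 'h::chilbert) l2"
  assumes co: "\<And>a. ((\<lambda>r. coef (w r) a) \<longlongrightarrow> coef v a) Fi"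
    and le: "\<forall>\<^sub>F r in Fi. norm (w r) \<le> norm v"
  shows "(w \<longlongrightarrow> v) Fi"
proof (rule tendstoI)
  fix e :: real assume "e > 0"
  \<comment> \<open>Chosen so that replacing v by its finite part g costs at most e^2/4; together
    with e^2/8 from g itself the pairing stays below e^2/2.\<close>
  define \<epsilon> where "\<epsilon> = e\<^sup>2 / (8 * (norm v + 1))"
  have nv: "norm v + 1 > 0" by (simp add: add_nonneg_pos)
  have "\<epsilon> > 0" using \<open>e > 0\<close> nv by (simp add: \<epsilon>_def)
  obtain G where G: "finite G" "dist (\<Sum>a\<in>G. tens (ket a) (coef v a)) v \<le> \<epsilon>"
    using has_sum_finite_approximation[OF has_sum_tens_ket[of v] \<open>\<epsilon> > 0\<close>] by auto
  define g where "g = (\<Sum>a\<in>G. tens (ket a) (coef v a))"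
  have "((\<lambda>r. inner (w r) g) \<longlongrightarrow> inner v g) Fi"
    unfolding g_def inner_cinner cinner_sum_right cinner_tens_ket
    by (intro tendsto_sum tendsto_Re bounded_linear.tendsto[OF bounded_linear_cinner_left, OF co])
  hence "\<forall>\<^sub>F r in Fi. dist (inner (w r) g) (inner v g) < e\<^sup>2 / 8"
    by (rule tendstoD) (use \<open>e > 0\<close> in simp)
  with le show "\<forall>\<^sub>F r in Fi. dist (w r) v < e"
  proof eventually_elim
    case (elim r)
    have "\<bar>inner (w r - v) (v - g)\<bar> \<le> norm (w r - v) * norm (v - g)" by (rule Cauchy_Schwarz_ineq2)
    also have "\<dots> \<le> (2 * (norm v + 1)) * \<epsilon>"
    proof (rule mult_mono)
      show "norm (w r - v) \<le> 2 * (norm v + 1)" using norm_triangle_ineq4[of "w r" v] elim(1) by simp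
      show "norm (v - g) \<le> \<epsilon>" using G(2) by (simp add: g_def dist_norm norm_minus_commute)
    qed (use nv in auto)
    also have "\<dots> = e\<^sup>2 / 4" using nv by (simp add: \<epsilon>_def field_simps)
    finally have 1: "\<bar>inner (w r - v) (v - g)\<bar> \<le> e\<^sup>2 / 4" .
    have 2: "\<bar>inner (w r - v) g\<bar> < e\<^sup>2 / 8" using elim(2) by (simp add: dist_real_def inner_diff_left)
    have "inner (w r - v) v = inner (w r - v) (v - g) + inner (w r - v) g" by (simp add: inner_diff_right)
    hence 3: "- inner (w r - v) v < e\<^sup>2 / 2" using 1 2 \<open>e > 0\<close> by (simp add: abs_less_iff abs_le_iff)
    have "(norm (w r))\<^sup>2 \<le> (norm v)\<^sup>2" using elim(1) by (intro power_mono) auto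
    moreover have "(dist (w r) v)\<^sup>2 = (norm (w r))\<^sup>2 - (norm v)\<^sup>2 - 2 * inner (w r - v) v"
      unfolding dist_norm power2_norm_eq_inner
      by (simp add: inner_diff_left inner_diff_right inner_commute)
    ultimately have "(dist (w r) v)\<^sup>2 < e\<^sup>2" using 3 by linarith
    thus ?case by (rule power2_less_imp_less) (use \<open>e > 0\<close> in simp)
  qed
qed

section \<open>Evaluation at words and row contractions\<close>

lemma op_word_append: "op_word X (\<alpha> @ \<beta>) x = op_word X \<alpha> (op_word X \<beta> x)"
  by (induction \<alpha>) simp_all

lemma bounded_clinear_op_word:
  assumes "\<And>i. bounded_clinear (X i)"
  shows "bounded_clinear (op_word X \<alpha>)"
proof (induction \<alpha>)
  case (Cons i \<alpha>)
  show ?case using bounded_clinear_compose[OF assms Cons] by (simp add: comp_def)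
qed (simp add: id_def bounded_clinear_id)

lemma bounded_clinear_row_op:
  assumes "\<And>i. bounded_clinear (X i)"
  shows "bounded_clinear (row_op X)"
  unfolding row_op_def
  by (intro bounded_clinear_setsum bounded_clinear_compose[OF assms] bounded_clinear_vec_nth)

lemma cadj_row_op:
  assumes "\<And>i. bounded_clinear (X i)"
  shows "cadj (row_op X) = (\<lambda>x. \<chi> i. cadj (X i) x)"
  by (rule cadj_unique) (simp add: row_op_def cinner_vec_def cinner_sum_left cadj_left[OF assms])

locale row_contraction =
  fixes A :: "'n::finite \<Rightarrow> 'h::chilbert \<Rightarrow> 'h"
  assumes A: "\<And>i. bounded_clinear (A i)" and row: "onorm (row_op A) \<le> 1"
begin

abbreviation "R \<equiv> row_op A"

lemma norm_row: "norm (R v) \<le> norm v"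
proof -
  have "norm (R v) \<le> onorm R * norm v"
    by (rule onorm[OF bounded_clinear_bounded_linear[OF bounded_clinear_row_op[OF A]]])
  also have "\<dots> \<le> 1 * norm v" by (intro mult_right_mono row) simp
  finally show ?thesis by simp
qed

end

sublocale row_contraction \<subseteq> contraction "row_op A"
  by unfold_locales (fact bounded_clinear_row_op[OF A] norm_row)+

context row_contraction
begin

text \<open>Adjoints reverse products, so letters appended to the word act last. Thus the values at
  the one-letter extensions of \<alpha> form the column R* \<open>W \<alpha> x\<close>.\<close>

definition W :: "'n list \<Rightarrow> 'h \<Rightarrow> 'h" where "W \<alpha> = cadj (op_word A \<alpha>)"

lemmas bounded_clinear_word = bounded_clinear_op_word[OF A]

lemma W_left: "cinner (op_word A \<alpha> x) y = cinner x (W \<alpha> y)"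
  unfolding W_def by (rule cadj_left[OF bounded_clinear_word])

lemma W_Nil: "W [] x = x"
  unfolding W_def by (simp add: id_def cadj_id)

lemma W_append: "W (\<alpha> @ \<beta>) x = W \<beta> (W \<alpha> x)"
proof -
  have "op_word A (\<alpha> @ \<beta>) = (\<lambda>x. op_word A \<alpha> (op_word A \<beta> x))" by (rule ext) (rule op_word_append)
  thus ?thesis unfolding W_def by (simp add: cadj_compose[OF bounded_clinear_word bounded_clinear_word])
qed

lemma cadj_R: "cadj R x $ i = cadj (A i) x"
  by (simp add: cadj_row_op[OF A])

lemma W_snoc: "W (\<alpha> @ [i]) x = cadj R (W \<alpha> x) $ i"
proof -
  have "W [i] = cadj (A i)" by (simp add: W_def)
  thus ?thesis by (simp add: W_append cadj_R)
qed

lemma bounded_clinear_W: "bounded_clinear (W \<alpha>)"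
  unfolding W_def by (rule bounded_clinear_cadj[OF bounded_clinear_word])

text \<open>The state recursion extends words at the end, because \<Lambda>_i appends its letter
  there; primitive recursion consumes lists from the front, hence the reversed word.\<close>

primrec state_rev :: "real \<Rightarrow> ('n list, 'h ^ 'n) l2 \<Rightarrow> 'n list \<Rightarrow> 'h" where
  "state_rev r u [] = 0"
| "state_rev r u (i # \<gamma>) = r *\<^sub>R ((cadj R (state_rev r u \<gamma>) + Dr (coef u (rev \<gamma>))) $ i)"

text \<open>\<open>state r u\<close> is \<open>(I - \<Sum>\<^sub>i r \<Lambda>\<^sub>i \<otimes> A\<^sub>i\<^sup>*)\<^sup>-\<^sup>1 [r \<Lambda>\<^sub>1 \<otimes> I, \<dots>, r \<Lambda>\<^sub>n \<otimes> I] (I \<otimes> \<Delta>\<^sub>*) u\<close>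
  in coordinates; these make sense also for \<open>r = 1\<close>, where they need not be square summable.\<close>

definition state :: "real \<Rightarrow> ('n list, 'h ^ 'n) l2 \<Rightarrow> 'n list \<Rightarrow> 'h" where
  "state r u \<gamma> = state_rev r u (rev \<gamma>)"

lemma state_Nil: "state r u [] = 0"
  by (simp add: state_def)

lemma state_snoc: "state r u (\<gamma> @ [i]) = r *\<^sub>R ((cadj R (state r u \<gamma>) + Dr (coef u \<gamma>)) $ i)"
  by (simp add: state_def)

text \<open>Second row of the Halmos unitary at (state, input); the first row, scaled by r, gives
  the states at \<open>\<gamma> @ [i]\<close>. The minus sign is that of -I \<otimes> f(T) in the
  Fourier representation.\<close>

definition out :: "real \<Rightarrow> ('n list, 'h ^ 'n) l2 \<Rightarrow> 'n list \<Rightarrow> 'h" where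
  "out r u \<gamma> = Dl (state r u \<gamma>) - R (coef u \<gamma>)"

definition state_level :: "real \<Rightarrow> ('n list, 'h ^ 'n) l2 \<Rightarrow> nat \<Rightarrow> real" where
  "state_level r u k = (\<Sum>\<gamma> | length \<gamma> = k. (norm (state r u \<gamma>))\<^sup>2)"

lemma state_level_0: "state_level r u 0 = 0"
  by (simp add: state_level_def words_0 state_Nil)

lemma state_level_nonneg: "0 \<le> state_level r u k"
  by (simp add: state_level_def sum_nonneg)

text \<open>Energy balance, the identity \<open>halmos\<close> summed over all words of one length:
  up to the factor \<open>r\<^sup>2\<close>, the next state energy is state plus input minus output
  energy.\<close>

lemma state_level_Suc:
  "state_level r u (Suc k) = r\<^sup>2 * (state_level r u k + (\<Sum>\<gamma> | length \<gamma> = k. (norm (coef u \<gamma>))\<^sup>2)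
     - (\<Sum>\<gamma> | length \<gamma> = k. (norm (out r u \<gamma>))\<^sup>2))"
proof -
  have "state_level r u (Suc k)
      = (\<Sum>\<gamma> | length \<gamma> = k. r\<^sup>2 * (norm (cadj R (state r u \<gamma>) + Dr (coef u \<gamma>)))\<^sup>2)"
    unfolding state_level_def sum_words_snoc
    by (intro sum.cong refl) (simp add: state_snoc norm_vec_sq power_mult_distrib sum_distrib_left)
  also have "\<dots> = (\<Sum>\<gamma> | length \<gamma> = k. r\<^sup>2 * ((norm (state r u \<gamma>))\<^sup>2 + (norm (coef u \<gamma>))\<^sup>2
      - (norm (out r u \<gamma>))\<^sup>2))"
    unfolding out_def using halmos by (intro sum.cong refl arg_cong2[where f = "(*)"]) (smt (verit))
  also have "\<dots> = r\<^sup>2 * (state_level r u k + (\<Sum>\<gamma> | length \<gamma> = k. (norm (coef u \<gamma>))\<^sup>2)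
     - (\<Sum>\<gamma> | length \<gamma> = k. (norm (out r u \<gamma>))\<^sup>2))"
    unfolding state_level_def by (simp add: sum_distrib_left sum.distrib sum_subtractf algebra_simps)
  finally show ?thesis .
qed

lemma coef_levels_le: "(\<Sum>k<N. \<Sum>\<gamma> | length \<gamma> = k. (norm (coef u \<gamma>))\<^sup>2) \<le> (norm u)\<^sup>2"
  for u :: "('n list, 'x::chilbert) l2"
  unfolding sum_words_lessThan norm_l2_sq
  by (rule finite_sum_le_infsum[OF l2_summable]) (auto simp: finite_words_less)

context
  fixes r :: real
  assumes r: "0 \<le> r" "r \<le> 1"
begin

lemma power2_le_1: "r\<^sup>2 \<le> 1"
  using r by (simp add: power_le_one)

lemma state_level_Suc_le:
  "state_level r u (Suc k) \<le> state_level r u k + (\<Sum>\<gamma> | length \<gamma> = k. (norm (coef u \<gamma>))\<^sup>2)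
     - (\<Sum>\<gamma> | length \<gamma> = k. (norm (out r u \<gamma>))\<^sup>2)"
\<comment> \<open>At r = 0 the balance reads 0 = 0 and says nothing about the sign of the bracket,
  which is taken from \<open>halmos\<close> instead; otherwise the positive factor is
  cancelled.\<close>
proof (cases "r = 0")
  case True
  have "(norm (out r u \<gamma>))\<^sup>2 \<le> (norm (state r u \<gamma>))\<^sup>2 + (norm (coef u \<gamma>))\<^sup>2" for \<gamma>
    unfolding out_def using halmos[of "state r u \<gamma>" "coef u \<gamma>"] by (smt (verit) zero_le_power2)
  hence "(\<Sum>\<gamma> | length \<gamma> = k. (norm (out r u \<gamma>))\<^sup>2)
      \<le> (\<Sum>\<gamma> | length \<gamma> = k. (norm (state r u \<gamma>))\<^sup>2 + (norm (coef u \<gamma>))\<^sup>2)"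
    by (rule sum_mono)
  thus ?thesis unfolding state_level_Suc True by (simp add: state_level_def sum.distrib)
next
  case False
  have "0 \<le> state_level r u (Suc k)" by (rule state_level_nonneg)
  hence "0 \<le> state_level r u k + (\<Sum>\<gamma> | length \<gamma> = k. (norm (coef u \<gamma>))\<^sup>2)
     - (\<Sum>\<gamma> | length \<gamma> = k. (norm (out r u \<gamma>))\<^sup>2)"
    unfolding state_level_Suc using False by (simp add: zero_le_mult_iff)
  thus ?thesis unfolding state_level_Suc using power2_le_1 by (intro mult_left_le_one_le) auto
qed

text \<open>The state terms telescope. The last one is kept, so that the same inequality bounds the
  output energy and the state energy at each level.\<close>

lemma out_levels_le:
  "(\<Sum>k<N. \<Sum>\<gamma> | length \<gamma> = k. (norm (out r u \<gamma>))\<^sup>2)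
    \<le> (\<Sum>k<N. \<Sum>\<gamma> | length \<gamma> = k. (norm (coef u \<gamma>))\<^sup>2) - state_level r u N"
proof (induction N)
  case (Suc N)
  show ?case using Suc state_level_Suc_le[of u N] by simp
qed (simp add: state_level_0)

lemma out_summable: "(\<lambda>\<gamma>. (norm (out r u \<gamma>))\<^sup>2) summable_on UNIV"
  and out_norm: "(\<Sum>\<^sub>\<infinity>\<gamma>. (norm (out r u \<gamma>))\<^sup>2) \<le> (norm u)\<^sup>2"
proof -
  have *: "(\<Sum>k<N. \<Sum>\<gamma> | length \<gamma> = k. (norm (out r u \<gamma>))\<^sup>2) \<le> (norm u)\<^sup>2" for N
    using out_levels_le[of u N] coef_levels_le[of u N] state_level_nonneg[of r u N] by linarith
  show "(\<lambda>\<gamma>. (norm (out r u \<gamma>))\<^sup>2) summable_on UNIV"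
    by (rule words_summable(1)[OF zero_le_power2 *])
  show "(\<Sum>\<^sub>\<infinity>\<gamma>. (norm (out r u \<gamma>))\<^sup>2) \<le> (norm u)\<^sup>2"
    by (rule words_summable(2)[OF zero_le_power2 *])
qed

lemma state_level_le: "state_level r u N \<le> (norm u)\<^sup>2"
proof -
  have "0 \<le> (\<Sum>k<N. \<Sum>\<gamma> | length \<gamma> = k. (norm (out r u \<gamma>))\<^sup>2)" by (intro sum_nonneg) simp
  thus ?thesis using out_levels_le[of u N] coef_levels_le[of u N] by linarith
qed

text \<open>Each level gains a factor \<open>r\<^sup>2\<close> below 1: the partial sums satisfy
  S(N+1) \<le> r^2 (S(N+1) + |u|^2), which is solved for S(N+1).\<close>

lemma state_summable:
  assumes "r < 1"
  shows "(\<lambda>\<gamma>. (norm (state r u \<gamma>))\<^sup>2) summable_on UNIV"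
proof (rule words_summable(1)[OF zero_le_power2])
  fix N
  have r2': "r\<^sup>2 < 1" using assms r by (simp add: power_less_one_iff)
  define S where "S N = (\<Sum>k<N. state_level r u k)" for N
  have "S N \<le> S (Suc N)" by (simp add: S_def state_level_nonneg)
  have "S (Suc N) = (\<Sum>k<N. state_level r u (Suc k))"
    unfolding S_def sum.lessThan_Suc_shift by (simp add: state_level_0)
  also have "\<dots> \<le> (\<Sum>k<N. r\<^sup>2 * (state_level r u k + (\<Sum>\<gamma> | length \<gamma> = k. (norm (coef u \<gamma>))\<^sup>2)))"
    unfolding state_level_Suc by (intro sum_mono mult_left_mono) (simp_all add: sum_nonneg)
  also have "\<dots> = r\<^sup>2 * (S N + (\<Sum>k<N. \<Sum>\<gamma> | length \<gamma> = k. (norm (coef u \<gamma>))\<^sup>2))"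
    by (simp add: S_def sum_distrib_left sum.distrib algebra_simps)
  also have "\<dots> \<le> r\<^sup>2 * (S (Suc N) + (norm u)\<^sup>2)"
    using \<open>S N \<le> S (Suc N)\<close> by (intro mult_left_mono add_mono coef_levels_le) auto
  finally have "S (Suc N) * (1 - r\<^sup>2) \<le> r\<^sup>2 * (norm u)\<^sup>2" by (simp add: algebra_simps)
  hence "S (Suc N) \<le> r\<^sup>2 * (norm u)\<^sup>2 / (1 - r\<^sup>2)" using r2' by (simp add: field_simps)
  with \<open>S N \<le> S (Suc N)\<close>
  show "(\<Sum>k<N. \<Sum>\<gamma> | length \<gamma> = k. (norm (state r u \<gamma>))\<^sup>2) \<le> r\<^sup>2 * (norm u)\<^sup>2 / (1 - r\<^sup>2)"
    unfolding S_def state_level_def by linarith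
qed

end

section \<open>The characteristic function in coordinates\<close>

definition Theta :: "real \<Rightarrow> ('n list, 'h ^ 'n) l2 \<Rightarrow> ('n list, 'h) l2" where
  "Theta r u = Abs_l2 (out r u)"

lemma coef_Theta:
  assumes "0 \<le> r" "r \<le> 1"
  shows "coef (Theta r u) \<gamma> = out r u \<gamma>"
  unfolding Theta_def by (simp add: coef_Abs_l2[OF out_summable[OF assms]])

lemma norm_Theta_le:
  assumes "0 \<le> r" "r \<le> 1"
  shows "norm (Theta r u) \<le> norm u"
proof (rule power2_le_imp_le)
  show "(norm (Theta r u))\<^sup>2 \<le> (norm u)\<^sup>2"
    unfolding norm_l2_sq[of "Theta r u"] coef_Theta[OF assms] by (rule out_norm[OF assms])
qed simp

lemma state_add: "state r (u + v) \<gamma> = state r u \<gamma> + state r v \<gamma>"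
  by (induction \<gamma> rule: rev_induct)
    (simp_all add: state_Nil state_snoc bounded_clinear_add[OF bounded_clinear_cadj_B] bounded_clinear_add[OF
      bounded_clinear_Dr] plus_l2.rep_eq scaleR_add_right algebra_simps)

lemma state_scaleC: "state r (c *\<^sub>C u) \<gamma> = c *\<^sub>C state r u \<gamma>"
  by (induction \<gamma> rule: rev_induct)
    (simp_all add: state_Nil state_snoc bounded_clinear_scaleC[OF bounded_clinear_cadj_B] bounded_clinear_scaleC[OF
      bounded_clinear_Dr] scaleC_l2.rep_eq scaleC_add_right bounded_clinear_scaleC[OF bounded_clinear_vec_nth]
      scaleC_scaleR)

lemma bounded_clinear_Theta:
  assumes "0 \<le> r" "r \<le> 1"
  shows "bounded_clinear (Theta r)"
proof (rule bounded_clinearI[where K = 1])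
  note D = bounded_clinear_Dl
  show "norm (Theta r u) \<le> norm u * 1" for u using norm_Theta_le[OF assms] by simp
  show "Theta r (u + v) = Theta r u + Theta r v" for u v
    by (rule l2_eqI) (simp add: coef_Theta[OF assms] plus_l2.rep_eq out_def state_add
        bounded_clinear_add[OF D] bounded_clinear_add[OF B])
  show "Theta r (c *\<^sub>C u) = c *\<^sub>C Theta r u" for u c
    by (rule l2_eqI) (simp add: coef_Theta[OF assms] scaleC_l2.rep_eq out_def state_scaleC
        bounded_clinear_scaleC[OF D] bounded_clinear_scaleC[OF B] scaleC_diff_right)
qed

lemma state_tendsto: "((\<lambda>r. state r u \<gamma>) \<longlongrightarrow> state 1 u \<gamma>) (at_left 1)"
proof (induction \<gamma> rule: rev_induct)
  case (snoc i \<gamma>)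
  show ?case unfolding state_snoc
    by (intro tendsto_scaleR tendsto_ident_at tendsto_vec_nth tendsto_add tendsto_const
        bounded_linear.tendsto[OF bounded_clinear_bounded_linear[OF bounded_clinear_cadj_B]] snoc)
qed (simp add: state_Nil)

text \<open>The inverse in the definition of the characteristic function is the Hilbert choice inverse
  function; it is determined since \<open>I - \<Sum>\<^sub>i r \<Lambda>\<^sub>i \<otimes> A\<^sub>i\<^sup>*\<close> is injective.\<close>

lemma Theta_formula:
  assumes r: "0 < r" "r < 1"
  shows "- op_tensor id R u + op_tensor id Dl
        (inv (\<lambda>w. w - (\<Sum>i\<in>UNIV. op_tensor (\<lambda>c. r *\<^sub>R Lam i c) (cadj (A i)) w))
          (\<Sum>i\<in>UNIV. op_tensor (\<lambda>c. r *\<^sub>R Lam i c) (\<lambda>v. v $ i) (op_tensor id Dr u)))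
    = Theta r u" (is "_ + op_tensor id Dl (inv ?f ?z) = _")
proof -
  have r': "0 \<le> r" "r \<le> 1" using r by auto
  note cA = bounded_clinear_cadj[OF A]
  note vn = bounded_clinear_vec_nth
  have f_Nil: "coef (?f w) [] = coef w []" for w
    by (simp add: minus_l2.rep_eq coef_sum coef_op_tensor_Lam(1)[OF cA])
  have f_snoc: "coef (?f w) (\<gamma> @ [j]) = coef w (\<gamma> @ [j]) - r *\<^sub>R cadj (A j) (coef w \<gamma>)" for w \<gamma> j
    by (simp add: minus_l2.rep_eq coef_sum coef_op_tensor_Lam(2)[OF cA])
  \<comment> \<open>The operator is triangular with identity diagonal: its value at \<gamma> j
    involves w only at \<gamma> j and \<gamma>, so w is recovered from the empty word
    upwards.\<close>
  have "inj ?f"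
  proof (rule injI)
    fix w w' assume eq: "?f w = ?f w'"
    have "coef w \<gamma> = coef w' \<gamma>" for \<gamma>
    proof (induction \<gamma> rule: rev_induct)
      case Nil
      show ?case using f_Nil[of w] f_Nil[of w'] eq by simp
    next
      case (snoc j \<gamma>)
      show ?case using f_snoc[of w \<gamma> j] f_snoc[of w' \<gamma> j] eq snoc by simp
    qed
    thus "w = w'" by (rule l2_eqI)
  qed
  define Y where "Y = Abs_l2 (state r u)"
  have Y: "coef Y \<gamma> = state r u \<gamma>" for \<gamma>
    unfolding Y_def by (simp add: coef_Abs_l2[OF state_summable[OF r' r(2)]])
  have "?f Y = ?z"
  proof (rule l2_eqI)
    fix \<gamma> show "coef (?f Y) \<gamma> = coef ?z \<gamma>"
    proof (cases \<gamma> rule: rev_cases)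
      case Nil
      show ?thesis unfolding Nil f_Nil by (simp add: Y state_Nil coef_sum coef_op_tensor_Lam(1)[OF vn])
    next
      case (snoc \<delta> j)
      show ?thesis unfolding snoc f_snoc
        by (simp add: Y state_snoc coef_sum coef_op_tensor_Lam(2)[OF vn] cadj_R
            op_tensor_id_left[OF bounded_clinear_Dr] coef_l2_map[OF bounded_clinear_Dr]
            scaleR_add_right)
    qed
  qed
  hence "inv ?f ?z = Y" by (rule inv_f_eq[OF \<open>inj ?f\<close>])
  thus ?thesis
    by (intro l2_eqI) (simp add: coef_Theta[OF r'] out_def Y plus_l2.rep_eq uminus_l2.rep_eq
        op_tensor_id_left[OF bounded_clinear_Dl] coef_l2_map[OF bounded_clinear_Dl]
        minus_l2.rep_eq op_tensor_id_left[OF B] coef_l2_map[OF B])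
qed

lemma B_closure: "v \<in> closure (range Dr) \<Longrightarrow> R v \<in> closure (range Dl)"
proof -
  assume v: "v \<in> closure (range Dr)"
  have "R ` closure (range Dr) \<subseteq> closure (range Dl)"
  proof (rule image_closure_subset)
    show "continuous_on (closure (range Dr)) R"
      by (rule bounded_linear.continuous_on[OF bounded_clinear_bounded_linear[OF B] continuous_on_id])
    show "R ` range Dr \<subseteq> closure (range Dl)"
      using closure_subset[of "range Dl"] by (auto simp: B_Dr)
  qed simp
  thus ?thesis using v by blast
qed

end

lemma Im_cinner: "Im (cinner u v) = inner u (\<i> *\<^sub>C v)"
  by (simp add: inner_cinner cinner_scaleC_right)

subsection \<open>Pure row contractions\<close>

locale pure_row_contraction = row_contraction +
  assumes pure: "\<And>x. (\<lambda>k. \<Sum>\<alpha> | length \<alpha> = k. (norm (W \<alpha> x))\<^sup>2) \<longlonglongrightarrow> 0"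
begin

lemma W_levels: "(\<lambda>k. \<Sum>\<alpha> | length \<alpha> = k. (norm (Dl (W \<alpha> x)))\<^sup>2) sums (norm x)\<^sup>2"
proof -
  let ?s = "\<lambda>k. \<Sum>\<alpha> | length \<alpha> = k. (norm (W \<alpha> x))\<^sup>2"
  have "(\<Sum>\<alpha> | length \<alpha> = k. (norm (Dl (W \<alpha> x)))\<^sup>2) = ?s k - ?s (Suc k)" for k
    unfolding sum_words_snoc W_snoc norm_Dl by (simp add: sum_subtractf flip: norm_vec_sq)
  moreover have "(\<lambda>k. ?s k - ?s (Suc k)) sums (?s 0 - 0)" by (rule telescope_sums'[OF pure])
  ultimately show ?thesis by (simp add: words_0 W_Nil)
qed

definition K :: "'b \<Rightarrow> ('a list, 'b) l2" where
  "K x = Abs_l2 (\<lambda>\<alpha>. Dl (W \<alpha> x))"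

lemma K_has_sum: "((\<lambda>\<alpha>. (norm (Dl (W \<alpha> x)))\<^sup>2) has_sum (norm x)\<^sup>2) UNIV"
  by (rule has_sum_words_nonneg[OF W_levels]) simp

lemma coef_K: "coef (K x) \<alpha> = Dl (W \<alpha> x)"
  unfolding K_def by (simp add: coef_Abs_l2[OF has_sum_imp_summable[OF K_has_sum]])

lemma norm_K: "norm (K x) = norm x"
proof -
  have "(norm (K x))\<^sup>2 = (norm x)\<^sup>2"
    by (rule has_sum_unique[OF norm_l2_has_sum]) (simp add: coef_K K_has_sum)
  thus ?thesis by (rule power2_eq_imp_eq) simp_all
qed

lemma bounded_clinear_K: "bounded_clinear K"
proof (rule bounded_clinearI[where K = 1])
  note D = bounded_clinear_Dl and W' = bounded_clinear_W
  show "norm (K x) \<le> norm x * 1" for x by (simp add: norm_K)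
  show "K (x + y) = K x + K y" for x y
    by (rule l2_eqI) (simp add: coef_K plus_l2.rep_eq bounded_clinear_add[OF D] bounded_clinear_add[OF W'])
  show "K (c *\<^sub>C x) = c *\<^sub>C K x" for c x
    by (rule l2_eqI) (simp add: coef_K scaleC_l2.rep_eq bounded_clinear_scaleC[OF D] bounded_clinear_scaleC[OF W'])
qed

text \<open>The norm identity polarizes to real inner products, and replacing y by i y gives the
  imaginary parts.\<close>

lemma cadj_K_K: "cadj K (K x) = x"
proof (rule cinner_eqI)
  fix y
  have inn: "inner (K u) (K v) = inner u v" for u v
  proof -
    have "(norm (K (u + v)))\<^sup>2 = (norm (u + v))\<^sup>2" by (simp add: norm_K)
    hence "(norm (K u + K v))\<^sup>2 = (norm (u + v))\<^sup>2" by (simp add: bounded_clinear_add[OF bounded_clinear_K])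
    moreover have "(norm (K u))\<^sup>2 = (norm u)\<^sup>2" "(norm (K v))\<^sup>2 = (norm v)\<^sup>2" by (simp_all add: norm_K)
    ultimately show ?thesis
      unfolding power2_norm_eq_inner by (simp add: inner_add_left inner_add_right inner_commute)
  qed
  have "cinner (K x) (K y) = cinner x y"
    using inn[of x y] inn[of x "\<i> *\<^sub>C y"]
    by (simp add: complex_eq_iff Im_cinner inner_cinner[symmetric] bounded_clinear_scaleC[OF bounded_clinear_K])
  thus "cinner (cadj K (K x)) y = cinner x y" by (simp add: cadj_right[OF bounded_clinear_K, symmetric])
qed

lemma cinner_K: "cinner (K x) (K y) = cinner x y"
  by (simp add: cadj_right[OF bounded_clinear_K] cadj_K_K)

lemma cadj_K_tens: "cadj K (tens (ket \<alpha>) x) = op_word A \<alpha> (Dl x)"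
proof (rule cinner_eqI)
  fix y
  have "cinner (K y) (tens (ket \<alpha>) x) = cinner y (op_word A \<alpha> (Dl x))"
    by (simp add: cinner_tens_ket coef_K Dl_cinner) (subst (1 2) cinner_commute, simp add: W_left)
  thus "cinner (cadj K (tens (ket \<alpha>) x)) y = cinner (op_word A \<alpha> (Dl x)) y"
    by (subst (1 2) cinner_commute) (simp add: cadj_left[OF bounded_clinear_K])
qed

text \<open>Once the input has died out, the \<open>Dr\<close> term leaves the recursion and the
  state evolves by adjoint words alone, which is where purity can act.\<close>

lemma state_finite_support:
  assumes "\<And>\<gamma>. N \<le> length \<gamma> \<Longrightarrow> coef u \<gamma> = 0" and "N \<le> length \<gamma>"
  shows "state 1 u (\<gamma> @ \<beta>) = W \<beta> (state 1 u \<gamma>)"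
proof (induction \<beta> rule: rev_induct)
  case (snoc i \<beta>)
  have "state 1 u ((\<gamma> @ \<beta>) @ [i]) = cadj R (state 1 u (\<gamma> @ \<beta>)) $ i"
    unfolding state_snoc using assms by (simp add: bounded_clinear_zero[OF bounded_clinear_Dr])
  thus ?case using snoc by (simp add: W_snoc)
qed (simp add: W_Nil)

text \<open>From level N on, finitely many states evolve freely, so purity drives the state energy
  to 0; at r = 1 the balance then telescopes to equal input and output energy.\<close>

lemma norm_Theta_finite_support:
  assumes "\<And>\<gamma>. N \<le> length \<gamma> \<Longrightarrow> coef u \<gamma> = 0"
  shows "norm (Theta 1 u) = norm u"
proof -
  have "state_level 1 u (k + N) = (\<Sum>\<gamma> | length \<gamma> = N. \<Sum>\<beta> | length \<beta> = k. (norm (W \<beta> (state 1 u \<gamma>)))\<^sup>2)" for k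
    unfolding state_level_def add.commute[of k N] sum_words_append
    by (intro sum.cong refl) (simp add: state_finite_support[OF assms])
  moreover have "(\<lambda>k. \<Sum>\<gamma> | length \<gamma> = N. \<Sum>\<beta> | length \<beta> = k. (norm (W \<beta> (state 1 u \<gamma>)))\<^sup>2)
      \<longlonglongrightarrow> (\<Sum>\<gamma> :: 'a list | length \<gamma> = N. 0)"
    by (intro tendsto_sum pure)
  ultimately have "(\<lambda>k. state_level 1 u (k + N)) \<longlonglongrightarrow> 0" by simp
  hence s: "state_level 1 u \<longlonglongrightarrow> 0" by (rule LIMSEQ_offset)
  have "(\<lambda>k. \<Sum>\<gamma> | length \<gamma> = k. (norm (coef u \<gamma>))\<^sup>2 ) sums (norm u)\<^sup>2" by (rule norm_l2_levels)
  moreover have "(\<lambda>k. state_level 1 u (Suc k) - state_level 1 u k) sums (0 - state_level 1 u 0)"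
    by (rule telescope_sums[OF s])
  ultimately have "(\<lambda>k. (\<Sum>\<gamma> | length \<gamma> = k. (norm (coef u \<gamma>))\<^sup>2)
      - (state_level 1 u (Suc k) - state_level 1 u k)) sums ((norm u)\<^sup>2 - (0 - state_level 1 u 0))"
    by (rule sums_diff)
  hence "(\<lambda>k. \<Sum>\<gamma> | length \<gamma> = k. (norm (coef (Theta 1 u) \<gamma>))\<^sup>2) sums (norm u)\<^sup>2"
    by (simp add: state_level_Suc state_level_0 coef_Theta)
  hence "(norm (Theta 1 u))\<^sup>2 = (norm u)\<^sup>2" by (rule sums_unique2[OF norm_l2_levels])
  thus ?thesis by (rule power2_eq_imp_eq) simp_all
qed

text \<open>Truncation by word length reduces this to inputs of finite support, and both sides are
  continuous.\<close>

lemma norm_Theta: "norm (Theta 1 u) = norm u"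
proof -
  define v where "v N = (\<Sum>k<N. \<Sum>\<alpha> | length \<alpha> = k. tens (ket \<alpha>) (coef u \<alpha>))" for N
  have v: "v \<longlonglongrightarrow> u"
    using has_sum_words[OF has_sum_tens_ket[of u]] by (simp add: sums_def v_def[abs_def])
  have "norm (Theta 1 (v N)) = norm (v N)" for N
  proof (rule norm_Theta_finite_support)
    fix \<gamma> :: "'a list" assume "N \<le> length \<gamma>"
    thus "coef (v N) \<gamma> = 0"
      unfolding v_def sum_words_lessThan by (auto simp: coef_sum coef_tens_ket intro!: sum.neutral)
  qed
  moreover have "(\<lambda>N. norm (Theta 1 (v N))) \<longlonglongrightarrow> norm (Theta 1 u)"
    by (intro tendsto_norm bounded_linear.tendsto[OF bounded_clinear_bounded_linear[OF
          bounded_clinear_Theta]] v) auto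
  moreover have "(\<lambda>N. norm (v N)) \<longlonglongrightarrow> norm u" by (rule tendsto_norm[OF v])
  ultimately show ?thesis by (simp add: LIMSEQ_unique)
qed

text \<open>The isometry at r = 1 supplies the norm condition of \<open>l2_tendsto\<close>:
  |\<Theta>_r u| \<le> |u| = |\<Theta>_1 u|.\<close>

lemma Theta_tendsto: "((\<lambda>r. Theta r u) \<longlongrightarrow> Theta 1 u) (at_left 1)"
proof (rule l2_tendsto)
  have ev: "\<forall>\<^sub>F r in at_left 1. 0 < r \<and> r < (1 :: real)"
    by (rule eventually_at_leftI[of 0]) auto
  show "\<forall>\<^sub>F r in at_left 1. norm (Theta r u) \<le> norm (Theta 1 u)"
    using ev by eventually_elim (simp add: norm_Theta norm_Theta_le)
  fix \<gamma>
  have "((\<lambda>r. out r u \<gamma>) \<longlongrightarrow> out 1 u \<gamma>) (at_left 1)"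
    unfolding out_def
    by (intro tendsto_diff tendsto_const state_tendsto
        bounded_linear.tendsto[OF bounded_clinear_bounded_linear[OF bounded_clinear_Dl]])
  hence "((\<lambda>r. out r u \<gamma>) \<longlongrightarrow> coef (Theta 1 u) \<gamma>) (at_left 1)" by (simp add: coef_Theta)
  moreover have "\<forall>\<^sub>F r in at_left 1. out r u \<gamma> = coef (Theta r u) \<gamma>"
    using ev by eventually_elim (simp add: coef_Theta)
  ultimately show "((\<lambda>r. coef (Theta r u) \<gamma>) \<longlongrightarrow> coef (Theta 1 u) \<gamma>) (at_left 1)"
    by (rule Lim_transform_eventually)
qed

text \<open>The inner product restricted to length k is p k - p (k + 1). Here p 0 = 0 because the
  initial state is 0, and p tends to 0 by Cauchy-Schwarz, as the words acting on h decay and the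
  state energy stays bounded.\<close>

lemma K_orthogonal_Theta: "cinner (K h) (Theta 1 u) = 0"
proof -
  define p where "p k = (\<Sum>\<gamma> | length \<gamma> = k. cinner (W \<gamma> h) (state 1 u \<gamma>))" for k
  \<comment> \<open>The polarized Halmos identity for the pairs (w, 0) and (y, v).\<close>
  have pt: "cinner (Dl w) (Dl y - R v) = cinner w y - cinner (cadj R w) (cadj R y + Dr v)" for w y v
  proof -
    have "cinner (Dl w) (R v) = cinner (cadj R w) (Dr v)"
      by (simp add: cadj_right[OF B] cadj_Dl Dr_cinner)
    thus ?thesis
      by (simp add: cinner_diff_right cinner_add_right Dl_cinner Dl_Dl cadj_right[OF B])
  qed
  have "(\<Sum>\<gamma> | length \<gamma> = k. cinner (coef (K h) \<gamma>) (coef (Theta 1 u) \<gamma>)) = p k - p (Suc k)" for k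
    unfolding p_def sum_words_snoc state_snoc W_snoc
    by (simp add: coef_K coef_Theta out_def pt sum_subtractf cinner_vec_def)
  moreover have "(\<lambda>k. \<Sum>\<gamma> | length \<gamma> = k. cinner (coef (K h) \<gamma>) (coef (Theta 1 u) \<gamma>)) sums
      cinner (K h) (Theta 1 u)"
    by (rule has_sum_words[OF cinner_l2_has_sum])
  moreover have "p \<longlonglongrightarrow> 0"
  proof (rule Lim_null_comparison)
    have "norm (p k) \<le> sqrt (\<Sum>\<alpha> | length \<alpha> = k. (norm (W \<alpha> h))\<^sup>2) * norm u" for k
    proof -
      have "norm (p k) \<le> (\<Sum>\<gamma> | length \<gamma> = k. \<bar>norm (W \<gamma> h)\<bar> * \<bar>norm (state 1 u \<gamma>)\<bar>)"
        unfolding p_def by (rule sum_norm_le) (simp add: cmod_cinner_le)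
      also have "\<dots> \<le> L2_set (\<lambda>\<gamma>. norm (W \<gamma> h)) {\<gamma>. length \<gamma> = k}
          * L2_set (\<lambda>\<gamma>. norm (state 1 u \<gamma>)) {\<gamma>. length \<gamma> = k}"
        by (rule L2_set_mult_ineq)
      also have "\<dots> \<le> L2_set (\<lambda>\<gamma>. norm (W \<gamma> h)) {\<gamma>. length \<gamma> = k} * norm u"
      proof (rule mult_left_mono)
        show "L2_set (\<lambda>\<gamma>. norm (state 1 u \<gamma>)) {\<gamma>. length \<gamma> = k} \<le> norm u"
          unfolding L2_set_def using state_level_le[of 1 u k]
          by (intro real_le_lsqrt) (auto simp: state_level_def sum_nonneg)
      qed (simp add: L2_set_nonneg)
      finally show ?thesis by (simp add: L2_set_def)
    qed
    thus "\<forall>\<^sub>F k in sequentially. norm (p k) \<le> sqrt (\<Sum>\<alpha> | length \<alpha> = k. (norm (W \<alpha> h))\<^sup>2) * norm u"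
      by (intro always_eventually allI)
    show "(\<lambda>k. sqrt (\<Sum>\<alpha> | length \<alpha> = k. (norm (W \<alpha> h))\<^sup>2) * norm u) \<longlonglongrightarrow> 0"
      using tendsto_mult[OF tendsto_real_sqrt[OF pure[of h]] tendsto_const[of "norm u"]] by simp
  qed
  hence "(\<lambda>k. p k - p (Suc k)) sums (p 0 - 0)" by (rule telescope_sums')
  moreover have "p 0 = 0" by (simp add: p_def words_0 state_Nil)
  ultimately show ?thesis by (simp add: sums_unique2)
qed

text \<open>The explicit preimage of \<open>e\<^sub>\<gamma> \<otimes> \<Delta> d\<close> under \<open>(h, w) \<mapsto> K h + \<Theta> w\<close>. It comes from
  \<open>h = K\<^sup>* (e\<^sub>\<gamma> \<otimes> \<Delta> d)\<close> and \<open>w = \<Theta>\<^sup>* (e\<^sub>\<gamma> \<otimes> \<Delta> d)\<close>.\<close>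

lemma tens_ket_decomp:
  "\<exists>w\<in>tens_space (closure (range Dr)).
    tens (ket \<gamma>0) (Dl d) = K (op_word A \<gamma>0 (Dl (Dl d))) + Theta 1 w"
proof -
  \<comment> \<open>Backward propagation of \<open>Dl (Dl d)\<close> from \<gamma>0 to its prefixes:
    for \<gamma>0 = \<gamma> @ \<delta> the value is A_\<delta> \<Delta>^2 d. At the empty word this
    is h, and it vanishes beyond \<gamma>0, so c has finite support.\<close>
  define z where "z \<gamma> = (if take (length \<gamma>) \<gamma>0 = \<gamma> then op_word A (drop (length \<gamma>) \<gamma>0) (Dl (Dl d)) else 0)"
    for \<gamma>
  define Z :: "_ \<Rightarrow> 'b ^ 'a" where "Z \<gamma> = (\<chi> i. z (\<gamma> @ [i]))" for \<gamma>
  define h where "h = op_word A \<gamma>0 (Dl (Dl d))"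
  \<comment> \<open>The adjoint of \<Theta> contributes -R* \<Delta> d at \<gamma>0, which is -Dr
    (R* d) by \<open>cadj_Dl\<close>; written so, every value of c is visibly in the range of
    \<open>Dr\<close>.\<close>
  define c :: "'a list \<Rightarrow> 'b ^ 'a" where "c \<gamma> = Dr (Z \<gamma> - (if \<gamma> = \<gamma>0 then cadj R d else 0))" for \<gamma>
  have z_rec: "z \<gamma> = R (Z \<gamma>) + (if \<gamma> = \<gamma>0 then Dl (Dl d) else 0)" for \<gamma>
  proof (cases "take (length \<gamma>) \<gamma>0 = \<gamma> \<and> \<gamma> \<noteq> \<gamma>0")
    case True
    then obtain j \<beta> where g: "\<gamma>0 = \<gamma> @ j # \<beta>"
      by (metis append_take_drop_id append_self_conv neq_Nil_conv)
    have "R (Z \<gamma>) = (\<Sum>i\<in>UNIV. if i = j then A i (op_word A \<beta> (Dl (Dl d))) else 0)"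
      unfolding row_op_def Z_def z_def g by (intro sum.cong) (auto simp: bounded_clinear_zero[OF A])
    thus ?thesis using True by (simp add: z_def g)
  next
    case False
    have "z (\<gamma> @ [i]) = 0" for i
    proof -
      have "take (length (\<gamma> @ [i])) \<gamma>0 \<noteq> \<gamma> @ [i]"
      proof
        assume *: "take (length (\<gamma> @ [i])) \<gamma>0 = \<gamma> @ [i]"
        then obtain \<beta> where "\<gamma>0 = (\<gamma> @ [i]) @ \<beta>" by (metis append_take_drop_id)
        thus False using False by simp
      qed
      thus ?thesis by (simp add: z_def)
    qed
    hence "Z \<gamma> = 0" by (simp add: Z_def vec_eq_iff)
    thus ?thesis using False by (auto simp: z_def bounded_clinear_zero[OF B])
  qed
  have z0: "z \<gamma> = 0" if "length \<gamma> > length \<gamma>0" for \<gamma>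
  proof -
    have "take (length \<gamma>) \<gamma>0 \<noteq> \<gamma>" using that by auto
    thus ?thesis by (simp add: z_def)
  qed
  have c0: "c \<gamma> = 0" if "length \<gamma> > length \<gamma>0" for \<gamma>
  proof -
    have "Z \<gamma> = 0" unfolding Z_def vec_eq_iff using that by (simp add: z0)
    thus ?thesis using that by (auto simp: c_def bounded_clinear_zero[OF bounded_clinear_Dr])
  qed
  have "finite {\<gamma>. (norm (c \<gamma>))\<^sup>2 \<noteq> 0}"
    by (rule finite_subset[OF _ finite_words_less[of "Suc (length \<gamma>0)"]])
      (use c0 in \<open>auto simp: less_Suc_eq_le not_less[symmetric]\<close>)
  hence "(\<lambda>\<gamma>. (norm (c \<gamma>))\<^sup>2) summable_on UNIV"
    by (intro finite_nonzero_values_imp_summable_on) simp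
  hence "coef (Abs_l2 c) = c" by (rule coef_Abs_l2)
  then obtain w where cw: "coef w = c" by blast
  have Drc: "Dr (c \<gamma>) = Z \<gamma> - cadj R (R (Z \<gamma>)) - (if \<gamma> = \<gamma>0 then cadj R (Dl (Dl d)) else 0)" for \<gamma>
    by (simp add: c_def bounded_clinear_diff[OF bounded_clinear_Dr] Dr_Dr cadj_Dl
        bounded_clinear_zero[OF bounded_clinear_cadj_B] bounded_clinear_zero[OF B])
  have Rc: "R (c \<gamma>) = Dl (R (Z \<gamma>)) - (if \<gamma> = \<gamma>0 then Dl (R (cadj R d)) else 0)" for \<gamma>
    by (simp add: c_def B_Dr bounded_clinear_diff[OF B] bounded_clinear_diff[OF bounded_clinear_Dl]
        bounded_clinear_zero[OF bounded_clinear_Dl] bounded_clinear_zero[OF B])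
  \<comment> \<open>z satisfies the state recursion with input c but starts at h instead of 0.
    Subtracting the free evolution of h corrects this, and the subtracted term later cancels against
    K h.\<close>
  have st: "state 1 w \<gamma> = z \<gamma> - W \<gamma> h" for \<gamma>
  proof (induction \<gamma> rule: rev_induct)
    case Nil
    show ?case by (simp add: state_Nil z_def W_Nil h_def)
  next
    case (snoc i \<gamma>)
    have "cadj R (z \<gamma>) + Dr (c \<gamma>) = Z \<gamma>"
      unfolding Drc z_rec[of \<gamma>]
      by (simp add: bounded_clinear_add[OF bounded_clinear_cadj_B] bounded_clinear_zero[OF bounded_clinear_cadj_B])
    hence "cadj R (z \<gamma> - W \<gamma> h) + Dr (c \<gamma>) = Z \<gamma> - cadj R (W \<gamma> h)"
      by (simp add: bounded_clinear_diff[OF bounded_clinear_cadj_B] algebra_simps)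
    thus ?case unfolding state_snoc snoc by (simp add: cw Z_def W_snoc)
  qed
  have "tens (ket \<gamma>0) (Dl d) = K h + Theta 1 w"
  proof (rule l2_eqI)
    fix \<gamma>
    have "coef (K h + Theta 1 w) \<gamma> = Dl (z \<gamma>) - R (c \<gamma>)"
      by (simp add: plus_l2.rep_eq coef_K coef_Theta out_def st cw
          bounded_clinear_diff[OF bounded_clinear_Dl])
    also have "\<dots> = (if \<gamma> = \<gamma>0 then Dl (Dl (Dl d) + R (cadj R d)) else 0)"
      unfolding Rc by (subst z_rec) (simp add: bounded_clinear_add[OF bounded_clinear_Dl]
          bounded_clinear_zero[OF bounded_clinear_Dl])
    also have "\<dots> = coef (tens (ket \<gamma>0) (Dl d)) \<gamma>" by (simp add: coef_tens_ket Dl_Dl)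
    finally show "coef (tens (ket \<gamma>0) (Dl d)) \<gamma> = coef (K h + Theta 1 w) \<gamma>" by (rule sym)
  qed
  moreover have "w \<in> tens_space (closure (range Dr))"
    using closure_subset[of "range Dr"] by (auto simp: tens_space_def cw c_def)
  ultimately show ?thesis unfolding h_def by blast
qed

text \<open>For the converse inclusion, each coordinate of u - K K* u lies in the closed range of
  \<open>Dl\<close>. By \<open>tens_ket_decomp\<close> and orthogonality to the range of \<Theta> it
  is orthogonal to every \<open>Dl d\<close>, hence to itself.\<close>

lemma range_K:
  "range K = {u \<in> tens_space (closure (range Dl)).
    \<forall>v\<in>tens_space (closure (range Dr)). cinner u (Theta 1 v) = 0}"
proof (intro equalityI subsetI)
  fix u assume "u \<in> range K"
  thus "u \<in> {u \<in> tens_space (closure (range Dl)).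
    \<forall>v\<in>tens_space (closure (range Dr)). cinner u (Theta 1 v) = 0}"
    using closure_subset[of "range Dl"] by (auto simp: tens_space_def coef_K K_orthogonal_Theta)
next
  fix u assume "u \<in> {u \<in> tens_space (closure (range Dl)).
    \<forall>v\<in>tens_space (closure (range Dr)). cinner u (Theta 1 v) = 0}"
  hence u: "\<And>\<gamma>. coef u \<gamma> \<in> closure (range Dl)"
    and orth: "\<And>v. v \<in> tens_space (closure (range Dr)) \<Longrightarrow> cinner u (Theta 1 v) = 0"
    by (auto simp: tens_space_def)
  have "coef u \<gamma> = coef (K (cadj K u)) \<gamma>" for \<gamma>
  proof -
    define e where "e = coef u \<gamma> - coef (K (cadj K u)) \<gamma>"
    have "cinner e (Dl d) = 0" for d
    proof -
      obtain w where w: "w \<in> tens_space (closure (range Dr))"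
        and eq: "tens (ket \<gamma>) (Dl d) = K (op_word A \<gamma> (Dl (Dl d))) + Theta 1 w"
        using tens_ket_decomp[of \<gamma> d] by blast
      have "cinner (coef u \<gamma>) (Dl d) = cinner u (tens (ket \<gamma>) (Dl d))" by (simp add: cinner_tens_ket)
      also have "\<dots> = cinner (cadj K u) (op_word A \<gamma> (Dl (Dl d)))"
        unfolding eq by (simp add: cinner_add_right orth[OF w] cadj_right[OF bounded_clinear_K])
      also have "\<dots> = cinner (coef (K (cadj K u)) \<gamma>) (Dl d)"
        by (simp add: coef_K Dl_cinner) (subst (1 2) cinner_commute, simp add: W_left)
      finally show ?thesis by (simp add: e_def cinner_diff_left)
    qed
    hence sub: "range Dl \<subseteq> {x. cinner e x = 0}" by auto
    have "closed {x. cinner e x = 0}"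
      by (intro closed_Collect_eq continuous_on_const
          bounded_linear.continuous_on[OF bounded_linear_cinner_right continuous_on_id])
    hence cl: "closure (range Dl) \<subseteq> {x. cinner e x = 0}" by (rule closure_minimal[OF sub])
    have "cinner e (coef u \<gamma>) = 0" using cl u by blast
    moreover have "coef (K (cadj K u)) \<gamma> \<in> closure (range Dl)"
      using closure_subset[of "range Dl"] by (auto simp: coef_K)
    hence "cinner e (coef (K (cadj K u)) \<gamma>) = 0" using cl by blast
    ultimately have "cinner e e = 0" by (subst (2) e_def) (simp add: cinner_diff_right)
    thus ?thesis by (simp add: cinner_self e_def)
  qed
  hence "u = K (cadj K u)" by (rule l2_eqI)
  thus "u \<in> range K" by blast
qed

lemma Theta_isometry:
  "isometry_between (tens_space (closure (range Dr))) (tens_space (closure (range Dl))) (Theta 1)"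
proof -
  have T: "bounded_clinear (Theta 1)" by (rule bounded_clinear_Theta) auto
  have cl: "Dl x - y \<in> closure (range Dl)" if "y \<in> closure (range Dl)" for x y
  proof -
    have "(\<lambda>y. Dl x - y) ` closure (range Dl) \<subseteq> closure (range Dl)"
    proof (rule image_closure_subset)
      have "Dl x - Dl z \<in> range Dl" for z
        by (metis bounded_clinear_diff[OF bounded_clinear_Dl] rangeI)
      thus "(\<lambda>y. Dl x - y) ` range Dl \<subseteq> closure (range Dl)"
        using closure_subset[of "range Dl"] by blast
    qed (auto intro!: continuous_intros)
    thus ?thesis using that by blast
  qed
  show ?thesis
    unfolding isometry_between_def
    using closure_subset[of "range Dl"]
    by (auto simp: tens_space_def coef_Theta out_def norm_Theta bounded_clinear_add[OF T]
        bounded_clinear_scaleC[OF T] intro!: cl B_closure)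
qed

end

subsection \<open>Series in a row contraction\<close>

text \<open>Summation by parts: with g the errors of the partial sums, the radial error is (1 - r)
  times the power series of g. The first N terms contribute at most (1 - r) C, the tail at most e/2
  by the geometric series.\<close>

lemma abel_limit:
  fixes a :: "nat \<Rightarrow> 'b::banach"
  assumes a: "a sums L"
  shows "((\<lambda>r. \<Sum>k. r ^ k *\<^sub>R a k) \<longlongrightarrow> L) (at_left 1)"
proof -
  define g where "g k = (\<Sum>j<Suc k. a j) - L" for k
  have "(\<lambda>k. \<Sum>j<Suc k. a j) \<longlonglongrightarrow> L" using a unfolding sums_def by (rule LIMSEQ_Suc)
  hence g0: "g \<longlonglongrightarrow> 0" using LIM_zero unfolding g_def[abs_def] by fastforce
  then obtain G where G: "\<And>k. norm (g k) \<le> G" "G > 0"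
    using convergent_imp_Bseq[OF convergentI[OF g0]] unfolding Bseq_def by blast
  have key: "(\<Sum>k. r ^ k *\<^sub>R a k) - L = (1 - r) *\<^sub>R (\<Sum>k. r ^ k *\<^sub>R g k)"
    and sg: "summable (\<lambda>k. r ^ k * norm (g k))" if r: "0 < r" "r < 1" for r :: real
  proof -
    show sg: "summable (\<lambda>k. r ^ k * norm (g k))"
      by (rule summable_comparison_test'[of "\<lambda>k. r ^ k * G" 0])
        (use r G in \<open>auto intro!: summable_mult2 summable_geometric mult_left_mono\<close>)
    hence "summable (\<lambda>k. norm (r ^ k *\<^sub>R g k))" using r by simp
    hence s1: "(\<lambda>k. r ^ k *\<^sub>R g k) sums (\<Sum>k. r ^ k *\<^sub>R g k)" (is "_ sums ?S")
      by (intro summable_sums summable_norm_cancel[of "\<lambda>k. r ^ k *\<^sub>R g k"])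
    have "(\<lambda>k. r *\<^sub>R (r ^ k *\<^sub>R g k)) sums (r *\<^sub>R ?S)" by (rule sums_scaleR_right[OF s1])
    hence "(\<lambda>k. r ^ Suc k *\<^sub>R g k) sums (r *\<^sub>R ?S)" by simp
    \<comment> \<open>h k is r^k g_(k-1) under the convention g_(-1) = -L, so that r^k g_k - h k =
      r^k a_k also for k = 0.\<close>
    moreover define h where "h k = (case k of 0 \<Rightarrow> - L | Suc k \<Rightarrow> r ^ Suc k *\<^sub>R g k)" for k
    ultimately have "(\<lambda>k. h (Suc k)) sums (r *\<^sub>R ?S)" by simp
    hence "h sums (r *\<^sub>R ?S + h 0)" by (rule sums_Suc)
    hence "h sums (r *\<^sub>R ?S + - L)" by (simp add: h_def)
    from sums_diff[OF s1 this]
    have "(\<lambda>k. r ^ k *\<^sub>R g k - h k) sums (?S - (r *\<^sub>R ?S + - L))" .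
    moreover have "r ^ k *\<^sub>R g k - h k = r ^ k *\<^sub>R a k" for k
      by (cases k) (simp_all add: h_def g_def flip: scaleR_diff_right)
    ultimately have "(\<lambda>k. r ^ k *\<^sub>R a k) sums (?S - (r *\<^sub>R ?S + - L))" by simp
    thus "(\<Sum>k. r ^ k *\<^sub>R a k) - L = (1 - r) *\<^sub>R ?S"
      by (simp add: sums_iff scaleR_diff_left)
  qed
  show ?thesis
  proof (rule tendstoI)
    fix e :: real assume "e > 0"
    obtain N where N: "\<And>k. k \<ge> N \<Longrightarrow> norm (g k) < e / 2"
      using LIMSEQ_D[OF g0, of "e / 2"] \<open>e > 0\<close> by auto
    define C where "C = (\<Sum>k<N. norm (g k))"
    have "((\<lambda>r. (1 - r) * C) \<longlongrightarrow> (1 - 1) * C) (at_left (1 :: real))" by (intro tendsto_intros)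
    hence "\<forall>\<^sub>F r in at_left (1::real). dist ((1 - r) * C) 0 < e / 2"
      using \<open>e > 0\<close> by (intro tendstoD) auto
    moreover have "\<forall>\<^sub>F r in at_left 1. 0 < r \<and> r < (1 :: real)"
      by (rule eventually_at_leftI[of 0]) auto
    ultimately show "\<forall>\<^sub>F r in at_left 1. dist (\<Sum>k. r ^ k *\<^sub>R a k) L < e"
    proof eventually_elim
      case (elim r)
      hence r: "0 < r" "r < 1" by auto
      have sN: "summable (\<lambda>k. r ^ (k + N) * norm (g (k + N)))"
        using sg[OF r] by (rule summable_ignore_initial_segment)
      have geo: "(\<lambda>k. r ^ k * (e / 2)) sums (1 / (1 - r) * (e / 2))"
        by (intro sums_mult2 geometric_sums) (use r in auto)
      have "(\<Sum>k. r ^ (k + N) * norm (g (k + N))) \<le> (\<Sum>k. r ^ k * (e / 2))"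
      proof (rule suminf_le[OF _ sN sums_summable[OF geo]])
        fix k
        have "r ^ (k + N) \<le> r ^ k" using r by (intro power_decreasing) auto
        thus "r ^ (k + N) * norm (g (k + N)) \<le> r ^ k * (e / 2)"
          using r N[of "k + N"] by (intro mult_mono) auto
      qed
      also have "\<dots> = (e / 2) / (1 - r)" using geo by (simp add: sums_iff)
      finally have 1: "(\<Sum>k. r ^ (k + N) * norm (g (k + N))) \<le> (e / 2) / (1 - r)" .
      have "(\<Sum>k<N. r ^ k * norm (g k)) \<le> C"
        unfolding C_def using r by (intro sum_mono mult_left_le_one_le) (auto simp: power_le_one)
      hence "(\<Sum>k. r ^ k * norm (g k)) \<le> C + (e / 2) / (1 - r)"
        using suminf_split_initial_segment[OF sg[OF r], of N] 1 by simp
      hence "(1 - r) * (\<Sum>k. r ^ k * norm (g k)) \<le> (1 - r) * (C + (e / 2) / (1 - r))"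
        using r by (intro mult_left_mono) auto
      also have "\<dots> = (1 - r) * C + e / 2" using r by (simp add: field_simps)
      also have "\<dots> < e" using elim(1) by (simp add: dist_real_def)
      finally have 2: "(1 - r) * (\<Sum>k. r ^ k * norm (g k)) < e" .
      have "dist (\<Sum>k. r ^ k *\<^sub>R a k) L = (1 - r) * norm (\<Sum>k. r ^ k *\<^sub>R g k)"
        unfolding dist_norm key[OF r] using r by simp
      also have "norm (\<Sum>k. r ^ k *\<^sub>R g k) \<le> (\<Sum>k. norm (r ^ k *\<^sub>R g k))"
        using sg[OF r] r by (intro summable_norm) simp
      also have "(\<Sum>k. norm (r ^ k *\<^sub>R g k)) = (\<Sum>k. r ^ k * norm (g k))" using r by simp
      finally show ?case using 2 r by (simp add: mult_left_mono)
    qed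
  qed
qed

text \<open>Coefficients after right multiplication by Z_\<beta>; for square summable families this
  is \<open>l2_push\<close>.\<close>

definition is_shift :: "'n list \<Rightarrow> 'n ncps \<Rightarrow> 'n ncps \<Rightarrow> bool" where
  "is_shift \<beta> a c \<longleftrightarrow> (\<forall>\<alpha>. c (\<alpha> @ \<beta>) = a \<alpha>) \<and> (\<forall>\<omega>. \<omega> \<notin> range (\<lambda>\<alpha>. \<alpha> @ \<beta>) \<longrightarrow> c \<omega> = 0)"

lemma is_shift_unique: "is_shift \<beta> a c \<Longrightarrow> is_shift \<beta> a c' \<Longrightarrow> c = c'"
  unfolding is_shift_def by (metis (no_types, lifting) ext imageE)

lemma is_shift_push: "is_shift \<beta> (coef u) (coef (l2_push (\<lambda>\<alpha>. \<alpha> @ \<beta>) u))"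
  unfolding is_shift_def
  using coef_l2_push_image[OF inj_append_right[of \<beta>]] coef_l2_push_outside[OF inj_append_right[of \<beta>]]
  by blast

text \<open>Only words ending in \<beta> carry coefficients, so degrees rise by exactly the length
  of \<beta>, and X_\<beta> acts on the vector first.\<close>

lemma hom_part_shift:
  fixes X :: "'n::finite \<Rightarrow> 'h::chilbert \<Rightarrow> 'h"
  assumes "is_shift \<beta> a c"
  shows "hom_part c X (k + length \<beta>) x = hom_part a X k (op_word X \<beta> x)"
    and "k < length \<beta> \<Longrightarrow> hom_part c X k x = 0"
proof -
  have c: "\<And>\<alpha>. c (\<alpha> @ \<beta>) = a \<alpha>" "\<And>\<omega>. \<omega> \<notin> range (\<lambda>\<alpha>. \<alpha> @ \<beta>) \<Longrightarrow> c \<omega> = 0"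
    using assms by (auto simp: is_shift_def)
  have "(\<Sum>\<beta>' | length \<beta>' = length \<beta>. c (\<alpha> @ \<beta>') *\<^sub>C op_word X (\<alpha> @ \<beta>') x)
      = a \<alpha> *\<^sub>C op_word X \<alpha> (op_word X \<beta> x)" for \<alpha>
  proof -
    have "(\<Sum>\<beta>' | length \<beta>' = length \<beta>. c (\<alpha> @ \<beta>') *\<^sub>C op_word X (\<alpha> @ \<beta>') x)
        = (\<Sum>\<beta>' | length \<beta>' = length \<beta>. if \<beta>' = \<beta> then a \<alpha> *\<^sub>C op_word X \<alpha> (op_word X \<beta> x) else 0)"
    proof (intro sum.cong refl)
      fix \<beta>' :: "'n list" assume "\<beta>' \<in> {\<beta>'. length \<beta>' = length \<beta>}"
      hence l: "length \<beta>' = length \<beta>" by simp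
      have "\<alpha> @ \<beta>' \<notin> range (\<lambda>\<alpha>. \<alpha> @ \<beta>)" if "\<beta>' \<noteq> \<beta>" using that l by auto
      thus "c (\<alpha> @ \<beta>') *\<^sub>C op_word X (\<alpha> @ \<beta>') x
          = (if \<beta>' = \<beta> then a \<alpha> *\<^sub>C op_word X \<alpha> (op_word X \<beta> x) else 0)"
        using c by (auto simp: op_word_append)
    qed
    thus ?thesis by (simp add: sum.delta[OF finite_words])
  qed
  thus "hom_part c X (k + length \<beta>) x = hom_part a X k (op_word X \<beta> x)"
    unfolding hom_part_def sum_words_append by simp
  assume k: "k < length \<beta>"
  have "c \<omega> = 0" if "length \<omega> = k" for \<omega>
    using that k by (intro c(2)) auto
  thus "hom_part c X k x = 0" unfolding hom_part_def by (intro sum.neutral) auto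
qed

lemma hom_part_shift_sums:
  assumes "is_shift \<beta> a c"
  shows "(\<lambda>k. hom_part c X k x) sums L \<longleftrightarrow> (\<lambda>k. hom_part a X k (op_word X \<beta> x)) sums L"
proof -
  have "(\<lambda>k. hom_part c X (k + length \<beta>) x) sums L \<longleftrightarrow> (\<lambda>k. hom_part c X k x) sums L"
    by (rule sums_zero_iff_shift) (rule hom_part_shift(2)[OF assms])
  thus ?thesis by (simp only: hom_part_shift(1)[OF assms])
qed

lemma op_word_scaleR:
  assumes "\<And>i. bounded_clinear (X i)"
  shows "op_word (\<lambda>i x. r *\<^sub>R X i x) \<alpha> x = r ^ length \<alpha> *\<^sub>R op_word X \<alpha> x"
  by (induction \<alpha>) (simp_all add: bounded_clinear_scaleR[OF assms])

lemma nc_eval_scaleR: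
  assumes "\<And>i. bounded_clinear (X i)"
  shows "nc_eval c (\<lambda>i x. r *\<^sub>R X i x) x = (\<Sum>k. r ^ k *\<^sub>R hom_part c X k x)"
  unfolding nc_eval_def hom_part_def scaleR_sum_right
  by (intro arg_cong[of _ _ suminf] ext sum.cong refl) (simp add: op_word_scaleR[OF assms] scaleC_scaleR)

text \<open>Uniqueness of sums settles the SOT case, Abel's theorem the radial one. Convergence is
  asked for at the single vector x only, since later it is known only for special vectors.\<close>

lemma value_eqI:
  assumes v: "sot_value c X Y \<or> rad_value c X Y" and s: "(\<lambda>k. hom_part (c i) X k x) sums L"
  shows "Y i x = L"
  using v
proof
  assume "sot_value c X Y"
  hence "(\<lambda>k. hom_part (c i) X k x) sums Y i x" by (simp add: sot_value_def)
  thus ?thesis using s by (rule sums_unique2)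
next
  assume r: "rad_value c X Y"
  hence X: "\<And>i. bounded_clinear (X i)" by (simp add: rad_value_def)
  have "((\<lambda>r. nc_eval (c i) (\<lambda>i x. r *\<^sub>R X i x) x) \<longlongrightarrow> Y i x) (at_left 1)"
    using r by (simp add: rad_value_def)
  moreover have "((\<lambda>r. nc_eval (c i) (\<lambda>i x. r *\<^sub>R X i x) x) \<longlongrightarrow> L) (at_left 1)"
    unfolding nc_eval_scaleR[OF X] by (rule abel_limit[OF s])
  ultimately show ?thesis by (rule tendsto_unique[OF trivial_limit_at_left_real])
qed

lemma value_bounded:
  assumes "sot_value c X Y \<or> rad_value c X Y"
  shows "bounded_clinear (X i)" "bounded_clinear (Y i)"
  using assms by (auto simp: sot_value_def rad_value_def)

section \<open>Compression of the universal model to the range of K\<close>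

context pure_row_contraction
begin

text \<open>The bounded operator K* is applied to the expansion of c in basis vectors. This gives
  convergence on the range of \<open>Dl\<close> for coefficients that are merely square
  summable.\<close>

lemma cadj_K_sums: "(\<lambda>k. hom_part (coef c) A k (Dl x)) sums cadj K (tens c x)"
proof -
  have "((\<lambda>\<alpha>. cadj K (tens (coef c \<alpha> *\<^sub>C ket \<alpha>) x)) has_sum cadj K (tens c x)) UNIV"
    by (rule has_sum_bounded_linear[OF bounded_linear_compose[OF
          bounded_clinear_bounded_linear[OF bounded_clinear_cadj[OF bounded_clinear_K]]
          bounded_clinear_bounded_linear[OF bounded_clinear_tens_left]] has_sum_ket])
  hence "((\<lambda>\<alpha>. coef c \<alpha> *\<^sub>C op_word A \<alpha> (Dl x)) has_sum cadj K (tens c x)) UNIV"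
    by (simp add: tens_simps bounded_clinear_scaleC[OF bounded_clinear_cadj[OF bounded_clinear_K]]
        cadj_K_tens)
  thus ?thesis unfolding hom_part_def by (rule has_sum_words)
qed

text \<open>Compared on e_\<beta> \<otimes> x, the right side is a series in the shifted
  coefficients at \<Delta> x, hence one in a^i at A_\<beta> \<Delta> x, and \<open>value_eqI\<close>
  identifies its sum as the value of T_i.\<close>

lemma K_intertwine:
  assumes M: "\<And>i. bounded_clinear (M i)" "\<And>i \<beta>. M i (ket \<beta>) = l2_push (\<lambda>\<alpha>. \<alpha> @ \<beta>) (a i)"
    and T: "sot_value (\<lambda>i. coef (a i)) A T \<or> rad_value (\<lambda>i. coef (a i)) A T"
  shows "T i (cadj K w) = cadj K (op_tensor (M i) id w)"
proof (rule l2_op_eqI[where A = "\<lambda>w. T i (cadj K w)" and B = "\<lambda>w. cadj K (op_tensor (M i) id w)"])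
  note cK = bounded_clinear_cadj[OF bounded_clinear_K]
  show "bounded_clinear (\<lambda>w. T i (cadj K w))"
    by (rule bounded_clinear_compose[OF value_bounded(2)[OF T] cK])
  show "bounded_clinear (\<lambda>w. cadj K (op_tensor (M i) id w))"
    by (rule bounded_clinear_compose[OF cK op_tensor_id_right(1)[OF M(1)]])
  fix \<beta> x
  have "(\<lambda>k. hom_part (coef (l2_push (\<lambda>\<alpha>. \<alpha> @ \<beta>) (a i))) A k (Dl x))
      sums cadj K (tens (l2_push (\<lambda>\<alpha>. \<alpha> @ \<beta>) (a i)) x)"
    by (rule cadj_K_sums)
  hence "(\<lambda>k. hom_part (coef (a i)) A k (op_word A \<beta> (Dl x)))
      sums cadj K (tens (l2_push (\<lambda>\<alpha>. \<alpha> @ \<beta>) (a i)) x)"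
    unfolding hom_part_shift_sums[OF is_shift_push] .
  from value_eqI[OF T this]
  show "T i (cadj K (tens (ket \<beta>) x)) = cadj K (op_tensor (M i) id (tens (ket \<beta>) x))"
    by (simp add: cadj_K_tens op_tensor_id_right(2)[OF M(1)] M(2))
qed

lemma orth_proj_range_K: "orth_proj (range K) x = K (cadj K x)"
  unfolding orth_proj_def
proof (rule the_equality)
  have *: "cinner (x - K (cadj K x)) (K z) = 0" for z
    by (simp add: cinner_diff_left cinner_K cadj_right[OF bounded_clinear_K, of x])
  thus "K (cadj K x) \<in> range K \<and> (\<forall>z\<in>range K. cinner (x - K (cadj K x)) z = 0)" by auto
  fix y assume y: "y \<in> range K \<and> (\<forall>z\<in>range K. cinner (x - y) z = 0)"
  then obtain v where v: "y = K v" by blast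
  have "cinner v z = cinner (cadj K x) z" for z
  proof -
    have "cinner (x - K v) (K z) = 0" using y[unfolded v] by blast
    thus ?thesis by (simp add: cinner_diff_left cinner_K cadj_right[OF bounded_clinear_K, of x])
  qed
  hence "v = cadj K x" by (rule cinner_eqI)
  thus "y = K (cadj K x)" by (simp add: v)
qed

lemma K_model:
  assumes "\<And>i. bounded_clinear (M i)" "\<And>i \<beta>. M i (ket \<beta>) = l2_push (\<lambda>\<alpha>. \<alpha> @ \<beta>) (a i)"
    and "sot_value (\<lambda>i. coef (a i)) A T \<or> rad_value (\<lambda>i. coef (a i)) A T"
  shows "unitarily_equiv_on T (range K) (\<lambda>i x. orth_proj (range K) (op_tensor (M i) id x))"
  unfolding unitarily_equiv_on_def
  by (intro exI[of _ K])
    (simp add: bounded_clinear_K cinner_K orth_proj_range_K cadj_K_K K_intertwine[OF assms, symmetric])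

end

section \<open>Pure tuples in the noncommutative domain\<close>

text \<open>The assumption on M isolates the consequence of the model property that its three cases
  share: M_i f_\<beta> has the coefficients of Z_i, shifted by \<beta>.\<close>

lemma model_theorem:
  fixes f :: "'n::finite \<Rightarrow> 'n ncps" and T :: "'n \<Rightarrow> 'h::chilbert \<Rightarrow> 'h"
  assumes M: "\<And>i. bounded_clinear (M i)" "\<And>i \<beta>. M i (ket \<beta>) = l2_push (\<lambda>\<alpha>. \<alpha> @ \<beta>) (a i)"
    and T: "T \<in> nc_domain f a" and pure: "pure_tuple f T"
  shows "isometry_between (tens_space (defect_star_space f T)) (tens_space (defect_space f T))
           (char_fun f T)
         \<and> unitarily_equiv_on T (model_space f T)
             (\<lambda>i x. orth_proj (model_space f T) (op_tensor (M i) id x))"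
proof -
  define A where "A = fun_calc f T"
  have val: "sot_value (\<lambda>i. coef (a i)) A T \<or> rad_value (\<lambda>i. coef (a i)) A T"
    and row: "onorm (row_op A) \<le> 1"
    using T by (auto simp: nc_domain_def A_def)
  interpret row_contraction A by unfold_locales (fact value_bounded(1)[OF val] row)+
  interpret pure_row_contraction A
  proof unfold_locales
    fix x
    have "(\<lambda>k. \<Sum>\<alpha> | length \<alpha> = k. op_word A \<alpha> (W \<alpha> x)) \<longlonglongrightarrow> 0"
      unfolding W_def unfolding A_def using pure by (simp add: pure_tuple_def)
    \<comment> \<open>Pairing with x turns the sum of A_\<alpha> A_\<alpha>* x into the sum of the
      squared norms of A_\<alpha>* x.\<close>
    hence "(\<lambda>k. inner (\<Sum>\<alpha> | length \<alpha> = k. op_word A \<alpha> (W \<alpha> x)) x) \<longlonglongrightarrow> inner 0 x"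
      by (intro tendsto_inner tendsto_const)
    thus "(\<lambda>k. \<Sum>\<alpha> | length \<alpha> = k. (norm (W \<alpha> x))\<^sup>2) \<longlonglongrightarrow> 0"
      by (simp add: inner_sum_left inner_cinner W_left cinner_sum_left cinner_self)
  qed
  have "R v = (\<Sum>i\<in>UNIV. A i (v $ i))" for v by (simp add: row_op_def)
  hence "R (cadj R x) = (\<Sum>i\<in>UNIV. A i (cadj (A i) x))" for x by (simp only: cadj_R)
  hence dl: "defect f T = Dl"
    unfolding defect_def Dl_def A_def[symmetric] by simp
  have dr: "defect_star f T = Dr"
    unfolding defect_star_def Dr_def A_def[symmetric] by (rule refl)
  have "char_fun f T u = Theta 1 u" for u
  proof -
    have "\<forall>\<^sub>F r in at_left 1. Theta r u = char_fun_r f T r u"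
    \<comment> \<open>The resolvent formula is available for 0 < r < 1, which suffices for a limit
      from the left at 1.\<close>
    proof (rule eventually_at_leftI[of 0])
      fix r :: real assume "r \<in> {0<..<1}"
      thus "Theta r u = char_fun_r f T r u"
        unfolding char_fun_r_def dl dr A_def[symmetric] by (intro Theta_formula[symmetric]) auto
    qed simp
    hence "((\<lambda>r. char_fun_r f T r u) \<longlongrightarrow> Theta 1 u) (at_left 1)"
      by (rule Lim_transform_eventually[OF Theta_tendsto])
    thus ?thesis unfolding char_fun_def by (intro tendsto_Lim trivial_limit_at_left_real)
  qed
  hence cf: "char_fun f T = Theta 1" by (rule ext)
  have ms: "model_space f T = range K"
    unfolding model_space_def range_K cf defect_space_def defect_star_space_def dl dr by (rule refl)
  show ?thesis
    unfolding ms cf defect_space_def defect_star_space_def dl dr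
    using Theta_isometry K_model[OF M val] by blast
qed

subsection \<open>Composition of power series\<close>

definition splits :: "'n list \<Rightarrow> ('n list \<times> 'n list) set" where
  "splits \<omega> = {x. fst x @ snd x = \<omega>}"

lemma mem_splits: "x \<in> splits \<omega> \<longleftrightarrow> fst x @ snd x = \<omega>"
  by (simp add: splits_def)

lemma finite_splits: "finite (splits \<omega>)"
proof (rule finite_subset)
  show "splits \<omega> \<subseteq> (\<lambda>k. (take k \<omega>, drop k \<omega>)) ` {..length \<omega>}"
  proof
    fix x assume "x \<in> splits \<omega>"
    hence "x = (take (length (fst x)) \<omega>, drop (length (fst x)) \<omega>)" "length (fst x) \<le> length \<omega>"
      by (auto simp: mem_splits prod_eq_iff)
    thus "x \<in> (\<lambda>k. (take k \<omega>, drop k \<omega>)) ` {..length \<omega>}" by blast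
  qed
qed simp

lemma nc_mult_splits: "nc_mult p q \<omega> = (\<Sum>x\<in>splits \<omega>. p (fst x) * q (snd x))"
  by (simp add: nc_mult_def splits_def case_prod_unfold)

lemma nc_mult_one_left: "nc_mult nc_one q = (q :: 'n ncps)"
proof
  fix \<omega> :: "'n list"
  have "nc_mult nc_one q \<omega> = (\<Sum>x\<in>{([] :: 'n list, \<omega>)}. nc_one (fst x) * q (snd x))"
    unfolding nc_mult_splits
    by (rule sum.mono_neutral_right) (auto simp: finite_splits mem_splits nc_one_def)
  thus "nc_mult nc_one q \<omega> = q \<omega>" by (simp add: nc_one_def)
qed

lemma nc_mult_assoc: "nc_mult (nc_mult p q) r = nc_mult p (nc_mult q r)"
proof
  fix \<omega>
  have "nc_mult (nc_mult p q) r \<omega> = (\<Sum>(x, y)\<in>(SIGMA x:splits \<omega>. splits (fst x)).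
      p (fst y) * q (snd y) * r (snd x))"
    unfolding nc_mult_splits
    by (subst sum.Sigma[symmetric]) (simp_all add: finite_splits sum_distrib_right)
  also have "\<dots> = (\<Sum>(x, y)\<in>(SIGMA x:splits \<omega>. splits (snd x)).
      p (fst x) * (q (fst y) * r (snd y)))"
    by (rule sum.reindex_bij_witness[where i = "\<lambda>((a, \<delta>), (b, c)). ((a @ b, c), (a, b))"
          and j = "\<lambda>((\<gamma>, c), (a, b)). ((a, b @ c), (b, c))"]) (auto simp: mult.assoc mem_splits)
  also have "\<dots> = nc_mult p (nc_mult q r) \<omega>"
    unfolding nc_mult_splits
    by (subst sum.Sigma[symmetric]) (simp_all add: finite_splits sum_distrib_left)
  finally show "nc_mult (nc_mult p q) r \<omega> = nc_mult p (nc_mult q r) \<omega>" .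
qed

lemma nc_word_append: "nc_word f (\<alpha> @ \<beta>) = nc_mult (nc_word f \<alpha>) (nc_word f \<beta>)"
  by (induction \<alpha>) (simp_all add: nc_mult_one_left nc_mult_assoc)

lemma nc_comp_finite:
  assumes "finite F" "\<And>\<alpha>. \<alpha> \<notin> F \<Longrightarrow> c \<alpha> * nc_word f \<alpha> \<omega> = 0"
  shows "nc_comp c f \<omega> = (\<Sum>\<alpha>\<in>F. c \<alpha> * nc_word f \<alpha> \<omega>)"
  unfolding nc_comp_def by (rule infsumI, rule has_sum_finite_neutralI[of F]) (use assms in auto)

lemma nc_comp_ket: "nc_comp (coef (ket \<beta>)) f = nc_word f \<beta>"
proof
  fix \<omega>
  have "nc_comp (coef (ket \<beta>)) f \<omega> = (\<Sum>\<alpha>\<in>{\<beta>}. coef (ket \<beta>) \<alpha> * nc_word f \<alpha> \<omega>)"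
    by (rule nc_comp_finite) (auto simp: ket.rep_eq)
  thus "nc_comp (coef (ket \<beta>)) f \<omega> = nc_word f \<beta> \<omega>" by (simp add: ket.rep_eq)
qed

text \<open>The finiteness assumption holds for polynomial a and for f(0) = 0. Under it the sums can
  be interchanged, and composition turns right multiplication by Z_\<beta> into right multiplication
  by f_\<beta>.\<close>

lemma nc_comp_shift:
  fixes f :: "'n \<Rightarrow> 'n ncps"
  assumes fin: "\<And>\<sigma>. finite {\<alpha>. a \<alpha> * nc_word f \<alpha> \<sigma> \<noteq> 0}" and sh: "is_shift \<beta> a c"
  shows "nc_comp c f = nc_mult (nc_comp a f) (nc_word f \<beta>)"
proof
  fix \<omega> :: "'n list"
  have c: "\<And>\<alpha>. c (\<alpha> @ \<beta>) = a \<alpha>" "\<And>\<omega>. \<omega> \<notin> range (\<lambda>\<alpha>. \<alpha> @ \<beta>) \<Longrightarrow> c \<omega> = 0"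
    using sh by (auto simp: is_shift_def)
  define S where "S = splits \<omega>"
  have S: "finite S" unfolding S_def by (rule finite_splits)
  \<comment> \<open>All words that contribute at some left factor of \<omega>, collected into one
    finite set for the exchange of sums.\<close>
  define F where "F = (\<Union>p\<in>S. {\<alpha>. a \<alpha> * nc_word f \<alpha> (fst p) \<noteq> 0})"
  have F: "finite F" unfolding F_def using S fin by blast
  have aF: "nc_comp a f (fst p) = (\<Sum>\<alpha>\<in>F. a \<alpha> * nc_word f \<alpha> (fst p))" if "p \<in> S" for p
    by (rule nc_comp_finite[OF F]) (use that in \<open>auto simp: F_def\<close>)
  have w: "nc_word f (\<alpha> @ \<beta>) \<omega> = (\<Sum>p\<in>S. nc_word f \<alpha> (fst p) * nc_word f \<beta> (snd p))" for \<alpha>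
    by (simp add: nc_word_append nc_mult_splits S_def)
  have "nc_comp c f \<omega> = (\<Sum>\<alpha>\<in>(\<lambda>\<alpha>. \<alpha> @ \<beta>) ` F. c \<alpha> * nc_word f \<alpha> \<omega>)"
  proof (rule nc_comp_finite)
    fix \<gamma> assume \<gamma>: "\<gamma> \<notin> (\<lambda>\<alpha>. \<alpha> @ \<beta>) ` F"
    show "c \<gamma> * nc_word f \<gamma> \<omega> = 0"
    proof (cases "\<gamma> \<in> range (\<lambda>\<alpha>. \<alpha> @ \<beta>)")
      case True
      then obtain \<alpha> where \<alpha>: "\<gamma> = \<alpha> @ \<beta>" by blast
      hence "\<alpha> \<notin> F" using \<gamma> by blast
      hence "a \<alpha> * nc_word f \<alpha> (fst p) = 0" if "p \<in> S" for p using that by (auto simp: F_def)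
      hence "(\<Sum>p\<in>S. a \<alpha> * nc_word f \<alpha> (fst p) * nc_word f \<beta> (snd p)) = 0"
        by (intro sum.neutral) auto
      thus ?thesis unfolding \<alpha> c(1) w by (simp add: sum_distrib_left mult.assoc)
    qed (simp add: c(2))
  qed (use F in simp)
  also have "\<dots> = (\<Sum>\<alpha>\<in>F. \<Sum>p\<in>S. a \<alpha> * nc_word f \<alpha> (fst p) * nc_word f \<beta> (snd p))"
    by (subst sum.reindex) (auto simp: inj_on_def c(1) w sum_distrib_left mult.assoc)
  also have "\<dots> = (\<Sum>p\<in>S. nc_comp a f (fst p) * nc_word f \<beta> (snd p))"
    by (subst sum.swap) (simp add: aF sum_distrib_right)
  also have "\<dots> = nc_mult (nc_comp a f) (nc_word f \<beta>) \<omega>"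
    by (simp add: nc_mult_splits S_def)
  finally show "nc_comp c f \<omega> = nc_mult (nc_comp a f) (nc_word f \<beta>) \<omega>" .
qed

lemma is_shift_polynomial:
  assumes "is_shift \<beta> a c" "nc_polynomial a"
  shows "nc_polynomial c"
proof -
  have "{\<omega>. c \<omega> \<noteq> 0} \<subseteq> (\<lambda>\<alpha>. \<alpha> @ \<beta>) ` {\<alpha>. a \<alpha> \<noteq> 0}"
  proof
    fix \<omega> assume "\<omega> \<in> {\<omega>. c \<omega> \<noteq> 0}"
    hence "c \<omega> \<noteq> 0" by simp
    moreover from this obtain \<alpha> where "\<omega> = \<alpha> @ \<beta>" using assms(1) unfolding is_shift_def by blast
    ultimately show "\<omega> \<in> (\<lambda>\<alpha>. \<alpha> @ \<beta>) ` {\<alpha>. a \<alpha> \<noteq> 0}" using assms(1) by (auto simp: is_shift_def)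
  qed
  thus ?thesis using assms(2) finite_subset unfolding nc_polynomial_def by blast
qed

subsection \<open>Invertible polynomial tuples\<close>

lemma nc_polynomial_mult:
  assumes "nc_polynomial p" "nc_polynomial q"
  shows "nc_polynomial (nc_mult p q)"
  unfolding nc_polynomial_def
proof (rule finite_subset)
  show "{\<omega>. nc_mult p q \<omega> \<noteq> 0} \<subseteq> (\<lambda>(\<alpha>, \<beta>). \<alpha> @ \<beta>) ` ({\<alpha>. p \<alpha> \<noteq> 0} \<times> {\<beta>. q \<beta> \<noteq> 0})"
  proof
    fix \<omega> assume "\<omega> \<in> {\<omega>. nc_mult p q \<omega> \<noteq> 0}"
    hence "(\<Sum>x\<in>splits \<omega>. p (fst x) * q (snd x)) \<noteq> 0" by (simp add: nc_mult_splits)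
    then obtain x where "x \<in> splits \<omega>" "p (fst x) * q (snd x) \<noteq> 0"
      by (rule sum.not_neutral_contains_not_neutral)
    hence "fst x @ snd x = \<omega>" "p (fst x) \<noteq> 0" "q (snd x) \<noteq> 0" by (auto simp: mem_splits)
    thus "\<omega> \<in> (\<lambda>(\<alpha>, \<beta>). \<alpha> @ \<beta>) ` ({\<alpha>. p \<alpha> \<noteq> 0} \<times> {\<beta>. q \<beta> \<noteq> 0})" by force
  qed
qed (use assms in \<open>auto simp: nc_polynomial_def\<close>)

lemma nc_polynomial_one: "nc_polynomial nc_one"
  unfolding nc_polynomial_def nc_one_def by (rule finite_subset[of _ "{[]}"]) auto

lemma nc_polynomial_word: "(\<And>i. nc_polynomial (f i)) \<Longrightarrow> nc_polynomial (nc_word f \<alpha>)"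
  by (induction \<alpha>) (simp_all add: nc_polynomial_one nc_polynomial_mult)

lemma nc_comp_polynomial:
  assumes "finite F" "\<And>\<alpha>. \<alpha> \<notin> F \<Longrightarrow> p \<alpha> = 0"
  shows "nc_comp p g \<omega> = (\<Sum>\<alpha>\<in>F. p \<alpha> * nc_word g \<alpha> \<omega>)"
  by (rule nc_comp_finite) (use assms in auto)

lemma nc_comp_mult:
  fixes p q :: "'n ncps"
  assumes p: "nc_polynomial p" and q: "nc_polynomial q"
  shows "nc_comp (nc_mult p q) g = nc_mult (nc_comp p g) (nc_comp q g)"
proof
  fix \<omega> :: "'n list"
  define P Q where "P = {\<alpha>. p \<alpha> \<noteq> 0}" and "Q = {\<alpha>. q \<alpha> \<noteq> 0}"
  have fin: "finite P" "finite Q" using p q by (auto simp: P_def Q_def nc_polynomial_def)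
  define S where "S = splits \<omega>"
  define G where "G = (\<lambda>(\<alpha>, \<beta>). \<alpha> @ \<beta>) ` (P \<times> Q)"
  have G: "finite G" using fin by (simp add: G_def)
  have pq: "nc_mult p q \<gamma> = (\<Sum>x\<in>{x \<in> P \<times> Q. fst x @ snd x = \<gamma>}. p (fst x) * q (snd x))" for \<gamma>
    unfolding nc_mult_splits
    by (rule sum.mono_neutral_right) (auto simp: finite_splits mem_splits P_def Q_def)
  have "nc_comp (nc_mult p q) g \<omega> = (\<Sum>\<gamma>\<in>G. nc_mult p q \<gamma> * nc_word g \<gamma> \<omega>)"
  proof (rule nc_comp_polynomial[OF G])
    fix \<gamma> assume "\<gamma> \<notin> G"
    hence "{x \<in> P \<times> Q. fst x @ snd x = \<gamma>} = {}" by (force simp: G_def)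
    thus "nc_mult p q \<gamma> = 0" unfolding pq by (simp only: sum.empty)
  qed
  also have "\<dots> = (\<Sum>\<gamma>\<in>G. \<Sum>x\<in>{x \<in> P \<times> Q. fst x @ snd x = \<gamma>}.
      p (fst x) * q (snd x) * nc_word g (fst x @ snd x) \<omega>)"
    unfolding pq sum_distrib_right by (intro sum.cong refl) auto
  \<comment> \<open>Pairs in P \<times> Q are grouped by their concatenation.\<close>
  also have "\<dots> = (\<Sum>x\<in>P \<times> Q. p (fst x) * q (snd x) * nc_word g (fst x @ snd x) \<omega>)"
    by (rule sum.group) (use fin G in \<open>auto simp: G_def\<close>)
  also have "\<dots> = (\<Sum>x\<in>P \<times> Q. \<Sum>y\<in>S. p (fst x) * nc_word g (fst x) (fst y) * (q (snd x) * nc_word g (snd x) (snd y)))"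
    unfolding nc_word_append nc_mult_splits S_def by (simp add: sum_distrib_left mult_ac)
  also have "\<dots> = (\<Sum>y\<in>S. \<Sum>x\<in>P \<times> Q. p (fst x) * nc_word g (fst x) (fst y) * (q (snd x) * nc_word g (snd x) (snd y)))"
    by (rule sum.swap)
  also have "\<dots> = (\<Sum>y\<in>S. (\<Sum>\<alpha>\<in>P. p \<alpha> * nc_word g \<alpha> (fst y)) * (\<Sum>\<beta>\<in>Q. q \<beta> * nc_word g \<beta> (snd y)))"
    by (simp add: sum_product sum.cartesian_product case_prod_unfold)
  also have "\<dots> = nc_mult (nc_comp p g) (nc_comp q g) \<omega>"
    unfolding nc_mult_splits S_def
    by (intro sum.cong refl arg_cong2[where f = "(*)"] nc_comp_polynomial[symmetric] fin)
      (simp_all add: P_def Q_def)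
  finally show "nc_comp (nc_mult p q) g \<omega> = nc_mult (nc_comp p g) (nc_comp q g) \<omega>" .
qed

lemma nc_comp_one: "nc_comp nc_one g = nc_one"
proof
  fix \<omega>
  have "nc_comp nc_one g \<omega> = (\<Sum>\<alpha>\<in>{[]}. nc_one \<alpha> * nc_word g \<alpha> \<omega>)"
    by (rule nc_comp_polynomial) (auto simp: nc_one_def)
  thus "nc_comp nc_one g \<omega> = nc_one \<omega>" by (simp add: nc_one_def)
qed

lemma nc_comp_word:
  assumes "\<And>i. nc_polynomial (f i)"
  shows "nc_comp (nc_word f \<alpha>) g = nc_word (\<lambda>i. nc_comp (f i) g) \<alpha>"
  by (induction \<alpha>) (simp_all add: nc_comp_one nc_comp_mult nc_polynomial_word assms)

lemma nc_word_var: "nc_word nc_var \<alpha> = (\<lambda>\<omega>. if \<omega> = \<alpha> then 1 else 0)"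
proof (induction \<alpha>)
  case (Cons i \<alpha>)
  show ?case
  proof
    fix \<omega>
    have "nc_mult (nc_var i) (nc_word nc_var \<alpha>) \<omega> = (\<Sum>x\<in>splits \<omega> \<inter> {([i], \<alpha>)}. 1)"
      unfolding nc_mult_splits Cons nc_var_def
      by (rule sum.mono_neutral_cong_right) (auto simp: finite_splits)
    thus "nc_word nc_var (i # \<alpha>) \<omega> = (if \<omega> = i # \<alpha> then 1 else 0)" by (auto simp: mem_splits)
  qed
qed (simp add: nc_one_def)

text \<open>Composition with g is multiplicative on polynomials and sends f_\<alpha> to Z_\<alpha>,
  so it undoes composition with f; this serves as injectivity of the latter.\<close>

lemma nc_comp_polynomial_inverse:
  assumes f: "\<And>i. nc_polynomial (f i)" and c: "nc_polynomial c" and fg: "\<And>i. nc_comp (f i) g = nc_var i"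
  shows "nc_comp (nc_comp c f) g = c"
proof
  fix \<omega>
  define C where "C = {\<alpha>. c \<alpha> \<noteq> 0}"
  have C: "finite C" using c by (simp add: C_def nc_polynomial_def)
  have cf: "nc_comp c f \<sigma> = (\<Sum>\<alpha>\<in>C. c \<alpha> * nc_word f \<alpha> \<sigma>)" for \<sigma>
    by (rule nc_comp_polynomial[OF C]) (simp add: C_def)
  define G where "G = (\<Union>\<alpha>\<in>C. {\<sigma>. nc_word f \<alpha> \<sigma> \<noteq> 0})"
  have G: "finite G"
    using C nc_polynomial_word[of f, OF f] by (auto simp: G_def nc_polynomial_def)
  have "nc_comp (nc_comp c f) g \<omega> = (\<Sum>\<sigma>\<in>G. (\<Sum>\<alpha>\<in>C. c \<alpha> * nc_word f \<alpha> \<sigma>) * nc_word g \<sigma> \<omega>)"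
    by (subst nc_comp_polynomial[OF G]) (auto simp: cf G_def intro!: sum.neutral)
  also have "\<dots> = (\<Sum>\<alpha>\<in>C. c \<alpha> * (\<Sum>\<sigma>\<in>G. nc_word f \<alpha> \<sigma> * nc_word g \<sigma> \<omega>))"
    unfolding sum_distrib_right sum_distrib_left by (subst sum.swap) (simp add: mult.assoc)
  also have "\<dots> = (\<Sum>\<alpha>\<in>C. c \<alpha> * nc_comp (nc_word f \<alpha>) g \<omega>)"
  proof (intro sum.cong refl arg_cong2[where f = "(*)"])
    fix \<alpha> assume "\<alpha> \<in> C"
    thus "(\<Sum>\<sigma>\<in>G. nc_word f \<alpha> \<sigma> * nc_word g \<sigma> \<omega>) = nc_comp (nc_word f \<alpha>) g \<omega>"
      by (intro nc_comp_polynomial[OF G, symmetric]) (auto simp: G_def)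
  qed
  also have "\<dots> = (\<Sum>\<alpha>\<in>C. if \<omega> = \<alpha> then c \<alpha> else 0)"
    by (intro sum.cong refl) (simp add: nc_comp_word[of f, OF f] fg nc_word_var)
  also have "\<dots> = c \<omega>" using C by (simp add: C_def)
  finally show "nc_comp (nc_comp c f) g \<omega> = c \<omega>" .
qed

text \<open>M_i e_\<beta> and the shifted coefficients of Z_i are both polynomials that compose with
  f to Z_i f_\<beta>; the inverse tuple leaves only one such polynomial.\<close>

lemma model_poly_shift:
  assumes "model_poly f a M"
  shows "bounded_clinear (M i)" "is_shift \<beta> (coef (a i)) (coef (M i (ket \<beta>)))"
proof -
  obtain g where f: "\<And>i. nc_polynomial (f i)" and fg: "\<And>i. nc_comp (f i) g = nc_var i"
    and a: "nc_polynomial (coef (a i))" "nc_comp (coef (a i)) f = nc_var i"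
    and L: "lmult_poly f (nc_var i) (M i)"
    using assms unfolding model_poly_def by blast
  show "bounded_clinear (M i)" using L by (simp add: lmult_poly_def)
  have "nc_polynomial (coef (ket \<beta>))"
    unfolding nc_polynomial_def by (rule finite_subset[of _ "{\<beta>}"]) (auto simp: ket.rep_eq)
  hence M: "nc_polynomial (coef (M i (ket \<beta>)))"
      "nc_comp (coef (M i (ket \<beta>))) f = nc_mult (nc_var i) (nc_comp (coef (ket \<beta>)) f)"
    using L unfolding lmult_poly_def by blast+
  define c where "c = coef (l2_push (\<lambda>\<alpha>. \<alpha> @ \<beta>) (a i))"
  have c: "is_shift \<beta> (coef (a i)) c" unfolding c_def by (rule is_shift_push)
  have "finite {\<alpha>. coef (a i) \<alpha> * nc_word f \<alpha> \<sigma> \<noteq> 0}" for \<sigma>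
    by (rule finite_subset[OF _ a(1)[unfolded nc_polynomial_def]]) auto
  from nc_comp_shift[OF this c] M(2) have "nc_comp (coef (M i (ket \<beta>))) f = nc_comp c f"
    by (simp add: a nc_comp_ket)
  hence "coef (M i (ket \<beta>)) = c"
    by (metis nc_comp_polynomial_inverse[of f, OF f _ fg] M(1) is_shift_polynomial[OF c a(1)])
  thus "is_shift \<beta> (coef (a i)) (coef (M i (ket \<beta>)))" using c by simp
qed

subsection \<open>Formal power series with invertible linear part\<close>

text \<open>Each factor of f_\<alpha> has zero constant term and so uses up at least one
  letter.\<close>

lemma nc_word_low:
  assumes "\<And>j. f j [] = 0" and "length \<omega> < length \<alpha>"
  shows "nc_word f \<alpha> \<omega> = 0"
  using assms(2)
proof (induction \<alpha> arbitrary: \<omega>)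
  case (Cons i \<alpha>)
  have "f i \<sigma> * nc_word f \<alpha> \<tau> = 0" if "\<sigma> @ \<tau> = \<omega>" for \<sigma> \<tau>
  proof (cases "\<sigma> = []")
    case False
    hence "length \<tau> < length \<alpha>" using Cons.prems that by (cases \<sigma>) auto
    thus ?thesis using Cons.IH by simp
  qed (simp add: assms(1))
  thus ?case by (auto simp: nc_mult_splits mem_splits intro!: sum.neutral)
qed simp

text \<open>In lowest degree every factor uses exactly one letter, so only linear parts
  survive.\<close>

lemma nc_word_top_Cons:
  assumes f: "\<And>j. f j [] = 0" and "length \<omega> = length \<alpha>"
  shows "nc_word f (i # \<alpha>) (j # \<omega>) = f i [j] * nc_word f \<alpha> \<omega>"
proof -
  have "nc_word f (i # \<alpha>) (j # \<omega>) = (\<Sum>x\<in>{([j], \<omega>)}. f i (fst x) * nc_word f \<alpha> (snd x))"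
    unfolding nc_word.simps nc_mult_splits
  proof (rule sum.mono_neutral_right)
    show "\<forall>x\<in>splits (j # \<omega>) - {([j], \<omega>)}. f i (fst x) * nc_word f \<alpha> (snd x) = 0"
    proof
      fix x assume x: "x \<in> splits (j # \<omega>) - {([j], \<omega>)}"
      show "f i (fst x) * nc_word f \<alpha> (snd x) = 0"
      proof (cases "fst x")
        case (Cons k \<sigma>)
        hence "\<sigma> \<noteq> []" "\<sigma> @ snd x = \<omega>" using x by (auto simp: mem_splits prod_eq_iff)
        hence "length (snd x) < length \<alpha>" using assms(2) by (cases \<sigma>) auto
        thus ?thesis by (simp add: nc_word_low[of f, OF f])
      qed (simp add: f)
    qed
  qed (auto simp: finite_splits mem_splits)
  thus ?thesis by simp
qed

text \<open>The sums run over the first index of the Jacobian, so the trivial kernel of its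
  transpose is what is required.\<close>

lemma jacobian_kernel:
  fixes f :: "'n::finite \<Rightarrow> 'n ncps"
  assumes J: "det (nc_jacobian0 f) \<noteq> 0" and d: "\<And>j. (\<Sum>i\<in>UNIV. d i * f i [j]) = 0"
  shows "d i = 0"
proof -
  have "invertible (transpose (nc_jacobian0 f))"
    using J by (simp add: invertible_det_nz det_transpose)
  then obtain B where B: "B ** transpose (nc_jacobian0 f) = mat 1" unfolding invertible_def by blast
  have "transpose (nc_jacobian0 f) *v (\<chi> i. d i) = 0"
    using d by (simp add: vec_eq_iff matrix_vector_mult_def transpose_def nc_jacobian0_def mult.commute)
  hence "(B ** transpose (nc_jacobian0 f)) *v (\<chi> i. d i) = 0"
    by (simp flip: matrix_vector_mul_assoc)
  thus ?thesis by (simp add: B vec_eq_iff)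
qed

lemma sum_words_Cons:
  fixes F :: "'n::finite list \<Rightarrow> 'b::comm_monoid_add"
  shows "(\<Sum>\<alpha> | length \<alpha> = Suc k. F \<alpha>) = (\<Sum>\<alpha> | length \<alpha> = k. \<Sum>i\<in>UNIV. F (i # \<alpha>))"
proof -
  have "(\<Sum>\<alpha> | length \<alpha> = k. \<Sum>i\<in>UNIV. F (i # \<alpha>))
      = (\<Sum>(\<alpha>, i)\<in>{\<alpha>. length \<alpha> = k} \<times> UNIV. F (i # \<alpha>))"
    by (simp add: sum.cartesian_product)
  also have "\<dots> = (\<Sum>\<alpha> | length \<alpha> = Suc k. F \<alpha>)"
    by (rule sum.reindex_bij_witness[where j = "\<lambda>(\<alpha>, i). i # \<alpha>" and i = "\<lambda>\<alpha>. (tl \<alpha>, hd \<alpha>)"])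
      (auto simp: length_Suc_conv)
  finally show ?thesis ..
qed

text \<open>The lowest-degree parts of the f_\<alpha> with |\<alpha>| = m form the m-fold tensor
  power of the Jacobian; the induction inverts one factor at a time, beginning with the first
  letter.\<close>

lemma top_part_inj:
  fixes f :: "'n::finite \<Rightarrow> 'n ncps"
  assumes f: "\<And>j. f j [] = 0" and J: "det (nc_jacobian0 f) \<noteq> 0"
    and z: "\<And>\<omega>. length \<omega> = m \<Longrightarrow> (\<Sum>\<alpha> | length \<alpha> = m. c \<alpha> * nc_word f \<alpha> \<omega>) = 0"
    and \<alpha>: "length \<alpha> = m"
  shows "c \<alpha> = 0"
  using z \<alpha>
proof (induction m arbitrary: c \<alpha>)
  case 0
  show ?case using "0.prems"(1)[of "[]"] "0.prems"(2) by (simp add: words_0 nc_one_def)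
next
  case (Suc m)
  obtain i \<beta> where \<alpha>: "\<alpha> = i # \<beta>" "length \<beta> = m" using Suc.prems(2) by (cases \<alpha>) auto
  \<comment> \<open>For fixed j the first letter is contracted against column j of the Jacobian; the
    remaining letters fall under the induction hypothesis.\<close>
  have "(\<Sum>i\<in>UNIV. c (i # \<beta>) * f i [j]) = 0" for j
  proof (rule Suc.IH[of "\<lambda>\<beta>. \<Sum>i\<in>UNIV. c (i # \<beta>) * f i [j]"])
    fix \<omega> :: "'n list" assume \<omega>: "length \<omega> = m"
    have "0 = (\<Sum>\<alpha> | length \<alpha> = m. \<Sum>i\<in>UNIV. c (i # \<alpha>) * nc_word f (i # \<alpha>) (j # \<omega>))"
      using Suc.prems(1)[of "j # \<omega>"] \<omega> unfolding sum_words_Cons by simp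
    also have "\<dots> = (\<Sum>\<alpha> | length \<alpha> = m. (\<Sum>i\<in>UNIV. c (i # \<alpha>) * f i [j]) * nc_word f \<alpha> \<omega>)"
      by (intro sum.cong refl)
        (simp add: nc_word_top_Cons[of f, OF f] \<omega> sum_distrib_right mult.assoc del: nc_word.simps)
    finally show "(\<Sum>\<alpha> | length \<alpha> = m. (\<Sum>i\<in>UNIV. c (i # \<alpha>) * f i [j]) * nc_word f \<alpha> \<omega>) = 0" by simp
  qed (rule \<alpha>(2))
  from jacobian_kernel[OF J this] show ?case by (simp add: \<alpha>)
qed

lemma nc_comp_truncate:
  fixes f :: "'n::finite \<Rightarrow> 'n ncps"
  assumes f: "\<And>j. f j [] = 0"
  shows "nc_comp c f \<omega> = (\<Sum>\<alpha> | length \<alpha> < Suc (length \<omega>). c \<alpha> * nc_word f \<alpha> \<omega>)"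
  by (rule nc_comp_finite[OF finite_words_less]) (auto simp: nc_word_low[of f, OF f])

text \<open>Triangularity in the degree: if the difference vanishes on words shorter than m, its
  composition in degree m sees only words of length m, since longer f_\<alpha> start later.\<close>

lemma nc_comp_inj:
  fixes f :: "'n::finite \<Rightarrow> 'n ncps"
  assumes f: "\<And>j. f j [] = 0" and J: "det (nc_jacobian0 f) \<noteq> 0"
    and eq: "nc_comp c f = nc_comp c' f"
  shows "c = c'"
proof
  fix \<alpha>
  define e where "e \<alpha> = c \<alpha> - c' \<alpha>" for \<alpha>
  have "e \<alpha> = 0"
  proof (induction "length \<alpha>" arbitrary: \<alpha> rule: less_induct)
    case less
    define m where "m = length \<alpha>"
    show "e \<alpha> = 0"
    proof (rule top_part_inj[OF f J])
      fix \<omega> :: "'n list" assume \<omega>: "length \<omega> = m"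
      have "0 = nc_comp c f \<omega> - nc_comp c' f \<omega>" using eq by simp
      also have "\<dots> = (\<Sum>\<alpha> | length \<alpha> < Suc m. e \<alpha> * nc_word f \<alpha> \<omega>)"
        unfolding nc_comp_truncate[of f, OF f] \<omega> e_def by (simp add: left_diff_distrib sum_subtractf)
      also have "\<dots> = (\<Sum>\<alpha> | length \<alpha> = m. e \<alpha> * nc_word f \<alpha> \<omega>)"
      proof (rule sum.mono_neutral_right[OF finite_words_less])
        show "\<forall>\<beta>\<in>{\<alpha>. length \<alpha> < Suc m} - {\<alpha>. length \<alpha> = m}. e \<beta> * nc_word f \<beta> \<omega> = 0"
          using less by (auto simp: m_def)
      qed auto
      finally show "(\<Sum>\<alpha> | length \<alpha> = m. e \<alpha> * nc_word f \<alpha> \<omega>) = 0" by simp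
    qed (simp add: m_def)
  qed
  thus "c \<alpha> = c' \<alpha>" by (simp add: e_def)
qed

lemma model_series_shift:
  assumes "model_series f a M"
  shows "bounded_clinear (M i)" "is_shift \<beta> (coef (a i)) (coef (M i (ket \<beta>)))"
proof -
  have f: "\<And>j. f j [] = 0" and J: "det (nc_jacobian0 f) \<noteq> 0"
    and a: "nc_comp (coef (a i)) f = nc_var i" and L: "lmult_series f (nc_var i) (M i)"
    using assms unfolding model_series_def by blast+
  show "bounded_clinear (M i)" using L by (simp add: lmult_series_def)
  define c where "c = coef (l2_push (\<lambda>\<alpha>. \<alpha> @ \<beta>) (a i))"
  have c: "is_shift \<beta> (coef (a i)) c" unfolding c_def by (rule is_shift_push)
  have "finite {\<alpha>. coef (a i) \<alpha> * nc_word f \<alpha> \<sigma> \<noteq> 0}" for \<sigma>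
    by (rule finite_subset[OF _ finite_words_less[of "Suc (length \<sigma>)"]])
      (use nc_word_low[of f, OF f] in \<open>auto simp: not_less_eq[symmetric]\<close>)
  from nc_comp_shift[OF this c] have "nc_comp (coef (M i (ket \<beta>))) f = nc_comp c f"
    using L by (simp add: a nc_comp_ket lmult_series_def)
  hence "coef (M i (ket \<beta>)) = c" by (rule nc_comp_inj[OF f J])
  thus "is_shift \<beta> (coef (a i)) (coef (M i (ket \<beta>)))" using c by simp
qed

subsection \<open>Free holomorphic functions\<close>

text \<open>The row of all Y_\<alpha> with |\<alpha>| = k arises by iterating the row of Y, which
  multiplies the norm bounds. Vectors varying with \<alpha> allow the induction to split off the
  first letter.\<close>

lemma norm_word_sum_le:
  fixes Y :: "'n::finite \<Rightarrow> 'h::chilbert \<Rightarrow> 'h"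
  assumes Y: "\<And>i. bounded_clinear (Y i)"
  shows "(norm (\<Sum>\<alpha> | length \<alpha> = k. op_word Y \<alpha> (v \<alpha>)))\<^sup>2
    \<le> (onorm (row_op Y) ^ k)\<^sup>2 * (\<Sum>\<alpha> | length \<alpha> = k. (norm (v \<alpha>))\<^sup>2)"
proof (induction k arbitrary: v)
  case 0
  show ?case by (simp add: words_0)
next
  case (Suc k)
  let ?\<rho> = "onorm (row_op Y)"
  have bl: "bounded_linear (row_op Y)"
    by (rule bounded_clinear_bounded_linear[OF bounded_clinear_row_op[OF Y]])
  define S where "S i = (\<Sum>\<alpha> | length \<alpha> = k. op_word Y \<alpha> (v (i # \<alpha>)))" for i
  have "(\<Sum>\<alpha> | length \<alpha> = Suc k. op_word Y \<alpha> (v \<alpha>)) = row_op Y (\<chi> i. S i)"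
    unfolding sum_words_Cons row_op_def S_def
    by (subst sum.swap) (simp add: bounded_clinear_sum[OF Y])
  hence "(norm (\<Sum>\<alpha> | length \<alpha> = Suc k. op_word Y \<alpha> (v \<alpha>)))\<^sup>2 \<le> (?\<rho> * norm (\<chi> i. S i))\<^sup>2"
    using onorm[OF bl] by (intro power_mono) auto
  also have "\<dots> = ?\<rho>\<^sup>2 * (\<Sum>i\<in>UNIV. (norm (S i))\<^sup>2)"
    by (simp add: power_mult_distrib norm_vec_sq)
  also have "\<dots> \<le> ?\<rho>\<^sup>2 * (\<Sum>i\<in>UNIV. (?\<rho> ^ k)\<^sup>2 * (\<Sum>\<alpha> | length \<alpha> = k. (norm (v (i # \<alpha>)))\<^sup>2))"
    unfolding S_def by (intro mult_left_mono sum_mono Suc) auto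
  also have "\<dots> = (?\<rho> ^ Suc k)\<^sup>2 * (\<Sum>\<alpha> | length \<alpha> = Suc k. (norm (v \<alpha>))\<^sup>2)"
    unfolding sum_words_Cons
    by (subst sum.swap) (simp add: power_mult_distrib mult.assoc flip: sum_distrib_left)
  finally show ?case .
qed

lemma level_le_norm:
  fixes u :: "'n::finite h2"
  shows "(\<Sum>\<alpha> | length \<alpha> = k. (cmod (coef u \<alpha>))\<^sup>2) \<le> (norm u)\<^sup>2"
  unfolding norm_l2_sq by (rule finite_sum_le_infsum[OF l2_summable]) (auto simp: finite_words)

text \<open>With the vectors c_\<alpha> x in \<open>norm_word_sum_le\<close>, the degree-k part
  decays geometrically, as each level of u has norm at most that of u.\<close>

lemma hom_part_summable:
  fixes Y :: "'n::finite \<Rightarrow> 'h::chilbert \<Rightarrow> 'h" and u :: "'n h2"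
  assumes "Y \<in> row_ball 1"
  shows "summable (\<lambda>k. hom_part (coef u) Y k x)"
proof (rule summable_comparison_test')
  let ?\<rho> = "onorm (row_op Y)"
  have Y: "\<And>i. bounded_clinear (Y i)" and lt: "?\<rho> < 1" using assms by (auto simp: row_ball_def)
  have \<rho>: "0 \<le> ?\<rho>"
    by (rule onorm_pos_le[OF bounded_clinear_bounded_linear[OF bounded_clinear_row_op[OF Y]]])
  show "summable (\<lambda>k. ?\<rho> ^ k * (norm u * norm x))"
    by (intro summable_mult2 summable_geometric) (use \<rho> lt in simp)
  fix k :: nat
  show "norm (hom_part (coef u) Y k x) \<le> ?\<rho> ^ k * (norm u * norm x)"
  proof (rule power2_le_imp_le)
    have "(norm (hom_part (coef u) Y k x))\<^sup>2
        = (norm (\<Sum>\<alpha> | length \<alpha> = k. op_word Y \<alpha> (coef u \<alpha> *\<^sub>C x)))\<^sup>2"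
      by (simp add: hom_part_def bounded_clinear_scaleC[OF bounded_clinear_op_word[OF Y]])
    also have "\<dots> \<le> (?\<rho> ^ k)\<^sup>2 * (\<Sum>\<alpha> | length \<alpha> = k. (norm (coef u \<alpha> *\<^sub>C x))\<^sup>2)"
      by (rule norm_word_sum_le[OF Y])
    also have "(\<Sum>\<alpha> | length \<alpha> = k. (norm (coef u \<alpha> *\<^sub>C x))\<^sup>2)
        = (\<Sum>\<alpha> | length \<alpha> = k. (cmod (coef u \<alpha>))\<^sup>2) * (norm x)\<^sup>2"
      by (simp add: norm_scaleC power_mult_distrib sum_distrib_right)
    also have "(?\<rho> ^ k)\<^sup>2 * \<dots> \<le> (?\<rho> ^ k)\<^sup>2 * ((norm u)\<^sup>2 * (norm x)\<^sup>2)"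
      by (intro mult_left_mono mult_right_mono level_le_norm) auto
    finally show "(norm (hom_part (coef u) Y k x))\<^sup>2 \<le> (?\<rho> ^ k * (norm u * norm x))\<^sup>2"
      by (simp add: power_mult_distrib)
  qed (use \<rho> in simp)
qed

text \<open>Level norms are bounded, so the series converges for r < 1. This makes square summable
  families admissible in the nondegeneracy condition of \<open>model_holo\<close>.\<close>

lemma nc_radius_l2:
  fixes u :: "'n::finite h2"
  shows "1 \<le> nc_radius (coef u)"
  unfolding nc_radius_def
proof (rule conv_radius_geI_ex)
  fix r :: real assume r: "0 < r" "ereal r < 1"
  have "summable (\<lambda>k. sqrt (\<Sum>\<alpha> | length \<alpha> = k. (cmod (coef u \<alpha>))\<^sup>2) * r ^ k)"
  proof (rule summable_comparison_test')
    show "summable (\<lambda>k. norm u * r ^ k)" by (intro summable_mult summable_geometric) (use r in simp)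
    fix k :: nat
    have "sqrt (\<Sum>\<alpha> | length \<alpha> = k. (cmod (coef u \<alpha>))\<^sup>2) \<le> norm u"
      by (rule real_le_lsqrt) (simp_all add: level_le_norm)
    thus "norm (sqrt (\<Sum>\<alpha> | length \<alpha> = k. (cmod (coef u \<alpha>))\<^sup>2) * r ^ k) \<le> norm u * r ^ k"
      using r by (simp add: abs_mult sum_nonneg mult_right_mono)
  qed
  thus "\<exists>z. norm z = r \<and> summable (\<lambda>k. sqrt (\<Sum>\<alpha> | length \<alpha> = k. (cmod (coef u \<alpha>))\<^sup>2) * z ^ k)"
    using r by (intro exI[of _ r]) simp
qed

lemma nc_eval_ket: "nc_eval (coef (ket \<beta>)) X = op_word X \<beta>"
proof
  fix x
  have "hom_part (coef (ket \<beta>)) X k x = (if k = length \<beta> then op_word X \<beta> x else 0)" for k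
  proof -
    have "hom_part (coef (ket \<beta>)) X k x = (\<Sum>\<alpha> | length \<alpha> = k. if \<alpha> = \<beta> then op_word X \<beta> x else 0)"
      unfolding hom_part_def by (intro sum.cong refl) (simp add: ket.rep_eq)
    thus ?thesis by (simp add: sum.delta[OF finite_words])
  qed
  hence "(\<lambda>k. hom_part (coef (ket \<beta>)) X k x) sums op_word X \<beta> x"
    using sums_single[of "length \<beta>" "\<lambda>k. op_word X \<beta> x"] by simp
  thus "nc_eval (coef (ket \<beta>)) X x = op_word X \<beta> x" by (simp add: nc_eval_def sums_iff)
qed

lemma nc_var_ket: "nc_var i = coef (ket [i])"
  by (rule ext) (simp add: nc_var_def ket.rep_eq)

text \<open>At Y = f(X) in the unit ball, M_i e_\<beta> and the shifted coefficients of Z_i have the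
  same value for every X; nondegeneracy turns vanishing of their difference after composition with f
  into equality of coefficients.\<close>

lemma model_holo_shift:
  assumes "model_holo f a M"
  shows "bounded_clinear (M i)" "is_shift \<beta> (coef (a i)) (coef (M i (ket \<beta>)))"
proof -
  obtain \<gamma> where ball: "\<And>X. X \<in> row_ball \<gamma> \<Longrightarrow> ball_map f X \<in> row_ball 1"
    and inj: "\<And>G. 1 \<le> nc_radius G \<Longrightarrow> G \<noteq> (\<lambda>_. 0) \<Longrightarrow>
        \<exists>X\<in>row_ball \<gamma>. nc_eval G (ball_map f X) \<noteq> (\<lambda>_. 0)"
    and a: "\<And>X. X \<in> row_ball \<gamma> \<Longrightarrow> nc_eval (coef (a i)) (ball_map f X) = X i"
    and L: "lmult_holo \<gamma> f (nc_var i) (M i)"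
    using assms unfolding model_holo_def by blast
  show "bounded_clinear (M i)" using L by (simp add: lmult_holo_def)
  define s where "s = l2_push (\<lambda>\<alpha>. \<alpha> @ \<beta>) (a i)"
  have s: "is_shift \<beta> (coef (a i)) (coef s)" unfolding s_def by (rule is_shift_push)
  have "nc_eval (coef (M i (ket \<beta>) - s)) (ball_map f X) = (\<lambda>_. 0)" if X: "X \<in> row_ball \<gamma>" for X
  proof
    fix x
    define Y where "Y = ball_map f X"
    have Y: "Y \<in> row_ball 1" unfolding Y_def by (rule ball[OF X])
    note sm = summable_sums[OF hom_part_summable[OF Y]]
    have "nc_eval (coef (M i (ket \<beta>))) Y = nc_eval (nc_var i) X \<circ> nc_eval (coef (ket \<beta>)) Y"
      using L X unfolding lmult_holo_def Y_def by blast
    \<comment> \<open>The multiplier Z_i takes the value X_i, which is the series of a^i at Y; both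
      sides are then series in Y.\<close>
    also have "nc_eval (nc_var i) X = nc_eval (coef (a i)) Y"
      unfolding nc_var_ket nc_eval_ket using a[OF X] by (simp add: Y_def)
    finally have "nc_eval (coef (M i (ket \<beta>))) Y x = nc_eval (coef (a i)) Y (op_word Y \<beta> x)"
      by (simp add: nc_eval_ket)
    moreover have "(\<lambda>k. hom_part (coef (M i (ket \<beta>))) Y k x) sums nc_eval (coef (M i (ket \<beta>))) Y x"
      unfolding nc_eval_def by (rule sm)
    ultimately have "(\<lambda>k. hom_part (coef (M i (ket \<beta>))) Y k x) sums nc_eval (coef (a i)) Y (op_word Y \<beta> x)"
      by simp
    moreover have "(\<lambda>k. hom_part (coef s) Y k x) sums nc_eval (coef (a i)) Y (op_word Y \<beta> x)"
      unfolding hom_part_shift_sums[OF s] nc_eval_def by (rule sm)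
    ultimately have "(\<lambda>k. hom_part (coef (M i (ket \<beta>))) Y k x - hom_part (coef s) Y k x) sums 0"
      using sums_diff by fastforce
    moreover have "hom_part (coef (M i (ket \<beta>))) Y k x - hom_part (coef s) Y k x
        = hom_part (coef (M i (ket \<beta>) - s)) Y k x" for k
    proof -
      have "(p - q) *\<^sub>C y = p *\<^sub>C y - q *\<^sub>C y" for p q and y :: "(nat, complex) l2"
        using scaleC_add_left[of "p - q" q y] by simp
      thus ?thesis by (simp add: hom_part_def minus_l2.rep_eq sum_subtractf)
    qed
    ultimately show "nc_eval (coef (M i (ket \<beta>) - s)) (ball_map f X) x = 0"
      by (simp add: nc_eval_def Y_def sums_iff)
  qed
  hence "coef (M i (ket \<beta>) - s) = (\<lambda>_. 0)" using inj[OF nc_radius_l2] by blast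
  hence "coef (M i (ket \<beta>)) = coef s" by (simp add: minus_l2.rep_eq fun_eq_iff)
  thus "is_shift \<beta> (coef (a i)) (coef (M i (ket \<beta>)))" using s by simp
qed

theorem theorem7p2:
  fixes f :: "'n::finite \<Rightarrow> 'n ncps"
    and a :: "'n \<Rightarrow> 'n h2"
    and M :: "'n \<Rightarrow> 'n h2 \<Rightarrow> 'n h2"
    and T :: "'n \<Rightarrow> 'h::chilbert \<Rightarrow> 'h"
  assumes "model_property f a M"
    and "T \<in> nc_domain f a"
    and "pure_tuple f T"
  shows "isometry_between (tens_space (defect_star_space f T)) (tens_space (defect_space f T))
           (char_fun f T)
         \<and> unitarily_equiv_on T (model_space f T)
             (\<lambda>i x. orth_proj (model_space f T) (op_tensor (M i) id x))"
proof (rule model_theorem[OF _ _ assms(2,3)])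
  show "bounded_clinear (M i)" for i
    using assms(1) model_poly_shift(1) model_series_shift(1) model_holo_shift(1)
    unfolding model_property_def by blast
  fix i \<beta>
  have "is_shift \<beta> (coef (a i)) (coef (M i (ket \<beta>)))"
    using assms(1) model_poly_shift(2) model_series_shift(2) model_holo_shift(2)
    unfolding model_property_def by blast
  hence "coef (M i (ket \<beta>)) = coef (l2_push (\<lambda>\<alpha>. \<alpha> @ \<beta>) (a i))"
    by (rule is_shift_unique[OF _ is_shift_push])
  thus "M i (ket \<beta>) = l2_push (\<lambda>\<alpha>. \<alpha> @ \<beta>) (a i)" by (simp only: coef_inject)
qed

end
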